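(* Let $Q$ be a Dynkin quiver with vertices $1,\dots,n$, $k$ a source of $Q$, $\mathbf d$ a dimension vector and ${\boldsymbol\nu}=(\nu^i)$ with $\nu^i\vdash d_i$. Let $\lambda=\nu^k$ and $\mu=\nu^{\mathrm{adj}(k)}$ and suppose $\lambda$ and $\mu$ are $t$-interlaced for some $t\ge0$. Let $V\simeq\operatorname{GenRep}({\boldsymbol\nu})$. Then $R^-_k(V)\simeq\operatorname{GenRep}(\sigma_k({\boldsymbol\nu}))$.
   Context: $\Bbbk$ algebraically closed; Dynkin quiver: underlying graph a simply-laced Dynkin diagram. For ${\boldsymbol\nu}\vdash\mathbf d$ and a quiver $\Gamma$ of Dynkin type, fix nilpotent operators $N_i$ on spaces of dimension $d_i$ with Jordan types $\nu^i$; among the representations of $\Gamma$ on these spaces compatible with $N$ ($N_{t(a)}f_a=f_aN_{s(a)}$ for all arrows), there is a dense open subset of pairwise isomorphic representations; $\operatorname{GenRep}({\boldsymbol\nu})$ denotes this isomorphism class. $R^-_k$ is the BGP reflection functor at the source $k$: $R^-_k(V)$ is the representation of $\sigma_k(Q)$ (arrows at $k$ reversed) with $R^-_k(V)_i=V_i$ for $i\neq k$, $R^-_k(V)_k=\operatorname{coker}(V_k\to\bigoplus_{a:k\to t(a)}V_{t(a)})$, and reversed maps the inclusions followed by the projection. $\nu^{\mathrm{adj}(k)}$: partition whose parts are the union over arrows $a:k\to t(a)$ of the parts of $\nu^{t(a)}$. Padding partitions with zeros, for $t\ge0$, $\lambda,\mu$ are $t$-interlaced if $\mu_1\ge\dots\ge\mu_{t+1}\ge\lambda_1\ge\mu_{t+2}\ge\mu_{t+3}\ge\lambda_2\ge\mu_{t+4}\ge\mu_{t+5}\ge\lambda_3\ge\cdots$,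 and then $\operatorname{diff}(\mu,\lambda)=(\mu_1,\dots,\mu_t,\mu_{t+1}+\mu_{t+2}-\lambda_1,\mu_{t+3}+\mu_{t+4}-\lambda_2,\dots)$ (independent of the choice of such $t$). $\sigma_k({\boldsymbol\nu})$ equals ${\boldsymbol\nu}$ except that $\nu^k$ is replaced by $\operatorname{diff}(\nu^{\mathrm{adj}(k)},\nu^k)$. *)

theory Defs
  imports "Jordan_Normal_Form.Jordan_Normal_Form" "HOL-Computational_Algebra.Polynomial"
begin

text \<open>A quiver with vertices 0..<nverts and arrows 0..<narrs, arrow a goes src a -> tgt a.\<close>
record quiver =
  nverts :: nat
  narrs :: nat
  src :: "nat \<Rightarrow> nat"
  tgt :: "nat \<Rightarrow> nat"

definition quiver_wf :: "quiver \<Rightarrow> bool" where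
  "quiver_wf Q \<longleftrightarrow> (\<forall>a<narrs Q. src Q a < nverts Q \<and> tgt Q a < nverts Q)"

definition underlying :: "quiver \<Rightarrow> nat \<Rightarrow> nat \<Rightarrow> bool" where
  "underlying Q i j \<longleftrightarrow> (\<exists>a<narrs Q. {src Q a, tgt Q a} = {i, j})"

definition typeA :: "nat \<Rightarrow> nat \<Rightarrow> nat \<Rightarrow> bool" where
  "typeA n i j \<longleftrightarrow> i < n \<and> j < n \<and> (j = Suc i \<or> i = Suc j)"

definition typeD :: "nat \<Rightarrow> nat \<Rightarrow> nat \<Rightarrow> bool" where
  "typeD n i j \<longleftrightarrow> typeA (n - 1) i j \<or> {i, j} = {n - 3, n - 1}"

definition typeE :: "nat \<Rightarrow> nat \<Rightarrow> nat \<Rightarrow> bool" where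
  "typeE n i j \<longleftrightarrow> typeA (n - 1) i j \<or> {i, j} = {2, n - 1}"

definition std_dynkin :: "nat \<Rightarrow> (nat \<Rightarrow> nat \<Rightarrow> bool) \<Rightarrow> bool" where
  "std_dynkin n G \<longleftrightarrow>
     (n \<ge> 1 \<and> G = typeA n) \<or> (n \<ge> 4 \<and> G = typeD n) \<or> (n \<in> {6, 7, 8} \<and> G = typeE n)"

definition is_dynkin_graph :: "nat \<Rightarrow> (nat \<Rightarrow> nat \<Rightarrow> bool) \<Rightarrow> bool" where
  "is_dynkin_graph n G \<longleftrightarrow> (\<exists>\<pi>. bij_betw \<pi> {0..<n} {0..<n} \<and>
      (\<exists>H. std_dynkin n H \<and> (\<forall>i<n. \<forall>j<n. G i j \<longleftrightarrow> H (\<pi> i) (\<pi> j))))"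

text \<open>Dynkin quiver: no multiple edges, and the underlying graph is a simply-laced Dynkin diagram
  (this also excludes loops).\<close>
definition dynkin_quiver :: "quiver \<Rightarrow> bool" where
  "dynkin_quiver Q \<longleftrightarrow> quiver_wf Q \<and>
     (\<forall>a<narrs Q. \<forall>b<narrs Q. {src Q a, tgt Q a} = {src Q b, tgt Q b} \<longrightarrow> a = b) \<and>
     is_dynkin_graph (nverts Q) (underlying Q)"

definition is_source :: "quiver \<Rightarrow> nat \<Rightarrow> bool" where
  "is_source Q k \<longleftrightarrow> k < nverts Q \<and> (\<forall>a<narrs Q. tgt Q a \<noteq> k)"

text \<open>\<sigma>_k(Q): reverse all arrows at k (k a source, so these are the arrows starting at k).\<close>
definition refl_quiver :: "quiver \<Rightarrow> nat \<Rightarrow> quiver" where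
  "refl_quiver Q k = Q\<lparr> src := (\<lambda>a. if src Q a = k then tgt Q a else src Q a),
                         tgt := (\<lambda>a. if src Q a = k then k else tgt Q a) \<rparr>"

definition out_arrows :: "quiver \<Rightarrow> nat \<Rightarrow> nat list" where
  "out_arrows Q k = filter (\<lambda>a. src Q a = k) [0..<narrs Q]"

definition is_rep :: "quiver \<Rightarrow> (nat \<Rightarrow> nat) \<Rightarrow> (nat \<Rightarrow> 'k::field mat) \<Rightarrow> bool" where
  "is_rep Q d f \<longleftrightarrow> (\<forall>a<narrs Q. f a \<in> carrier_mat (d (tgt Q a)) (d (src Q a)))"

definition rep_iso :: "quiver \<Rightarrow> (nat \<Rightarrow> nat) \<Rightarrow> (nat \<Rightarrow> 'k::field mat)
    \<Rightarrow> (nat \<Rightarrow> nat) \<Rightarrow> (nat \<Rightarrow> 'k mat) \<Rightarrow> bool" where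
  "rep_iso Q d f d' f' \<longleftrightarrow> (\<exists>\<phi>. (\<forall>i<nverts Q. \<phi> i \<in> carrier_mat (d' i) (d i) \<and> invertible_mat (\<phi> i)) \<and>
      (\<forall>a<narrs Q. \<phi> (tgt Q a) * f a = f' a * \<phi> (src Q a)))"

definition is_partition :: "nat list \<Rightarrow> bool" where
  "is_partition \<nu> \<longleftrightarrow> sorted_wrt (\<ge>) \<nu> \<and> (\<forall>x\<in>set \<nu>. 0 < x)"

definition pad :: "nat list \<Rightarrow> nat \<Rightarrow> nat" where
  "pad \<nu> i = (if i < length \<nu> then \<nu> ! i else 0)"

definition jordan_type :: "'k::field mat \<Rightarrow> nat list \<Rightarrow> bool" where
  "jordan_type N \<nu> \<longleftrightarrow> similar_mat N (jordan_matrix (map (\<lambda>s. (s, 0)) \<nu>))"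

text \<open>\<lambda>, \<mu> are t-interlaced: \<mu>_1 \<ge> ... \<ge> \<mu>_(t+1) \<ge> \<lambda>_1 \<ge> \<mu>_(t+2) \<ge> \<mu>_(t+3) \<ge> \<lambda>_2 \<ge> ...
  (1-indexed in the paper; here 0-indexed via pad).\<close>
definition interlaced :: "nat \<Rightarrow> nat list \<Rightarrow> nat list \<Rightarrow> bool" where
  "interlaced t lam mu \<longleftrightarrow> (\<forall>i. pad mu (Suc i) \<le> pad mu i) \<and>
     (\<forall>j. pad lam j \<le> pad mu (t + 2 * j) \<and> pad mu (t + 2 * j + 1) \<le> pad lam j)"

definition diff_seq :: "nat \<Rightarrow> nat list \<Rightarrow> nat list \<Rightarrow> nat \<Rightarrow> nat" where
  "diff_seq t mu lam i = (if i < t then pad mu i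
      else pad mu (t + 2 * (i - t)) + pad mu (t + 2 * (i - t) + 1) - pad lam (i - t))"

definition diff_part :: "nat \<Rightarrow> nat list \<Rightarrow> nat list \<Rightarrow> nat list" where
  "diff_part t mu lam = filter (\<lambda>x. 0 < x) (map (diff_seq t mu lam) [0..<t + length mu])"

definition adj_part :: "quiver \<Rightarrow> nat \<Rightarrow> (nat \<Rightarrow> nat list) \<Rightarrow> nat list" where
  "adj_part Q k \<nu> = rev (sort (concat (map (\<lambda>a. \<nu> (tgt Q a)) (out_arrows Q k))))"

definition sigma_part :: "quiver \<Rightarrow> nat \<Rightarrow> nat \<Rightarrow> (nat \<Rightarrow> nat list) \<Rightarrow> (nat \<Rightarrow> nat list)" where
  "sigma_part Q k t \<nu> = \<nu>(k := diff_part t (adj_part Q k \<nu>) (\<nu> k))"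

definition compat_reps :: "quiver \<Rightarrow> (nat \<Rightarrow> nat) \<Rightarrow> (nat \<Rightarrow> 'k::field mat) \<Rightarrow> (nat \<Rightarrow> 'k mat) set" where
  "compat_reps Q d N = {f. is_rep Q d f \<and> (\<forall>a<narrs Q. N (tgt Q a) * f a = f a * N (src Q a))}"

inductive_set poly_funs :: "quiver \<Rightarrow> (nat \<Rightarrow> nat) \<Rightarrow> ((nat \<Rightarrow> 'k::field mat) \<Rightarrow> 'k) set"
  for Q :: quiver and d :: "nat \<Rightarrow> nat" where
  pf_const: "(\<lambda>f. c) \<in> poly_funs Q d"
| pf_coord: "a < narrs Q \<Longrightarrow> i < d (tgt Q a) \<Longrightarrow> j < d (src Q a) \<Longrightarrow> (\<lambda>f. f a $$ (i, j)) \<in> poly_funs Q d"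
| pf_add: "p \<in> poly_funs Q d \<Longrightarrow> q \<in> poly_funs Q d \<Longrightarrow> (\<lambda>f. p f + q f) \<in> poly_funs Q d"
| pf_mult: "p \<in> poly_funs Q d \<Longrightarrow> q \<in> poly_funs Q d \<Longrightarrow> (\<lambda>f. p f * q f) \<in> poly_funs Q d"

definition zariski_open_in :: "quiver \<Rightarrow> (nat \<Rightarrow> nat) \<Rightarrow> (nat \<Rightarrow> 'k::field mat) set \<Rightarrow> (nat \<Rightarrow> 'k mat) set \<Rightarrow> bool" where
  "zariski_open_in Q d X U \<longleftrightarrow>
     (\<exists>P \<subseteq> poly_funs Q d. U = {f \<in> X. \<exists>p\<in>P. p f \<noteq> 0})"

definition zariski_dense_in :: "quiver \<Rightarrow> (nat \<Rightarrow> nat) \<Rightarrow> (nat \<Rightarrow> 'k::field mat) set \<Rightarrow> (nat \<Rightarrow> 'k mat) set \<Rightarrow> bool" where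
  "zariski_dense_in Q d X U \<longleftrightarrow> U \<subseteq> X \<and>
     (\<forall>U'. zariski_open_in Q d X U' \<and> U' \<noteq> {} \<longrightarrow> U \<inter> U' \<noteq> {})"

definition is_GenRep :: "quiver \<Rightarrow> (nat \<Rightarrow> nat list) \<Rightarrow> (nat \<Rightarrow> nat) \<Rightarrow> (nat \<Rightarrow> 'k::field mat) \<Rightarrow> bool" where
  "is_GenRep Q \<nu> d f \<longleftrightarrow> is_rep Q d f \<and>
     (let d\<nu> = (\<lambda>i. sum_list (\<nu> i)) in
      \<exists>N U. (\<forall>i<nverts Q. N i \<in> carrier_mat (d\<nu> i) (d\<nu> i) \<and> jordan_type (N i) (\<nu> i)) \<and>
        zariski_open_in Q d\<nu> (compat_reps Q d\<nu> N) U \<and>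
        zariski_dense_in Q d\<nu> (compat_reps Q d\<nu> N) U \<and> U \<noteq> {} \<and>
        (\<forall>g\<in>U. \<forall>h\<in>U. rep_iso Q d\<nu> g d\<nu> h) \<and>
        (\<exists>g\<in>U. rep_iso Q d\<nu> g d f))"

definition vsum :: "nat \<Rightarrow> 'k::field vec list \<Rightarrow> 'k vec" where
  "vsum n vs = foldr (+) vs (0\<^sub>v n)"

text \<open>(d', f') is (a matrix model of) R^-_k(d, f): it agrees with V away from k, and
  W_k with the reversed maps is a cokernel of V_k -> \<Oplus>_{a : k -> tgt a} V_(tgt a), the reversed maps
  being the components of the cokernel projection.\<close>
definition is_refl_minus :: "quiver \<Rightarrow> nat \<Rightarrow> (nat \<Rightarrow> nat) \<Rightarrow> (nat \<Rightarrow> 'k::field mat)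
    \<Rightarrow> (nat \<Rightarrow> nat) \<Rightarrow> (nat \<Rightarrow> 'k mat) \<Rightarrow> bool" where
  "is_refl_minus Q k d f d' f' \<longleftrightarrow>
     is_rep Q d f \<and> is_rep (refl_quiver Q k) d' f' \<and>
     (\<forall>i<nverts Q. i \<noteq> k \<longrightarrow> d' i = d i) \<and>
     (\<forall>a<narrs Q. src Q a \<noteq> k \<longrightarrow> f' a = f a) \<and>
     (\<forall>w \<in> carrier_vec (d' k). \<exists>x. (\<forall>a\<in>set (out_arrows Q k). x a \<in> carrier_vec (d (tgt Q a))) \<and>
          vsum (d' k) (map (\<lambda>a. f' a *\<^sub>v x a) (out_arrows Q k)) = w) \<and>
     (\<forall>x. (\<forall>a\<in>set (out_arrows Q k). x a \<in> carrier_vec (d (tgt Q a))) \<longrightarrow>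
          (vsum (d' k) (map (\<lambda>a. f' a *\<^sub>v x a) (out_arrows Q k)) = 0\<^sub>v (d' k) \<longleftrightarrow>
           (\<exists>v \<in> carrier_vec (d k). \<forall>a\<in>set (out_arrows Q k). x a = f a *\<^sub>v v)))"

end

theory Submission
  imports Defs
begin

text \<open>Write \<open>M\<close> for the sum of the spaces at the ends of the arrows starting at \<open>k\<close>, with its nilpotent
  operator. In Jordan bases, interlacing gives an explicit exact sequence \<open>L \<rightarrow> M \<rightarrow> K\<close> of nilpotent
  operators of types \<open>\<lambda>\<close>, \<open>\<mu>\<close> and \<open>diff(\<mu>, \<lambda>)\<close>: it is a sum of sequences in which one block of \<open>L\<close>
  embeds into two consecutive blocks of \<open>M\<close>. Because no part of \<open>\<mu>\<close> lies strictly between the two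
  consecutive ones, every homomorphism \<open>L \<rightarrow> M\<close> factors through the embedding \<open>\<phi>\<close> and every homomorphism
  \<open>M \<rightarrow> K\<close> through the projection \<open>\<psi>\<close>, by an endomorphism of \<open>M\<close> depending polynomially on it. This
  endomorphism is the identity at \<open>\<phi>\<close>, respectively \<open>\<psi>\<close>, hence invertible on a nonempty open set; so a
  generic homomorphism is a translate of \<open>\<phi>\<close> or \<open>\<psi>\<close> by a polynomially varying automorphism.

  Consequently a generic compatible representation \<open>h\<close> of the reflected quiver is the reflection of one
  whose entries are polynomial in \<open>h\<close> (the adjugate matrix replaces the inverse). Compatible
  representations form a linear space, which is irreducible since the field is infinite, so the
  generic locus pulls back to a nonempty, hence dense, open set. Reflections of isomorphic
  representations are isomorphic because cokernels are unique.\<close>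

section \<open>Matrices of polynomial functions\<close>

text \<open>Regard a block of length \<open>n\<close> as polynomials in the operator
  \<open>x\<close> modulo \<open>x^n\<close>. A homomorphism from a block of length \<open>l\<close>
  into one of length \<open>c\<close> prolongs along an inclusion of \<open>l\<close> into a longer
  block \<open>a\<close> if \<open>c \<ge> a\<close>, and descends to a quotient of length
  \<open>b < l\<close> if \<open>c \<le> b\<close>. Targets of a length strictly between
  \<open>b\<close> and \<open>a\<close> can fail both, and this is what consecutive parts exclude.
  Homomorphisms into the cokernel block behave dually.

  The generic class is given only through some polynomial \<open>q\<close>, which may vanish at
  every representation extending \<open>\<phi>\<close>. The two factorizations therefore have
  different jobs: the one through \<open>\<phi>\<close> moves the sequence to a base point where
  \<open>q\<close> is nonzero, and the one through the moved projection \<open>\<psi>1\<close>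
  writes a generic projection as \<open>\<psi>1 * B\<close>. Translating the base point by the
  inverse of \<open>B\<close> produces the representation whose reflection is wanted. At
  \<open>B = 1\<close> it is the base point itself, which is why the locus pulled back from
  \<open>q\<close> is nonempty.\<close>

definition function_algebra :: "('x \<Rightarrow> 'k::field) set \<Rightarrow> bool" where
  "function_algebra R \<longleftrightarrow> (\<forall>c. (\<lambda>x. c) \<in> R) \<and>
     (\<forall>p\<in>R. \<forall>q\<in>R. (\<lambda>x. p x + q x) \<in> R \<and> (\<lambda>x. p x * q x) \<in> R)"

lemma function_algebraD:
  assumes "function_algebra R"
  shows "(\<lambda>x. c) \<in> R" "p \<in> R \<Longrightarrow> q \<in> R \<Longrightarrow> (\<lambda>x. p x + q x) \<in> R"
    "p \<in> R \<Longrightarrow> q \<in> R \<Longrightarrow> (\<lambda>x. p x * q x) \<in> R"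
  using assms unfolding function_algebra_def by blast+

lemma function_algebra_sum:
  assumes R: "function_algebra R" and p: "\<And>i. i \<in> I \<Longrightarrow> p i \<in> R"
  shows "(\<lambda>x. \<Sum>i\<in>I. p i x) \<in> R"
  using p by (induction I rule: infinite_finite_induct) (auto intro!: function_algebraD[OF R])

lemma function_algebra_prod:
  assumes R: "function_algebra R" and p: "\<And>i. i \<in> I \<Longrightarrow> p i \<in> R"
  shows "(\<lambda>x. \<Prod>i\<in>I. p i x) \<in> R"
  using p by (induction I rule: infinite_finite_induct) (auto intro!: function_algebraD[OF R])

text \<open>The size is demanded at every argument, not only at compatible representations, so that
  no domain has to be tracked through products and determinants; \<open>stack\<close> and
  \<open>side\<close> have a fixed size at every argument.\<close>

definition matrix_over :: "('x \<Rightarrow> 'k::field) set \<Rightarrow> nat \<Rightarrow> nat \<Rightarrow> ('x \<Rightarrow> 'k mat) \<Rightarrow> bool" where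
  "matrix_over R n m A \<longleftrightarrow> (\<forall>x. A x \<in> carrier_mat n m) \<and>
     (\<forall>i<n. \<forall>j<m. (\<lambda>x. A x $$ (i, j)) \<in> R)"

lemma matrix_overI:
  assumes "\<And>x. A x \<in> carrier_mat n m" "\<And>i j. i < n \<Longrightarrow> j < m \<Longrightarrow> (\<lambda>x. A x $$ (i, j)) \<in> R"
  shows "matrix_over R n m A"
  using assms unfolding matrix_over_def by blast

lemma matrix_overD:
  assumes "matrix_over R n m A"
  shows "A x \<in> carrier_mat n m" "i < n \<Longrightarrow> j < m \<Longrightarrow> (\<lambda>x. A x $$ (i, j)) \<in> R"
  using assms unfolding matrix_over_def by blast+

lemma matrix_over_const:
  assumes "function_algebra R" "A \<in> carrier_mat n m"
  shows "matrix_over R n m (\<lambda>x. A)"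
  using assms by (auto intro!: matrix_overI function_algebraD)

lemma matrix_over_add:
  assumes R: "function_algebra R" and A: "matrix_over R n m A" and B: "matrix_over R n m B"
  shows "matrix_over R n m (\<lambda>x. A x + B x)"
proof (rule matrix_overI)
  fix x show "A x + B x \<in> carrier_mat n m"
    using matrix_overD(1)[OF A, of x] matrix_overD(1)[OF B, of x] by simp
next
  fix i j assume ij: "i < n" "j < m"
  have "(\<lambda>x. (A x + B x) $$ (i, j)) = (\<lambda>x. A x $$ (i, j) + B x $$ (i, j))"
  proof
    fix x show "(A x + B x) $$ (i, j) = A x $$ (i, j) + B x $$ (i, j)"
      using matrix_overD(1)[OF B, of x] ij by simp
  qed
  then show "(\<lambda>x. (A x + B x) $$ (i, j)) \<in> R"
    using function_algebraD(2)[OF R] matrix_overD(2)[OF A ij] matrix_overD(2)[OF B ij] by simp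
qed

lemma matrix_over_mult:
  assumes R: "function_algebra R" and A: "matrix_over R n m A" and B: "matrix_over R m l B"
  shows "matrix_over R n l (\<lambda>x. A x * B x)"
proof (rule matrix_overI)
  fix x show "A x * B x \<in> carrier_mat n l"
    using matrix_overD(1)[OF A, of x] matrix_overD(1)[OF B, of x] by (rule mult_carrier_mat)
next
  fix i j assume ij: "i < n" "j < l"
  have "(\<lambda>x. (A x * B x) $$ (i, j)) = (\<lambda>x. \<Sum>k<m. A x $$ (i, k) * B x $$ (k, j))"
  proof
    fix x
    show "(A x * B x) $$ (i, j) = (\<Sum>k<m. A x $$ (i, k) * B x $$ (k, j))"
      using matrix_overD(1)[OF A, of x] matrix_overD(1)[OF B, of x] ij
      by (auto simp: scalar_prod_def atLeast0LessThan)
  qed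
  also have "\<dots> \<in> R"
    by (intro function_algebra_sum[OF R] function_algebraD(3)[OF R] matrix_overD(2)[OF A] matrix_overD(2)[OF B] ij)
      auto
  finally show "(\<lambda>x. (A x * B x) $$ (i, j)) \<in> R" .
qed

lemma det_in_function_algebra:
  assumes R: "function_algebra R" and A: "matrix_over R n n A"
  shows "(\<lambda>x. det (A x)) \<in> R"
proof -
  have "(\<lambda>x. det (A x)) = (\<lambda>x. \<Sum>p\<in>{p. p permutes {0..<n}}. signof p * (\<Prod>i = 0..<n. A x $$ (i, p i)))"
    using det_def'[OF matrix_overD(1)[OF A]] by auto
  also have "\<dots> \<in> R"
  proof (intro function_algebra_sum[OF R] function_algebraD(3)[OF R] function_algebraD(1)[OF R]
        function_algebra_prod[OF R] matrix_overD(2)[OF A])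
    fix p i assume "p \<in> {p. p permutes {0..<n}}" "i \<in> {0..<n}"
    then show "i < n" "p i < n" using permutes_in_image[of p "{0..<n}" i] by auto
  qed
  finally show ?thesis .
qed

lemma matrix_over_adj_mat:
  assumes R: "function_algebra R" and A: "matrix_over R n n A"
  shows "matrix_over R n n (\<lambda>x. adj_mat (A x))"
proof (rule matrix_overI)
  fix x show "adj_mat (A x) \<in> carrier_mat n n" using adj_mat(1)[OF matrix_overD(1)[OF A]] .
next
  fix i j assume ij: "i < n" "j < n"
  have dim: "dim_row (A x) = n" "dim_col (A x) = n" for x using matrix_overD(1)[OF A, of x] by auto
  have "matrix_over R (n - 1) (n - 1) (\<lambda>x. mat_delete (A x) j i)"
    by (rule matrix_overI) (use dim ij in \<open>auto simp: mat_delete_def intro!: matrix_overD(2)[OF A]\<close>)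
  then have "(\<lambda>x. (-1) ^ (j + i) * det (mat_delete (A x) j i)) \<in> R"
    by (intro function_algebraD(3)[OF R] function_algebraD(1)[OF R] det_in_function_algebra[OF R])
  then show "(\<lambda>x. adj_mat (A x) $$ (i, j)) \<in> R"
    using ij dim by (simp add: adj_mat_def cofactor_def)
qed

text \<open>The quantification is over function algebras on a fixed type of arguments only because HOL
  has no type quantifiers.\<close>
definition regular_map :: "nat \<Rightarrow> nat \<Rightarrow> nat \<Rightarrow> nat \<Rightarrow> ('k::field mat \<Rightarrow> 'k mat) \<Rightarrow> bool" where
  "regular_map n m n' m' F \<longleftrightarrow> (\<forall>R :: ((nat \<Rightarrow> 'k mat) \<Rightarrow> 'k) set. function_algebra R \<longrightarrow>
     (\<forall>A. matrix_over R n m A \<longrightarrow> matrix_over R n' m' (\<lambda>x. F (A x))))"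

lemma regular_mapD:
  fixes R :: "((nat \<Rightarrow> 'k::field mat) \<Rightarrow> 'k) set"
  assumes "regular_map n m n' m' F" "function_algebra R" "matrix_over R n m A"
  shows "matrix_over R n' m' (\<lambda>x. F (A x))"
  using assms unfolding regular_map_def by blast

text \<open>The value at a single matrix is recovered from a constant family over the algebra of all
  functions.\<close>

lemma regular_map_carrier:
  assumes "regular_map n m n' m' (F :: 'k::field mat \<Rightarrow> 'k mat)" "A \<in> carrier_mat n m"
  shows "F A \<in> carrier_mat n' m'"
proof -
  have R: "function_algebra (UNIV :: ((nat \<Rightarrow> 'k mat) \<Rightarrow> 'k) set)" by (simp add: function_algebra_def)
  show ?thesis
    using matrix_overD(1)[OF regular_mapD[OF assms(1) R matrix_over_const[OF R assms(2)]]] .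
qed

lemma regular_map_mult_const:
  assumes F: "regular_map n m n' m' F" and P: "P \<in> carrier_mat n n\<^sub>1" and Q: "Q \<in> carrier_mat m\<^sub>1 m"
    and P': "P' \<in> carrier_mat n'\<^sub>1 n'" and Q': "Q' \<in> carrier_mat m' m'\<^sub>1"
  shows "regular_map n\<^sub>1 m\<^sub>1 n'\<^sub>1 m'\<^sub>1 (\<lambda>X. P' * F (P * X * Q) * Q')"
  unfolding regular_map_def
proof (intro allI impI)
  fix R :: "((nat \<Rightarrow> 'a mat) \<Rightarrow> 'a) set" and A
  assume R: "function_algebra R" and A: "matrix_over R n\<^sub>1 m\<^sub>1 A"
  note const = matrix_over_const[OF R]
  show "matrix_over R n'\<^sub>1 m'\<^sub>1 (\<lambda>x. P' * F (P * A x * Q) * Q')"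
    using matrix_over_mult[OF R matrix_over_mult[OF R const[OF P'] regular_mapD[OF F R
          matrix_over_mult[OF R matrix_over_mult[OF R const[OF P] A] const[OF Q]]]] const[OF Q']] .
qed

section \<open>Polynomial functions of a representation\<close>

lemma function_algebra_poly_funs: "function_algebra (poly_funs Q d)"
  by (auto simp: function_algebra_def intro: poly_funs.intros)

text \<open>Serves to pull the polynomial of the generic locus back along a map between spaces of
  representations with polynomial entries.\<close>

lemma poly_funs_comp:
  assumes "p \<in> poly_funs Q d"
    and R: "function_algebra R"
    and S: "\<And>a i j. a < narrs Q \<Longrightarrow> i < d (tgt Q a) \<Longrightarrow> j < d (src Q a) \<Longrightarrow> (\<lambda>h. S h a $$ (i, j)) \<in> R"
  shows "(\<lambda>h. p (S h)) \<in> R"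
  using assms(1)
  by induction (auto intro: function_algebraD[OF R] S)

section \<open>Homomorphisms between Jordan blocks\<close>

text \<open>Module homomorphisms between the Jordan blocks of sizes \<open>n\<close> and \<open>m\<close>, where the nilpotent
  operator sends the basis vector with index \<open>Suc p\<close> to the one with index \<open>p\<close>.\<close>
definition block_hom :: "nat \<Rightarrow> nat \<Rightarrow> (nat \<Rightarrow> nat \<Rightarrow> 'k::field) \<Rightarrow> bool" where
  "block_hom m n X \<longleftrightarrow> (\<forall>p<m. \<forall>q<n.
     (if Suc p < m then X (Suc p) q else 0) = (if 0 < q then X p (q - 1) else 0))"

lemma block_homD:
  assumes "block_hom m n X" "p < m" "q < n"
  shows "(if Suc p < m then X (Suc p) q else 0) = (if 0 < q then X p (q - 1) else 0)"
  using assms unfolding block_hom_def by blast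

text \<open>The basis vectors of index at most \<open>q\<close> span the kernel of the power
  \<open>q + 1\<close> of the operator, and a homomorphism respects these kernels.\<close>

lemma block_hom_below_diagonal:
  assumes X: "block_hom m n X" and "p < m" "q < n" "q < p"
  shows "X p q = 0"
  using assms(2-)
proof (induction p arbitrary: q)
  case (Suc p)
  then show ?case using block_homD[OF X, of p q] by (auto split: if_splits)
qed simp

lemma block_hom_toeplitz:
  assumes X: "block_hom m n X" and "p < m" "q < n" "p \<le> q"
  shows "X p q = X 0 (q - p)"
  using assms(2-)
proof (induction p arbitrary: q)
  case (Suc p)
  have "X (Suc p) q = X p (q - 1)" using block_homD[OF X, of p q] Suc.prems by simp
  then show ?case using Suc.IH[of "q - 1"] Suc.prems by simp
qed simp

text \<open>The basis vector of index \<open>q\<close> is the image of the last one under the power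
  \<open>n - 1 - q\<close> of the operator. Its image lies in the range of that power on the target,
  where indices \<open>p\<close> with \<open>n + p > m + q\<close> do not occur.\<close>

lemma block_hom_source_longer:
  assumes X: "block_hom m n X" and "p < m" "q < n" "q + m < n + p"
  shows "X p q = 0"
proof -
  \<comment> \<open>Induction on the distance \<open>i\<close> to the last row: entries are carried
    down their diagonal, and the last row is zero away from the last column.\<close>
  have "m = Suc (p + i) \<Longrightarrow> q < n \<Longrightarrow> q + m < n + p \<Longrightarrow> X p q = 0" for i p q
  proof (induction i arbitrary: p q)
    case 0
    then show ?case using block_homD[OF X, of p "Suc q"] by (auto split: if_splits)
  next
    case (Suc i)
    have "X p q = X (Suc p) (Suc q)"
    proof -
      have "p < m" "Suc q < n" "Suc p < m" using Suc.prems by simp_all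
      then show ?thesis using block_homD[OF X, of p "Suc q"] by simp
    qed
    then show ?case using Suc.IH[of "Suc p" "Suc q"] Suc.prems by auto
  qed
  from this[of p "m - Suc p" q] assms show ?thesis by simp
qed

lemma block_hom_zero: "block_hom m n (\<lambda>p q. 0)"
  by (simp add: block_hom_def)

text \<open>For \<open>a \<le> m\<close> every upper triangular Toeplitz matrix is a homomorphism.
  The diagonals of \<open>X\<close> are prolonged to the longer source; the additional diagonals are
  free and set to zero.\<close>

lemma block_hom_extend_source:
  assumes X: "block_hom m l X" and "l \<le> a" "a \<le> m"
  shows "block_hom m a (\<lambda>p q. if p \<le> q \<and> q - p < l then X 0 (q - p) else 0)"
  unfolding block_hom_def
proof (intro allI impI)
  fix p q assume "p < m" "q < a"
  moreover have "q - Suc p = q - 1 - p" by simp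
  ultimately show "(if Suc p < m then if Suc p \<le> q \<and> q - Suc p < l then X 0 (q - Suc p) else 0 else 0)
      = (if 0 < q then if p \<le> q - 1 \<and> q - 1 - p < l then X 0 (q - 1 - p) else 0 else 0)"
    using assms(2,3) by auto
qed

text \<open>If \<open>m \<le> b\<close>, the first \<open>\<delta>\<close> columns of
  \<open>X\<close> vanish by \<open>block_hom_source_longer\<close>, so \<open>X\<close> descends to
  the quotient by the first \<open>\<delta>\<close> basis vectors.\<close>

lemma block_hom_source_quotient:
  assumes X: "block_hom m l X" and "l = b + \<delta>" "m \<le> b \<or> \<delta> = 0"
  shows "block_hom m b (\<lambda>p q. X p (q + \<delta>))"
  unfolding block_hom_def
proof (intro allI impI)
  fix p q assume pq: "p < m" "q < b"
  note X' = block_homD[OF X pq(1), of "q + \<delta>"]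
  show "(if Suc p < m then X (Suc p) (q + \<delta>) else 0) = (if 0 < q then X p (q - 1 + \<delta>) else 0)"
  proof (cases "q = 0 \<and> \<delta> \<noteq> 0")
    case True
    then have "X p (\<delta> - 1) = 0"
      using assms(2,3) pq by (intro block_hom_source_longer[OF X]) auto
    with X' True pq assms(2) show ?thesis by simp
  next
    case False
    with X' pq assms(2) show ?thesis by (cases q) auto
  qed
qed

text \<open>The quotient map from the block of length \<open>a\<close> drops its
  \<open>\<delta>\<close> lowest indices. Rows from \<open>\<delta>\<close> on are thus forced to be
  those of \<open>Y\<close>; the rows above them continue the diagonals of \<open>Y\<close>, with
  zero where a diagonal leaves the matrix.\<close>

lemma block_hom_lift_quotient:
  assumes Y: "block_hom k m Y" and a: "a = k + \<delta>" "a \<le> m \<or> \<delta> = 0"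
  shows "block_hom a m (\<lambda>p q. if \<delta> \<le> p then Y (p - \<delta>) q
    else if 0 < k \<and> q + (\<delta> - p) < m then Y 0 (q + (\<delta> - p)) else 0)" (is "block_hom a m ?Z")
  unfolding block_hom_def
proof (intro allI impI)
  fix p q assume pq: "p < a" "q < m"
  show "(if Suc p < a then ?Z (Suc p) q else 0) = (if 0 < q then ?Z p (q - 1) else 0)"
  proof (cases "\<delta> \<le> p")
    case True
    then have "p - \<delta> < k" "Suc p < a \<longleftrightarrow> Suc (p - \<delta>) < k" "Suc p - \<delta> = Suc (p - \<delta>)" "\<delta> \<le> Suc p"
      using pq a by auto
    then show ?thesis using block_homD[OF Y, of "p - \<delta>" q] pq True by (auto split: if_splits)
  next
    case p: False
    \<comment> \<open>Column 0 has no left neighbour, so the entry one row further down must vanish,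
      and that entry is \<open>Y 0 (\<delta> - p - 1)\<close>.\<close>
    have *: "Y 0 (\<delta> - p - 1) = 0" if "0 < k"
      using that a p pq by (intro block_hom_source_longer[OF Y]) auto
    show ?thesis
    proof (cases "Suc p = \<delta>")
      case True
      then show ?thesis using p pq a * by (cases q) auto
    next
      case False
      then have "q + (\<delta> - Suc p) = q - 1 + (\<delta> - p)" if "0 < q" using that p by simp
      with False show ?thesis using p pq a * by (cases q) auto
    qed
  qed
qed

text \<open>If \<open>m \<le> b\<close>, the rows from \<open>b\<close> on lie below the diagonal
  and vanish, so the image is in the subblock of length \<open>b\<close>. The sign anticipates the
  minus sign in the short component of \<open>proj\<close>.\<close>

lemma block_hom_restrict_target:
  assumes Y: "block_hom k m Y" and "b \<le> k" "m \<le> b \<or> b = k"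
  shows "block_hom b m (\<lambda>p q. - Y p q)"
  unfolding block_hom_def
proof (intro allI impI)
  fix p q assume pq: "p < b" "q < m"
  note Y' = block_homD[OF Y, of p q]
  show "(if Suc p < b then - Y (Suc p) q else 0) = (if 0 < q then - Y p (q - 1) else 0)"
  proof (cases "Suc p < b \<or> b = k")
    case True
    with Y' pq assms(2) show ?thesis by auto
  next
    case False
    then have "Suc p < k \<Longrightarrow> Y (Suc p) q = 0"
      using pq assms by (intro block_hom_below_diagonal[OF Y]) auto
    with Y' pq assms False show ?thesis by (auto split: if_splits)
  qed
qed

section \<open>Matrices with labelled rows and columns, nilpotent Jordan matrices\<close>

definition index_mat :: "(nat \<Rightarrow> 'i) \<Rightarrow> (nat \<Rightarrow> 'j) \<Rightarrow> nat \<Rightarrow> nat \<Rightarrow> ('i \<Rightarrow> 'j \<Rightarrow> 'k) \<Rightarrow> 'k mat" where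
  "index_mat e e' n m F = mat n m (\<lambda>(a, b). F (e a) (e' b))"

lemma index_mat_carrier[simp]: "index_mat e e' n m F \<in> carrier_mat n m"
  by (simp add: index_mat_def)

lemma index_mat_mult:
  fixes F :: "'i \<Rightarrow> 'j \<Rightarrow> 'k::field"
  assumes "bij_betw e' {..<m} I"
  shows "index_mat e e' n m F * index_mat e' e'' m l G = index_mat e e'' n l (\<lambda>x z. \<Sum>y\<in>I. F x y * G y z)"
  by (rule eq_matI)
    (auto simp: index_mat_def scalar_prod_def atLeast0LessThan
      sum.reindex_bij_betw[OF assms, of "\<lambda>y. F (e _) y * G y (e'' _)"])

lemma index_mat_add:
  "index_mat e e' n m F + index_mat e e' n m G = index_mat e e' n m (\<lambda>x y. F x y + G x y)"
  by (rule eq_matI) (auto simp: index_mat_def)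

lemma index_mat_cong:
  assumes "bij_betw e {..<n} I" "bij_betw e' {..<m} I'"
    and "\<And>x y. x \<in> I \<Longrightarrow> y \<in> I' \<Longrightarrow> F x y = G x y"
  shows "index_mat e e' n m F = index_mat e e' n m G"
  using assms by (intro eq_matI) (auto simp: index_mat_def bij_betw_def)

lemma index_mat_eq_iff:
  assumes e: "bij_betw e {..<n} I" and e': "bij_betw e' {..<m} I'"
  shows "index_mat e e' n m F = index_mat e e' n m G \<longleftrightarrow> (\<forall>x\<in>I. \<forall>y\<in>I'. F x y = G x y)"
proof
  assume *: "index_mat e e' n m F = index_mat e e' n m G"
  show "\<forall>x\<in>I. \<forall>y\<in>I'. F x y = G x y"
  proof (intro ballI)
    fix x y assume "x \<in> I" "y \<in> I'"
    then obtain i j where "i < n" "x = e i" "j < m" "y = e' j"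
      using e e' unfolding bij_betw_def by blast
    then show "F x y = G x y"
      using arg_cong[OF *, of "\<lambda>A. A $$ (i, j)"] by (simp add: index_mat_def)
  qed
qed (use index_mat_cong[OF e e'] in blast)

lemma index_mat_one:
  assumes "bij_betw e {..<n} I"
  shows "index_mat e e n n (\<lambda>x y. if x = y then 1 else 0) = 1\<^sub>m n"
  using assms by (intro eq_matI) (auto simp: index_mat_def bij_betw_def inj_on_def)

lemma index_mat_zero: "index_mat e e' n m (\<lambda>x y. 0) = 0\<^sub>m n m"
  by (intro eq_matI) (auto simp: index_mat_def)

lemma mat_eq_index_mat:
  assumes e: "bij_betw e {..<n} I" and e': "bij_betw e' {..<m} I'" and X: "X \<in> carrier_mat n m"
  shows "X = index_mat e e' n m (\<lambda>x y. X $$ (the_inv_into {..<n} e x, the_inv_into {..<m} e' y))"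
  using X by (intro eq_matI)
    (auto simp: index_mat_def the_inv_into_f_f[OF bij_betw_imp_inj_on[OF e]]
      the_inv_into_f_f[OF bij_betw_imp_inj_on[OF e']])

definition jordan_entry :: "'i \<times> nat \<Rightarrow> 'i \<times> nat \<Rightarrow> 'k::field" where
  "jordan_entry x y = (if fst x = fst y \<and> snd y = Suc (snd x) then 1 else 0)"

text \<open>A block of size 0 has no cell, so padding zeros and empty partner blocks cost
  nothing.\<close>

definition cells :: "'i set \<Rightarrow> ('i \<Rightarrow> nat) \<Rightarrow> ('i \<times> nat) set" where
  "cells S m = (SIGMA i:S. {..<m i})"

lemma cells_iff[simp]: "(i, p) \<in> cells S m \<longleftrightarrow> i \<in> S \<and> p < m i"
  by (auto simp: cells_def)

lemma finite_cells[simp]: "finite S \<Longrightarrow> finite (cells S m)"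
  by (auto simp: cells_def)

abbreviation jordan_mat :: "(nat \<Rightarrow> 'i \<times> nat) \<Rightarrow> nat \<Rightarrow> 'k::field mat" where
  "jordan_mat e n \<equiv> index_mat e e n n jordan_entry"

lemma sum_delta_eq:
  assumes "finite I"
  shows "(\<Sum>y\<in>I. (if y = a then c else 0) * G y) = (if a \<in> I then c * G a else (0::'k::field))"
    "(\<Sum>y\<in>I. G y * (if y = a then c else 0)) = (if a \<in> I then G a * c else (0::'k::field))"
  using assms by (simp_all add: if_distrib[of "\<lambda>x. x * _"] if_distrib[of "\<lambda>x. _ * x"] sum.delta cong: if_cong)

lemma jordan_mult_entry:
  assumes "finite S"
  shows "(\<Sum>y\<in>cells S m. jordan_entry (i, p) y * G y)
    = (if (i, Suc p) \<in> cells S m then G (i, Suc p) else 0)"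
proof -
  have "(\<Sum>y\<in>cells S m. jordan_entry (i, p) y * G y)
      = (\<Sum>y\<in>cells S m. (if y = (i, Suc p) then 1 else 0) * G y)"
    by (rule sum.cong) (auto simp: jordan_entry_def)
  then show ?thesis using assms by (simp add: sum_delta_eq)
qed

lemma mult_jordan_entry:
  assumes "finite S" "(i, q) \<in> cells S m"
  shows "(\<Sum>y\<in>cells S m. G y * jordan_entry y (i, q)) = (if 0 < q then G (i, q - 1) else 0)"
proof (cases q)
  case (Suc q')
  have "(\<Sum>y\<in>cells S m. G y * jordan_entry y (i, q))
      = (\<Sum>y\<in>cells S m. G y * (if y = (i, q') then 1 else 0))"
    by (rule sum.cong) (auto simp: jordan_entry_def Suc)
  then show ?thesis using assms by (simp add: sum_delta_eq Suc)
qed (auto simp: jordan_entry_def intro!: sum.neutral)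

text \<open>Multiplying by a Jordan matrix on either side only shifts positions inside a block, so
  commutation can be tested on each pair of blocks separately.\<close>

lemma index_mat_intertwines_iff:
  fixes F :: "'i \<times> nat \<Rightarrow> 'j \<times> nat \<Rightarrow> 'k::field"
  assumes e: "bij_betw e {..<n} (cells S m)" and e': "bij_betw e' {..<n'} (cells S' m')"
    and fin: "finite S" "finite S'"
  shows "jordan_mat e n * index_mat e e' n n' F = index_mat e e' n n' F * jordan_mat e' n'
    \<longleftrightarrow> (\<forall>i\<in>S. \<forall>j\<in>S'. block_hom (m i) (m' j) (\<lambda>p q. F (i, p) (j, q)))"
  unfolding index_mat_mult[OF e] index_mat_mult[OF e'] index_mat_eq_iff[OF e e']
proof -
  have "(\<Sum>y\<in>cells S m. jordan_entry (i, p) y * F y (j, q))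
      = (if Suc p < m i then F (i, Suc p) (j, q) else 0)"
    "(\<Sum>y\<in>cells S' m'. F (i, p) y * jordan_entry y (j, q)) = (if 0 < q then F (i, p) (j, q - 1) else 0)"
    if "i \<in> S" "p < m i" "j \<in> S'" "q < m' j" for i p j q
    using that fin by (simp_all add: jordan_mult_entry mult_jordan_entry)
  then show "(\<forall>x\<in>cells S m. \<forall>y\<in>cells S' m'. (\<Sum>z\<in>cells S m. jordan_entry x z * F z y)
      = (\<Sum>z\<in>cells S' m'. F x z * jordan_entry z y))
    \<longleftrightarrow> (\<forall>i\<in>S. \<forall>j\<in>S'. block_hom (m i) (m' j) (\<lambda>p q. F (i, p) (j, q)))"
    unfolding block_hom_def cells_def by (auto simp del: split_paired_All)
qed

section \<open>Interlaced blocks\<close>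

text \<open>Tailored to \<open>factor_emb\<close> and \<open>factor_proj\<close>, each entry of
  which copies at most one entry of the argument, up to sign.\<close>

lemma regular_map_select:
  fixes F :: "'k::field mat \<Rightarrow> 'k mat"
  assumes "\<And>X. F X \<in> carrier_mat n' m'"
    and "\<And>i j. i < n' \<Longrightarrow> j < m' \<Longrightarrow> (\<forall>X. F X $$ (i, j) = 0) \<or>
      (\<exists>c p q. p < n \<and> q < m \<and> (\<forall>X. F X $$ (i, j) = c * X $$ (p, q)))"
  shows "regular_map n m n' m' F"
  unfolding regular_map_def
proof (intro allI impI matrix_overI assms(1))
  fix R :: "((nat \<Rightarrow> 'k mat) \<Rightarrow> 'k) set" and A i j
  assume R: "function_algebra R" and A: "matrix_over R n m A" and ij: "i < n'" "j < m'"
  show "(\<lambda>x. F (A x) $$ (i, j)) \<in> R"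
    using assms(2)[OF ij] by (auto intro!: function_algebraD[OF R] matrix_overD(2)[OF A])
qed

text \<open>The target is a sum of pairs of blocks of sizes \<open>A j\<close> and \<open>B j\<close> (labelled \<open>True\<close> and
  \<open>False\<close>). The block of size \<open>L j\<close> embeds into the \<open>j\<close>-th pair as an inclusion into the longer
  block plus a quotient map onto the shorter one; the cokernel is a single block of size
  \<open>A j + B j - L j\<close>.\<close>
locale interlaced_blocks =
  fixes s :: nat and A B L :: "nat \<Rightarrow> nat"
  assumes B_le_L: "j < s \<Longrightarrow> B j \<le> L j" and L_le_A: "j < s \<Longrightarrow> L j \<le> A j"
    and gap: "j < s \<Longrightarrow> c < s \<Longrightarrow> L j = B j \<or> A j \<le> (if b then A c else B c) \<or> (if b then A c else B c) \<le> B j"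
begin

definition K :: "nat \<Rightarrow> nat" where "K j = A j + B j - L j"
definition shift :: "nat \<Rightarrow> nat" where "shift j = L j - B j"
definition M :: "nat \<times> bool \<Rightarrow> nat" where "M i = (if snd i then A (fst i) else B (fst i))"

definition pairs :: "(nat \<times> bool) set" where "pairs = {..<s} \<times> UNIV"

lemma pairs_iff[simp]: "(j, b) \<in> pairs \<longleftrightarrow> j < s" by (simp add: pairs_def)
lemma finite_pairs[simp]: "finite pairs" by (simp add: pairs_def)
lemma M_simps[simp]: "M (j, True) = A j" "M (j, False) = B j" by (simp_all add: M_def)

lemma L_eq: "j < s \<Longrightarrow> L j = B j + shift j" and A_eq: "j < s \<Longrightarrow> A j = K j + shift j"
  and B_le_K: "j < s \<Longrightarrow> B j \<le> K j"
  using B_le_L[of j] L_le_A[of j] by (simp_all add: K_def shift_def)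

text \<open>Index 0 spans the kernel of a block, so an inclusion keeps indices, while a quotient map
  lowers them by the difference of the lengths, here \<open>L j - B j\<close>.\<close>

definition emb :: "(nat \<times> bool) \<times> nat \<Rightarrow> nat \<times> nat \<Rightarrow> 'k::field" where
  "emb y z = (case z of (j, q) \<Rightarrow> (if y = ((j, True), q) then 1 else 0)
     + (if shift j \<le> q \<and> y = ((j, False), q - shift j) then 1 else 0))"

text \<open>Since \<open>A j - K j = L j - B j\<close>, the quotient map onto the cokernel block
  lowers indices by the same \<open>shift j\<close>, and the minus sign makes the two components
  cancel on the image of \<open>emb\<close>.\<close>

definition proj :: "nat \<times> nat \<Rightarrow> (nat \<times> bool) \<times> nat \<Rightarrow> 'k::field" where
  "proj z y = (case z of (j, p) \<Rightarrow> (if y = ((j, True), p + shift j) then 1 else 0)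
     - (if y = ((j, False), p) then 1 else 0))"

text \<open>On the image of \<open>emb\<close>, coordinates from \<open>shift j\<close> on appear in
  both blocks of the pair. Reading them off the short block makes the retraction vanish on the image
  of \<open>proj_section\<close>.\<close>

definition emb_retract :: "nat \<times> nat \<Rightarrow> (nat \<times> bool) \<times> nat \<Rightarrow> 'k::field" where
  "emb_retract z y = (case z of (j, p) \<Rightarrow> (if y = ((j, True), p) \<and> p < shift j then 1 else 0)
     + (if shift j \<le> p \<and> y = ((j, False), p - shift j) then 1 else 0))"

definition proj_section :: "(nat \<times> bool) \<times> nat \<Rightarrow> nat \<times> nat \<Rightarrow> 'k::field" where
  "proj_section y z = (case z of (j, q) \<Rightarrow> if y = ((j, True), q + shift j) then 1 else 0)"

lemma sum_mult_emb:
  assumes "(j, q) \<in> cells {..<s} L"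
  shows "(\<Sum>y\<in>cells pairs M. G y * emb y (j, q))
    = G ((j, True), q) + (if shift j \<le> q then G ((j, False), q - shift j) else (0::'k::field))"
proof -
  have "(\<Sum>y\<in>cells pairs M. G y * emb y (j, q))
     = (\<Sum>y\<in>cells pairs M. G y * (if y = ((j, True), q) then 1 else 0))
     + (\<Sum>y\<in>cells pairs M. G y * (if y = ((j, False), q - shift j) then if shift j \<le> q then 1 else 0 else 0))"
    unfolding sum.distrib[symmetric] by (rule sum.cong) (auto simp: emb_def)
  also have "\<dots> = G ((j, True), q) + (if shift j \<le> q then G ((j, False), q - shift j) else 0)"
    using assms L_le_A[of j] L_eq[of j] by (auto simp: sum_delta_eq)
  finally show ?thesis .
qed

lemma sum_proj_mult:
  assumes "(j, p) \<in> cells {..<s} K"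
  shows "(\<Sum>y\<in>cells pairs M. proj (j, p) y * G y)
    = G ((j, True), p + shift j) - (if p < B j then G ((j, False), p) else (0::'k::field))"
proof -
  have "(\<Sum>y\<in>cells pairs M. proj (j, p) y * G y)
     = (\<Sum>y\<in>cells pairs M. (if y = ((j, True), p + shift j) then 1 else 0) * G y)
     - (\<Sum>y\<in>cells pairs M. (if y = ((j, False), p) then 1 else 0) * G y)"
    unfolding sum_subtractf[symmetric] by (rule sum.cong) (auto simp: proj_def)
  also have "\<dots> = G ((j, True), p + shift j) - (if p < B j then G ((j, False), p) else 0)"
    using assms A_eq[of j] by (auto simp: sum_delta_eq)
  finally show ?thesis .
qed

lemma sum_emb_mult:
  assumes "((j, b), p) \<in> cells pairs M"
  shows "(\<Sum>z\<in>cells {..<s} L. emb ((j, b), p) z * G z)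
    = (if b then if p < L j then G (j, p) else 0 else (G (j, p + shift j) :: 'k::field))"
proof -
  have "(\<Sum>z\<in>cells {..<s} L. emb ((j, b), p) z * G z)
     = (\<Sum>z\<in>cells {..<s} L. (if z = (j, if b then p else p + shift j) then 1 else 0) * G z)"
    by (rule sum.cong) (auto simp: emb_def split: if_splits)
  also have "\<dots> = (if b then if p < L j then G (j, p) else 0 else G (j, p + shift j))"
    using assms L_eq[of j] by (auto simp: sum_delta_eq)
  finally show ?thesis .
qed

lemma sum_proj_section_mult:
  assumes "((j, b), p) \<in> cells pairs M"
  shows "(\<Sum>z\<in>cells {..<s} K. proj_section ((j, b), p) z * G z)
    = (if b \<and> shift j \<le> p then (G (j, p - shift j) :: 'k::field) else 0)"
proof -
  have "(\<Sum>z\<in>cells {..<s} K. proj_section ((j, b), p) z * G z)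
     = (\<Sum>z\<in>cells {..<s} K. (if z = (j, p - shift j) then if b \<and> shift j \<le> p then 1 else 0 else 0) * G z)"
    by (rule sum.cong) (auto simp: proj_section_def split: if_splits)
  also have "\<dots> = (if b \<and> shift j \<le> p then G (j, p - shift j) else 0)"
    using assms A_eq[of j] by (cases b) (auto simp: sum_delta_eq)
  finally show ?thesis .
qed

lemma proj_emb:
  assumes "x \<in> cells {..<s} K" "z \<in> cells {..<s} L"
  shows "(\<Sum>y\<in>cells pairs M. proj x y * emb y z) = (0::'k::field)"
proof (cases x; cases z)
  fix j p j' q assume "x = (j, p)" "z = (j', q)"
  with assms show ?thesis by (auto simp: sum_mult_emb) (auto simp: proj_def)
qed

lemma proj_proj_section:
  assumes "x \<in> cells {..<s} K" "z \<in> cells {..<s} K"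
  shows "(\<Sum>y\<in>cells pairs M. proj x y * proj_section y z) = (if x = z then 1 else 0 :: 'k::field)"
proof (cases x; cases z)
  fix j p j' q assume "x = (j, p)" "z = (j', q)"
  with assms show ?thesis by (auto simp: sum_proj_mult) (auto simp: proj_section_def)
qed

lemma emb_proj_split:
  assumes "x \<in> cells pairs M" "y \<in> cells pairs M"
  shows "(\<Sum>z\<in>cells {..<s} L. emb x z * emb_retract z y) + (\<Sum>z\<in>cells {..<s} K. proj_section x z * proj z y)
    = (if x = y then 1 else 0 :: 'k::field)"
proof -
  obtain j b p j' b' q where xy: "x = ((j, b), p)" "y = ((j', b'), q)" by (metis surj_pair)
  show ?thesis
    using assms L_eq[of j] unfolding xy
    by (subst sum_emb_mult, simp, subst sum_proj_section_mult, simp)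
      (cases b; cases b'; auto simp: emb_retract_def proj_def)
qed

section \<open>Factoring homomorphisms through the embedding and the projection\<close>

lemma block_hom_emb:
  assumes "i \<in> pairs" "j < s"
  shows "block_hom (M i) (L j) (\<lambda>p q. emb (i, p) (j, q) :: 'k::field)"
  using assms L_le_A[of j] L_eq[of j]
  by (cases i; cases "snd i") (auto simp: block_hom_def emb_def)

lemma block_hom_proj:
  assumes "i \<in> pairs" "j < s"
  shows "block_hom (K j) (M i) (\<lambda>p q. proj (j, p) (i, q) :: 'k::field)"
  using assms B_le_K[of j] A_eq[of j]
  by (cases i; cases "snd i") (auto simp: block_hom_def proj_def)

text \<open>For fixed \<open>j\<close> and \<open>c\<close> only one block of the pair is used: a
  homomorphism into a block of length at least \<open>A j\<close> is prolonged to the long block,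
  any other one descends to the short block. If \<open>L j = B j\<close>, the component of
  \<open>emb\<close> onto the short block is an isomorphism and serves every target.\<close>

definition factor_emb :: "((nat \<times> bool) \<times> nat \<Rightarrow> nat \<times> nat \<Rightarrow> 'k::field)
    \<Rightarrow> (nat \<times> bool) \<times> nat \<Rightarrow> (nat \<times> bool) \<times> nat \<Rightarrow> 'k" where
  "factor_emb X = (\<lambda>(c, p) ((j, b), q).
     if L j \<noteq> B j \<and> A j \<le> M c then (if b \<and> p \<le> q \<and> q - p < L j then X (c, 0) (j, q - p) else 0)
     else (if b then 0 else X (c, p) (j, q + shift j)))"

text \<open>Dual to \<open>factor_emb\<close>. If \<open>L j = B j\<close>, then
  \<open>K j = A j\<close> and it is the long block that maps isomorphically onto the cokernel
  block; hence this case stands in the other branch.\<close>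

definition factor_proj :: "(nat \<times> nat \<Rightarrow> (nat \<times> bool) \<times> nat \<Rightarrow> 'k::field)
    \<Rightarrow> (nat \<times> bool) \<times> nat \<Rightarrow> (nat \<times> bool) \<times> nat \<Rightarrow> 'k" where
  "factor_proj Y = (\<lambda>((j, b), p) (c, q).
     if L j = B j \<or> A j \<le> M c then
       (if b then (if shift j \<le> p then Y (j, p - shift j) (c, q)
         else if 0 < K j \<and> q + (shift j - p) < M c then Y (j, 0) (c, q + (shift j - p)) else 0) else 0)
     else (if b then 0 else - Y (j, p) (c, q)))"

lemma gap_cases:
  assumes "j < s" "c \<in> pairs"
  obtains "L j \<noteq> B j" "A j \<le> M c" | "M c \<le> B j" | "L j = B j" "shift j = 0"
proof -
  have "L j = B j \<or> A j \<le> M c \<or> M c \<le> B j"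
    using gap[OF assms(1), of "fst c" "snd c"] assms(2) by (auto simp: M_def pairs_def)
  then show thesis using that by (auto simp: shift_def)
qed

lemma block_hom_factor_emb:
  assumes X: "\<And>c j. c \<in> pairs \<Longrightarrow> j < s \<Longrightarrow> block_hom (M c) (L j) (\<lambda>p q. X (c, p) (j, q))"
    and "c \<in> pairs" "i \<in> pairs"
  shows "block_hom (M c) (M i) (\<lambda>p q. factor_emb X (c, p) (i, q))"
proof -
  obtain j b where i: "i = (j, b)" "j < s" using assms(3) by (cases i) auto
  note X' = X[OF assms(2) i(2)]
  show ?thesis
  proof (cases "L j \<noteq> B j \<and> A j \<le> M c")
    case True
    with block_hom_extend_source[OF X' L_le_A[OF i(2)]] show ?thesis
      by (cases b) (simp_all add: factor_emb_def i block_hom_zero)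
  next
    case False
    then have "M c \<le> B j \<or> shift j = 0" using gap_cases[OF i(2) assms(2)] by metis
    from block_hom_source_quotient[OF X' L_eq[OF i(2)] this] show ?thesis
      using False by (cases b) (auto simp add: factor_emb_def i block_hom_zero)
  qed
qed

lemma factor_emb:
  assumes X: "\<And>c j. c \<in> pairs \<Longrightarrow> j < s \<Longrightarrow> block_hom (M c) (L j) (\<lambda>p q. X (c, p) (j, q))"
    and "x \<in> cells pairs M" "z \<in> cells {..<s} L"
  shows "(\<Sum>y\<in>cells pairs M. factor_emb X x y * emb y z) = X x z"
proof -
  obtain c p j q where xz: "x = (c, p)" "z = (j, q)" by fastforce
  with assms(2,3) have *: "c \<in> pairs" "p < M c" "j < s" "q < L j" by auto
  note X' = X[OF *(1,3)]
  \<comment> \<open>Columns below \<open>shift j\<close> of \<open>emb\<close> meet only the long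
    block, on which this branch is zero, so there \<open>X\<close> itself has to vanish.\<close>
  have "shift j \<le> q \<or> X (c, p) (j, q) = 0" if "\<not> (L j \<noteq> B j \<and> A j \<le> M c)"
  proof (cases "shift j \<le> q")
    case False
    then have "M c \<le> B j" using that gap_cases[OF *(3,1)] by (metis le0)
    then have "X (c, p) (j, q) = 0"
      using False * L_eq[OF *(3)] by (intro block_hom_source_longer[OF X']) auto
    then show ?thesis by simp
  qed simp
  then show ?thesis
    using block_hom_toeplitz[OF X' *(2,4)] block_hom_below_diagonal[OF X' *(2,4)] *
    unfolding xz by (subst sum_mult_emb) (auto simp: factor_emb_def not_le)
qed

lemma block_hom_factor_proj:
  assumes Y: "\<And>c j. c \<in> pairs \<Longrightarrow> j < s \<Longrightarrow> block_hom (K j) (M c) (\<lambda>p q. Y (j, p) (c, q))"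
    and "c \<in> pairs" "i \<in> pairs"
  shows "block_hom (M i) (M c) (\<lambda>p q. factor_proj Y (i, p) (c, q))"
proof -
  obtain j b where i: "i = (j, b)" "j < s" using assms(3) by (cases i) auto
  note Y' = Y[OF assms(2) i(2)]
  show ?thesis
  proof (cases "L j = B j \<or> A j \<le> M c")
    case True
    then have "A j \<le> M c \<or> shift j = 0" by (auto simp: shift_def)
    from block_hom_lift_quotient[OF Y' A_eq[OF i(2)] this] True show ?thesis
      by (cases b) (simp_all add: factor_proj_def i block_hom_zero)
  next
    case False
    then have "M c \<le> B j \<or> B j = K j" using gap_cases[OF i(2) assms(2)] by metis
    from block_hom_restrict_target[OF Y' B_le_K[OF i(2)] this] False show ?thesis
      by (cases b) (simp_all add: factor_proj_def i block_hom_zero)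
  qed
qed

lemma factor_proj:
  assumes Y: "\<And>c j. c \<in> pairs \<Longrightarrow> j < s \<Longrightarrow> block_hom (K j) (M c) (\<lambda>p q. Y (j, p) (c, q))"
    and "x \<in> cells pairs M" "z \<in> cells {..<s} K"
  shows "(\<Sum>y\<in>cells pairs M. proj z y * factor_proj Y y x) = Y z x"
proof -
  obtain c q j p where xz: "x = (c, q)" "z = (j, p)" by fastforce
  with assms(2,3) have *: "c \<in> pairs" "q < M c" "j < s" "p < K j" by auto
  note Y' = Y[OF *(1,3)]
  \<comment> \<open>Rows of \<open>proj\<close> from \<open>B j\<close> on have no short component,
    so there \<open>Y\<close> has to vanish in this branch.\<close>
  have "p < B j \<or> Y (j, p) (c, q) = 0" if "\<not> (L j = B j \<or> A j \<le> M c)"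
  proof (cases "p < B j")
    case False
    then have "M c \<le> B j" using that gap_cases[OF *(3,1)] by metis
    then have "Y (j, p) (c, q) = 0"
      using False * by (intro block_hom_below_diagonal[OF Y']) auto
    then show ?thesis by simp
  qed simp
  then show ?thesis
    using * unfolding xz by (subst sum_proj_mult) (auto simp: factor_proj_def)
qed

end

section \<open>Jordan types\<close>

text \<open>The numbering of the cells is existential, so neither the order of the blocks nor the
  type of their labels matters; lists, pairs and families over arrows become interchangeable
  descriptions of one Jordan type.\<close>

definition jordan_cells :: "'k::field mat \<Rightarrow> nat \<Rightarrow> 'i set \<Rightarrow> ('i \<Rightarrow> nat) \<Rightarrow> bool" where
  "jordan_cells N n S m \<longleftrightarrow> (\<exists>e. bij_betw e {..<n} (cells S m) \<and> similar_mat N (jordan_mat e n))"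

text \<open>Relabelling changes the numbering but not the Jordan matrix itself, and only blocks of
  positive size have cells to relabel.\<close>

lemma jordan_cells_reindex:
  assumes N: "jordan_cells N n S m" and g: "bij_betw g {i\<in>S. 0 < m i} {i\<in>S'. 0 < m' i}"
    and m: "\<And>i. i \<in> S \<Longrightarrow> 0 < m i \<Longrightarrow> m' (g i) = m i"
  shows "jordan_cells N n S' m'"
proof -
  obtain e where e: "bij_betw e {..<n} (cells S m)" "similar_mat N (jordan_mat e n)"
    using N unfolding jordan_cells_def by blast
  define h where "h = (\<lambda>(i, p :: nat). (g i, p))"
  have inj: "inj_on g {i\<in>S. 0 < m i}" using g by (simp add: bij_betw_def)
  have h_inj: "inj_on h (cells S m)"
    using inj by (auto simp: inj_on_def h_def)
  have "h ` cells S m = cells S' m'"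
  proof (intro equalityI subsetI)
    fix y assume "y \<in> h ` cells S m"
    then obtain i p where y: "y = (g i, p)" "i \<in> S" "p < m i" by (auto simp: h_def)
    then have "g i \<in> {i\<in>S'. 0 < m' i}" using bij_betwE[OF g] by auto
    then show "y \<in> cells S' m'" using y m[of i] by auto
  next
    fix y assume "y \<in> cells S' m'"
    then obtain j p where y: "y = (j, p)" "j \<in> S'" "p < m' j" by (cases y) auto
    then have "j \<in> g ` {i\<in>S. 0 < m i}" using g by (auto simp: bij_betw_def)
    then obtain i where "i \<in> S" "0 < m i" "j = g i" by blast
    then show "y \<in> h ` cells S m" using y m[of i] by (force simp: h_def)
  qed
  with h_inj have he: "bij_betw (h \<circ> e) {..<n} (cells S' m')"
    using bij_betw_trans[OF e(1)] bij_betw_imageI by metis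
  have "(jordan_mat e n :: 'a mat) = index_mat e e n n (\<lambda>x y. jordan_entry (h x) (h y))"
    using inj by (intro index_mat_cong[OF e(1) e(1)]) (auto simp: jordan_entry_def h_def cells_def inj_on_eq_iff)
  then have "(jordan_mat (h \<circ> e) n :: 'a mat) = jordan_mat e n" by (simp add: index_mat_def)
  then show ?thesis using e(2) he unfolding jordan_cells_def by metis
qed

text \<open>A bijection is chosen for each positive size separately; the size of a block tells which
  one to apply, so they glue.\<close>

lemma jordan_cells_cong_card:
  assumes N: "jordan_cells N n S m" and fin: "finite S" "finite S'"
    and card: "\<And>v. 0 < v \<Longrightarrow> card {i\<in>S. m i = v} = card {i\<in>S'. m' i = v}"
  shows "jordan_cells N n S' m'"
proof -
  have "\<forall>v. \<exists>g. 0 < v \<longrightarrow> bij_betw g {i\<in>S. m i = v} {i\<in>S'. m' i = v}"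
    using card fin by (auto intro!: finite_same_card_bij)
  then obtain g where g: "\<And>v. 0 < v \<Longrightarrow> bij_betw (g v) {i\<in>S. m i = v} {i\<in>S'. m' i = v}" by metis
  define h where "h i = g (m i) i" for i
  have hm: "h i \<in> S' \<and> m' (h i) = m i" if "i \<in> S" "0 < m i" for i
    using bij_betwE[OF g[OF that(2)]] that(1) by (auto simp: h_def)
  have "bij_betw h {i\<in>S. 0 < m i} {i\<in>S'. 0 < m' i}"
    unfolding bij_betw_def
  proof (intro conjI inj_onI equalityI subsetI)
    fix i j assume i: "i \<in> {i\<in>S. 0 < m i}" and j: "j \<in> {i\<in>S. 0 < m i}" and eq: "h i = h j"
    then have "m i = m j" using hm[of i] hm[of j] by simp
    then show "i = j" using i j eq g[of "m i"] by (auto simp: h_def bij_betw_def inj_on_def)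
  next
    fix j assume "j \<in> {i\<in>S'. 0 < m' i}"
    then have "0 < m' j" "j \<in> g (m' j) ` {i\<in>S. m i = m' j}"
      using g[of "m' j"] by (auto simp: bij_betw_def)
    then obtain i where "i \<in> S" "m i = m' j" "j = g (m' j) i" by blast
    with \<open>0 < m' j\<close> show "j \<in> h ` {i\<in>S. 0 < m i}" by (auto simp: h_def intro!: image_eqI[of _ _ i])
  qed (use hm in auto)
  then show ?thesis using jordan_cells_reindex[OF N] hm by blast
qed

lemma jordan_matrix_eq_jordan_mat:
  "\<exists>e. bij_betw e {..<sum_list \<nu>} (cells {..<length \<nu>} ((!) \<nu>)) \<and>
     (jordan_matrix (map (\<lambda>s. (s, 0)) \<nu>) :: 'k::field mat) = jordan_mat e (sum_list \<nu>)"
proof (induction \<nu>)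
  case Nil
  show ?case by (auto simp: jordan_matrix_def index_mat_def cells_def bij_betw_def intro!: eq_matI)
next
  case (Cons n \<nu>)
  let ?J = "jordan_matrix (map (\<lambda>s. (s, 0)) \<nu>) :: 'k mat"
  have sum: "sum_list (map fst (map (\<lambda>s. (s, 0 :: 'k)) \<nu>)) = sum_list \<nu>" by (simp add: o_def)
  obtain e where e: "bij_betw e {..<sum_list \<nu>} (cells {..<length \<nu>} ((!) \<nu>))"
    and J: "?J = jordan_mat e (sum_list \<nu>)" using Cons by blast
  define h where "h a = (if a < n then (0, a) else (Suc (fst (e (a - n))), snd (e (a - n))))" for a
  have e_in: "fst (e a) < length \<nu>" "snd (e a) < \<nu> ! fst (e a)" if "a < sum_list \<nu>" for a
  proof -
    have "e a \<in> cells {..<length \<nu>} ((!) \<nu>)" using bij_betwE[OF e] that by blast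
    then show "fst (e a) < length \<nu>" "snd (e a) < \<nu> ! fst (e a)" by (auto simp: cells_def)
  qed
  have e_inj: "a = b" if "a < sum_list \<nu>" "b < sum_list \<nu>" "e a = e b" for a b
    using inj_onD[OF bij_betw_imp_inj_on[OF e] that(3)] that by simp
  have "bij_betw h {..<sum_list (n # \<nu>)} (cells {..<length (n # \<nu>)} ((!) (n # \<nu>)))"
    unfolding bij_betw_def
  proof (intro conjI inj_onI equalityI subsetI)
    fix a b assume ab: "a \<in> {..<sum_list (n # \<nu>)}" "b \<in> {..<sum_list (n # \<nu>)}" and eq: "h a = h b"
    show "a = b"
    proof (cases "a < n \<or> b < n")
      case True
      with eq show ?thesis by (auto simp: h_def split: if_splits)
    next
      case False
      with eq have "e (a - n) = e (b - n)" by (simp add: h_def prod_eq_iff)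
      moreover have "n \<le> a" "n \<le> b" "a - n < sum_list \<nu>" "b - n < sum_list \<nu>"
        using ab False by auto
      ultimately show ?thesis using e_inj[of "a - n" "b - n"] by linarith
    qed
  next
    fix y assume "y \<in> h ` {..<sum_list (n # \<nu>)}"
    then obtain a where "y = h a" "a < n + sum_list \<nu>" by auto
    then show "y \<in> cells {..<length (n # \<nu>)} ((!) (n # \<nu>))"
      using e_in[of "a - n"] by (auto simp: h_def)
  next
    fix y assume "y \<in> cells {..<length (n # \<nu>)} ((!) (n # \<nu>))"
    then obtain i p where y: "y = (i, p)" "i < Suc (length \<nu>)" "p < (n # \<nu>) ! i" by (cases y) auto
    show "y \<in> h ` {..<sum_list (n # \<nu>)}"
    proof (cases i)
      case 0
      with y show ?thesis by (auto simp: h_def intro!: image_eqI[of _ _ p])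
    next
      case (Suc i')
      with y have "(i', p) \<in> e ` {..<sum_list \<nu>}" using e by (auto simp: bij_betw_def)
      then obtain a where "a < sum_list \<nu>" "e a = (i', p)" by auto
      with y Suc show ?thesis by (auto simp: h_def intro!: image_eqI[of _ _ "a + n"])
    qed
  qed
  moreover have "jordan_matrix (map (\<lambda>s. (s, 0)) (n # \<nu>)) = (jordan_mat h (sum_list (n # \<nu>)) :: 'k mat)"
  proof -
    have "jordan_matrix (map (\<lambda>s. (s, 0)) (n # \<nu>)) = four_block_mat (jordan_block n 0)
        (0\<^sub>m n (sum_list \<nu>)) (0\<^sub>m (sum_list \<nu>) n) ?J"
      unfolding list.map jordan_matrix_Cons sum ..
    also have "\<dots> = jordan_mat h (sum_list (n # \<nu>))"
      unfolding J using e_in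
      by (intro eq_matI) (auto simp: index_mat_def h_def jordan_entry_def)
    finally show ?thesis .
  qed
  ultimately show ?case by blast
qed

lemma jordan_type_cells:
  assumes "jordan_type N \<nu>"
  shows "jordan_cells N (sum_list \<nu>) {..<length \<nu>} ((!) \<nu>)"
  using assms jordan_matrix_eq_jordan_mat[of \<nu>, where 'k = 'a]
  unfolding jordan_type_def jordan_cells_def by metis

text \<open>\<open>diff_part\<close> drops the zeros of \<open>diff_seq\<close>; a block of size 0
  does not change the matrix.\<close>

lemma jordan_matrix_filter_pos:
  "jordan_matrix (map (\<lambda>s. (s, 0)) (filter (\<lambda>x. 0 < x) \<nu>)) = (jordan_matrix (map (\<lambda>s. (s, 0)) \<nu>) :: 'k::field mat)"
proof (induction \<nu>)
  case (Cons n \<nu>)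
  have "sum_list (filter ((<) 0) \<nu>) = sum_list \<nu>" by (induction \<nu>) auto
  with Cons show ?case
    by (cases "n = 0") (auto simp: jordan_matrix_Cons o_def intro!: eq_matI)
qed simp

lemma the_inv_into_less:
  assumes "bij_betw e {..<n} I" "x \<in> I"
  shows "the_inv_into {..<n} e x < n"
  using the_inv_into_into[OF bij_betw_imp_inj_on[OF assms(1)], of x "{..<n}"] assms
  by (auto simp: bij_betw_def)

text \<open>Reads a matrix as a function of labels, the form in which \<open>factor_emb\<close> and
  \<open>factor_proj\<close> take their argument.\<close>

definition mat_entry :: "(nat \<Rightarrow> 'i) \<Rightarrow> nat \<Rightarrow> (nat \<Rightarrow> 'j) \<Rightarrow> nat \<Rightarrow> 'k mat \<Rightarrow> 'i \<Rightarrow> 'j \<Rightarrow> 'k" where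
  "mat_entry e n e' m X x y = X $$ (the_inv_into {..<n} e x, the_inv_into {..<m} e' y)"

lemma index_mat_mat_entry:
  assumes "bij_betw e {..<n} I" "bij_betw e' {..<m} I'" "X \<in> carrier_mat n m"
  shows "index_mat e e' n m (mat_entry e n e' m X) = X"
  using mat_eq_index_mat[OF assms] by (simp add: mat_entry_def[abs_def])

context interlaced_blocks begin

end

section \<open>Factoring sequences\<close>

lemma conjugate_mult:
  fixes P :: "'k::field mat"
  assumes P: "P \<in> carrier_mat a a" and X: "X \<in> carrier_mat a b" and Q: "Q \<in> carrier_mat b b"
    and P': "P' \<in> carrier_mat b b" and Y: "Y \<in> carrier_mat b c" and Q': "Q' \<in> carrier_mat c c"
    and QP: "Q * P' = 1\<^sub>m b"
  shows "(P * X * Q) * (P' * Y * Q') = P * (X * Y) * Q'"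
proof -
  have "Q * (P' * Y * Q') = Q * (P' * (Y * Q'))" by (simp add: assoc_mult_mat[OF P' Y Q'])
  also have "\<dots> = Q * P' * (Y * Q')"
    by (rule assoc_mult_mat[symmetric, of _ b b _ b _ c]) (use assms in auto)
  also have "\<dots> = Y * Q'" using Y Q' by (simp add: QP)
  finally have *: "Q * (P' * Y * Q') = Y * Q'" .
  have "(P * X * Q) * (P' * Y * Q') = P * X * (Q * (P' * Y * Q'))"
    by (rule assoc_mult_mat[of _ a b _ b _ c]) (use assms in auto)
  also have "\<dots> = P * X * Y * Q'"
    unfolding * by (rule assoc_mult_mat[symmetric, of _ a b _ c _ c]) (use assms in auto)
  also have "P * X * Y = P * (X * Y)" by (rule assoc_mult_mat[OF P X Y])
  finally show ?thesis .
qed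

lemma conjugate_inverse:
  fixes P :: "'k::field mat"
  assumes "P \<in> carrier_mat a a" "Q \<in> carrier_mat a a" "P' \<in> carrier_mat b b" "Q' \<in> carrier_mat b b"
    and "X \<in> carrier_mat a b" "P * Q = 1\<^sub>m a" "P' * Q' = 1\<^sub>m b"
  shows "P * (Q * X * P') * Q' = X"
proof -
  have "P * (Q * X * P') = P * (Q * (X * P'))" using assms(1-5) by simp
  also have "\<dots> = P * Q * (X * P')" using assms(1-5) by (intro assoc_mult_mat[symmetric]) auto
  also have "\<dots> = X * P'" using assms by simp
  also have "X * P' * Q' = X * (P' * Q')" using assms(1-5) by (intro assoc_mult_mat) auto
  finally show ?thesis using assms by simp
qed

text \<open>The maps \<open>r\<close> and \<open>\<sigma>\<close> split the exact sequence \<open>L \<rightarrow> M \<rightarrow> K\<close> only as a sequence of vector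
  spaces; they need not commute with the operators.\<close>
definition factoring_sequence :: "nat \<Rightarrow> nat \<Rightarrow> nat \<Rightarrow> 'k::field mat \<Rightarrow> 'k mat \<Rightarrow> 'k mat \<Rightarrow>
    'k mat \<Rightarrow> 'k mat \<Rightarrow> 'k mat \<Rightarrow> 'k mat \<Rightarrow> ('k mat \<Rightarrow> 'k mat) \<Rightarrow> ('k mat \<Rightarrow> 'k mat) \<Rightarrow> bool" where
  "factoring_sequence l m k L M K \<phi> \<psi> r \<sigma> F G \<longleftrightarrow>
     \<phi> \<in> carrier_mat m l \<and> \<psi> \<in> carrier_mat k m \<and> r \<in> carrier_mat l m \<and> \<sigma> \<in> carrier_mat m k \<and>
     M * \<phi> = \<phi> * L \<and> K * \<psi> = \<psi> * M \<and>
     \<psi> * \<phi> = 0\<^sub>m k l \<and> \<psi> * \<sigma> = 1\<^sub>m k \<and> \<phi> * r + \<sigma> * \<psi> = 1\<^sub>m m \<and>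
     regular_map m l m m F \<and> regular_map k m m m G \<and>
     (\<forall>X\<in>carrier_mat m l. M * X = X * L \<longrightarrow> M * F X = F X * M \<and> F X * \<phi> = X) \<and>
     (\<forall>Y\<in>carrier_mat k m. K * Y = Y * M \<longrightarrow> M * G Y = G Y * M \<and> \<psi> * G Y = Y)"

lemma factoring_sequenceD:
  assumes "factoring_sequence l m k L M K \<phi> \<psi> r \<sigma> F G"
  shows "\<phi> \<in> carrier_mat m l" "\<psi> \<in> carrier_mat k m" "r \<in> carrier_mat l m" "\<sigma> \<in> carrier_mat m k"
    "M * \<phi> = \<phi> * L" "K * \<psi> = \<psi> * M"
    "\<psi> * \<phi> = 0\<^sub>m k l" "\<psi> * \<sigma> = 1\<^sub>m k" "\<phi> * r + \<sigma> * \<psi> = 1\<^sub>m m"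
    "regular_map m l m m F" "regular_map k m m m G"
    "\<forall>X\<in>carrier_mat m l. M * X = X * L \<longrightarrow> M * F X = F X * M \<and> F X * \<phi> = X"
    "\<forall>Y\<in>carrier_mat k m. K * Y = Y * M \<longrightarrow> M * G Y = G Y * M \<and> \<psi> * G Y = Y"
  using assms unfolding factoring_sequence_def by - (elim conjE, assumption)+

lemma factoring_sequence_factor:
  assumes "factoring_sequence l m k L M K \<phi> \<psi> r \<sigma> F G"
  shows "X \<in> carrier_mat m l \<Longrightarrow> M * X = X * L \<Longrightarrow> M * F X = F X * M"
    "X \<in> carrier_mat m l \<Longrightarrow> M * X = X * L \<Longrightarrow> F X * \<phi> = X"
    "Y \<in> carrier_mat k m \<Longrightarrow> K * Y = Y * M \<Longrightarrow> M * G Y = G Y * M"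
    "Y \<in> carrier_mat k m \<Longrightarrow> K * Y = Y * M \<Longrightarrow> \<psi> * G Y = Y"
  using factoring_sequenceD(12,13)[OF assms] by simp_all

text \<open>The bases of the three spaces are changed independently. \<open>F\<close> and
  \<open>G\<close> are conjugated accordingly and stay regular, because only multiplications by
  constant matrices are added.\<close>

lemma factoring_sequence_similar:
  fixes L M K :: "'k::field mat"
  assumes seq: "factoring_sequence l m k L' M' K' \<phi> \<psi> r \<sigma> F G"
    and L: "L \<in> carrier_mat l l" "similar_mat L L'" and M: "M \<in> carrier_mat m m" "similar_mat M M'"
    and K: "K \<in> carrier_mat k k" "similar_mat K K'"
  shows "\<exists>\<phi> \<psi> r \<sigma> F G. factoring_sequence l m k L M K \<phi> \<psi> r \<sigma> F G"
proof -
  obtain P\<^sub>L Q\<^sub>L where L': "P\<^sub>L * Q\<^sub>L = 1\<^sub>m l" "Q\<^sub>L * P\<^sub>L = 1\<^sub>m l" "L = P\<^sub>L * L' * Q\<^sub>L" "L' \<in> carrier_mat l l"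
      "P\<^sub>L \<in> carrier_mat l l" "Q\<^sub>L \<in> carrier_mat l l"
    using L(2) similar_mat_witD2[OF L(1)] unfolding similar_mat_def by metis
  obtain P\<^sub>M Q\<^sub>M where M': "P\<^sub>M * Q\<^sub>M = 1\<^sub>m m" "Q\<^sub>M * P\<^sub>M = 1\<^sub>m m" "M = P\<^sub>M * M' * Q\<^sub>M" "M' \<in> carrier_mat m m"
      "P\<^sub>M \<in> carrier_mat m m" "Q\<^sub>M \<in> carrier_mat m m"
    using M(2) similar_mat_witD2[OF M(1)] unfolding similar_mat_def by metis
  obtain P\<^sub>K Q\<^sub>K where K': "P\<^sub>K * Q\<^sub>K = 1\<^sub>m k" "Q\<^sub>K * P\<^sub>K = 1\<^sub>m k" "K = P\<^sub>K * K' * Q\<^sub>K" "K' \<in> carrier_mat k k"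
      "P\<^sub>K \<in> carrier_mat k k" "Q\<^sub>K \<in> carrier_mat k k"
    using K(2) similar_mat_witD2[OF K(1)] unfolding similar_mat_def by metis
  note seq' = factoring_sequenceD[OF seq]
  note c = seq'(1-4) and hom = seq'(5,6) and ex = seq'(7-9) and reg = seq'(10,11)
  have L'_eq: "L' = Q\<^sub>L * L * P\<^sub>L" and M'_eq: "M' = Q\<^sub>M * M * P\<^sub>M" and K'_eq: "K' = Q\<^sub>K * K * P\<^sub>K"
    unfolding L'(3) M'(3) K'(3)
    using conjugate_inverse[OF L'(6,5,6,5,4,2,2)] conjugate_inverse[OF M'(6,5,6,5,4,2,2)]
      conjugate_inverse[OF K'(6,5,6,5,4,2,2)] by simp_all
  define F' where "F' X = P\<^sub>M * F (Q\<^sub>M * X * P\<^sub>L) * Q\<^sub>M" for X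
  define G' where "G' Y = P\<^sub>M * G (Q\<^sub>K * Y * P\<^sub>M) * Q\<^sub>M" for Y
  have FX: "M * F' X = F' X * M \<and> F' X * (P\<^sub>M * \<phi> * Q\<^sub>L) = X" if X: "X \<in> carrier_mat m l" "M * X = X * L" for X
  proof -
    let ?X = "Q\<^sub>M * X * P\<^sub>L"
    have Xc: "?X \<in> carrier_mat m l" using M'(6) X(1) L'(5) by (meson mult_carrier_mat)
    have "M' * ?X = ?X * L'"
      unfolding M'_eq L'_eq
      using conjugate_mult[OF M'(6) M(1) M'(5) M'(6) X(1) L'(5) M'(1)]
        conjugate_mult[OF M'(6) X(1) L'(5) L'(6) L(1) L'(5) L'(1)] X(2) by simp
    note FX = factoring_sequence_factor(1,2)[OF seq Xc this]
    note Fc = regular_map_carrier[OF reg(1) Xc]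
    show ?thesis
      unfolding F'_def M'(3)
      using conjugate_mult[OF M'(5,4,6,5) Fc M'(6,2)] conjugate_mult[OF M'(5) Fc M'(6,5,4,6,2)]
        conjugate_mult[OF M'(5) Fc M'(6,5) c(1) L'(6) M'(2)] FX
        conjugate_inverse[OF M'(5,6) L'(5,6) X(1) M'(1) L'(1)] by simp
  qed
  have GY: "M * G' Y = G' Y * M \<and> P\<^sub>K * \<psi> * Q\<^sub>M * G' Y = Y" if Y: "Y \<in> carrier_mat k m" "K * Y = Y * M" for Y
  proof -
    let ?Y = "Q\<^sub>K * Y * P\<^sub>M"
    have Yc: "?Y \<in> carrier_mat k m" using K'(6) Y(1) M'(5) by (meson mult_carrier_mat)
    have "K' * ?Y = ?Y * M'"
      unfolding M'_eq K'_eq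
      using conjugate_mult[OF K'(6) K(1) K'(5) K'(6) Y(1) M'(5) K'(1)]
        conjugate_mult[OF K'(6) Y(1) M'(5) M'(6) M(1) M'(5) M'(1)] Y(2) by simp
    note GY = factoring_sequence_factor(3,4)[OF seq Yc this]
    note Gc = regular_map_carrier[OF reg(2) Yc]
    show ?thesis
      unfolding G'_def M'(3)
      using conjugate_mult[OF M'(5,4,6,5) Gc M'(6,2)] conjugate_mult[OF M'(5) Gc M'(6,5,4,6,2)]
        conjugate_mult[OF K'(5) c(2) M'(6,5) Gc M'(6,2)] GY
        conjugate_inverse[OF K'(5,6) M'(5,6) Y(1) K'(1) M'(1)] by simp
  qed
  have "factoring_sequence l m k L M K (P\<^sub>M * \<phi> * Q\<^sub>L) (P\<^sub>K * \<psi> * Q\<^sub>M) (P\<^sub>L * r * Q\<^sub>M) (P\<^sub>M * \<sigma> * Q\<^sub>K) F' G'"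
    unfolding factoring_sequence_def
  proof (intro conjI ballI impI)
    show "P\<^sub>M * \<phi> * Q\<^sub>L \<in> carrier_mat m l" "P\<^sub>K * \<psi> * Q\<^sub>M \<in> carrier_mat k m"
      "P\<^sub>L * r * Q\<^sub>M \<in> carrier_mat l m" "P\<^sub>M * \<sigma> * Q\<^sub>K \<in> carrier_mat m k"
      using c L'(5,6) M'(5,6) K'(5,6) by (meson mult_carrier_mat)+
    show "M * (P\<^sub>M * \<phi> * Q\<^sub>L) = P\<^sub>M * \<phi> * Q\<^sub>L * L"
      unfolding M'(3) L'(3)
      using conjugate_mult[OF M'(5,4,6,5) c(1) L'(6) M'(2)] conjugate_mult[OF M'(5) c(1) L'(6,5,4,6,2)] hom by simp
    show "K * (P\<^sub>K * \<psi> * Q\<^sub>M) = P\<^sub>K * \<psi> * Q\<^sub>M * M"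
      unfolding M'(3) K'(3)
      using conjugate_mult[OF K'(5,4,6,5) c(2) M'(6) K'(2)] conjugate_mult[OF K'(5) c(2) M'(6,5,4,6,2)] hom by simp
    show "P\<^sub>K * \<psi> * Q\<^sub>M * (P\<^sub>M * \<phi> * Q\<^sub>L) = 0\<^sub>m k l"
      using conjugate_mult[OF K'(5) c(2) M'(6,5) c(1) L'(6) M'(2)] ex(1) K'(5) L'(6) by simp
    show "P\<^sub>K * \<psi> * Q\<^sub>M * (P\<^sub>M * \<sigma> * Q\<^sub>K) = 1\<^sub>m k"
      using conjugate_mult[OF K'(5) c(2) M'(6,5) c(4) K'(6) M'(2)] ex(2) K'(1,5) by simp
    have "P\<^sub>M * \<phi> * Q\<^sub>L * (P\<^sub>L * r * Q\<^sub>M) + P\<^sub>M * \<sigma> * Q\<^sub>K * (P\<^sub>K * \<psi> * Q\<^sub>M) = P\<^sub>M * (\<phi> * r + \<sigma> * \<psi>) * Q\<^sub>M"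
      using conjugate_mult[OF M'(5) c(1) L'(6,5) c(3) M'(6) L'(2)]
        conjugate_mult[OF M'(5) c(4) K'(6,5) c(2) M'(6) K'(2)] c M'(5,6)
      by (simp add: mult_add_distrib_mat[of _ m m _ m] add_mult_distrib_mat[of _ m m _ _ m])
    then show "P\<^sub>M * \<phi> * Q\<^sub>L * (P\<^sub>L * r * Q\<^sub>M) + P\<^sub>M * \<sigma> * Q\<^sub>K * (P\<^sub>K * \<psi> * Q\<^sub>M) = 1\<^sub>m m"
      using ex(3) M'(1,5) by simp
    show "regular_map m l m m F'" unfolding F'_def[abs_def]
      by (rule regular_map_mult_const[OF reg(1) M'(6) L'(5) M'(5,6)])
    show "regular_map k m m m G'" unfolding G'_def[abs_def]
      by (rule regular_map_mult_const[OF reg(2) K'(6) M'(5) M'(5,6)])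
  qed (use FX GY in blast)+
  then show ?thesis by blast
qed

context interlaced_blocks begin

lemma jordan_factoring_sequence:
  assumes eL: "bij_betw eL {..<l} (cells {..<s} L)" and eM: "bij_betw eM {..<m} (cells pairs M)"
    and eK: "bij_betw eK {..<k} (cells {..<s} K)"
  shows "\<exists>\<phi> \<psi> r \<sigma> F G. factoring_sequence l m k (jordan_mat eL l :: 'k::field mat)
    (jordan_mat eM m) (jordan_mat eK k) \<phi> \<psi> r \<sigma> F G"
proof -
  let ?\<phi> = "index_mat eM eL m l emb :: 'k mat" and ?\<psi> = "index_mat eK eM k m proj :: 'k mat"
  let ?r = "index_mat eL eM l m emb_retract :: 'k mat" and ?\<sigma> = "index_mat eM eK m k proj_section :: 'k mat"
  define F :: "'k mat \<Rightarrow> 'k mat" where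
    "F X = index_mat eM eM m m (factor_emb (mat_entry eM m eL l X))" for X
  define G :: "'k mat \<Rightarrow> 'k mat" where
    "G Y = index_mat eM eM m m (factor_proj (mat_entry eK k eM m Y))" for Y
  note inv_less = the_inv_into_less[OF eL] the_inv_into_less[OF eM] the_inv_into_less[OF eK]
  have "regular_map m l m m F"
  proof (rule regular_map_select)
    fix a b assume "a < m" "b < m"
    moreover obtain c p j b' q where eq: "eM a = (c, p)" "eM b = ((j, b'), q)" by (metis surj_pair)
    ultimately have in_cells: "(c, p) \<in> cells pairs M" "((j, b'), q) \<in> cells pairs M"
      using bij_betwE[OF eM] by (metis lessThan_iff)+
    \<comment> \<open>The labels of the entry decide the branch of \<open>factor_emb\<close>, and
      the branch names the single pair of cells whose entry of \<open>X\<close> is copied.\<close>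
    show "(\<forall>X. F X $$ (a, b) = 0) \<or> (\<exists>d i i'. i < m \<and> i' < l \<and> (\<forall>X. F X $$ (a, b) = d * X $$ (i, i')))"
    proof -
      have wit: ?thesis if "i < m" "i' < l" "\<forall>X. F X $$ (a, b) = d * X $$ (i, i')" for i i' d
        using that by blast
      show ?thesis
      proof (cases "L j \<noteq> B j \<and> A j \<le> M c")
        case True
        show ?thesis
        proof (cases "b' \<and> p \<le> q \<and> q - p < L j")
          case b: True
          then have "(c, 0) \<in> cells pairs M" "(j, q - p) \<in> cells {..<s} L" using in_cells by (cases c; simp)+
          then show ?thesis using True b \<open>a < m\<close> \<open>b < m\<close> inv_less
            by (intro wit[of "the_inv_into {..<m} eM (c, 0)" "the_inv_into {..<l} eL (j, q - p)" 1])
              (simp_all add: F_def index_mat_def eq factor_emb_def mat_entry_def)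
        qed (use True \<open>a < m\<close> \<open>b < m\<close> in \<open>auto simp: F_def index_mat_def eq factor_emb_def\<close>)
      next
        case False
        show ?thesis
        proof (cases b')
          case b: False
          then have "(j, q + shift j) \<in> cells {..<s} L" using in_cells L_eq[of j] by simp
          then show ?thesis using False b \<open>a < m\<close> \<open>b < m\<close> inv_less in_cells
            by (intro wit[of "the_inv_into {..<m} eM (c, p)" "the_inv_into {..<l} eL (j, q + shift j)" 1])
              (auto simp: F_def index_mat_def eq factor_emb_def mat_entry_def)
        qed (use False \<open>a < m\<close> \<open>b < m\<close> in \<open>auto simp: F_def index_mat_def eq factor_emb_def\<close>)
      qed
    qed
  qed (simp add: F_def)
  moreover have "regular_map k m m m G"
  proof (rule regular_map_select)
    fix a b assume "a < m" "b < m"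
    moreover obtain c q j b' p where eq: "eM a = ((j, b'), p)" "eM b = (c, q)" by (metis surj_pair)
    ultimately have in_cells: "((j, b'), p) \<in> cells pairs M" "(c, q) \<in> cells pairs M"
      using bij_betwE[OF eM] by (metis lessThan_iff)+
    show "(\<forall>Y. G Y $$ (a, b) = 0) \<or> (\<exists>d i i'. i < k \<and> i' < m \<and> (\<forall>Y. G Y $$ (a, b) = d * Y $$ (i, i')))"
    proof -
      have wit: ?thesis if "i < k" "i' < m" "\<forall>X. G X $$ (a, b) = d * X $$ (i, i')" for i i' d
        using that by blast
      show ?thesis
      proof (cases "L j = B j \<or> A j \<le> M c")
        case True
        consider "b'" "shift j \<le> p" | "b'" "\<not> shift j \<le> p" "0 < K j \<and> q + (shift j - p) < M c"
          | "\<not> b' \<or> \<not> shift j \<le> p \<and> \<not> (0 < K j \<and> q + (shift j - p) < M c)" by blast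
        then show ?thesis
        proof cases
          case 1
          then have "(j, p - shift j) \<in> cells {..<s} K" using in_cells A_eq[of j] by auto
          then show ?thesis using True 1 \<open>a < m\<close> \<open>b < m\<close> inv_less in_cells
            by (intro wit[of "the_inv_into {..<k} eK (j, p - shift j)" "the_inv_into {..<m} eM (c, q)" 1])
              (simp_all add: G_def index_mat_def eq factor_proj_def mat_entry_def)
        next
          case 2
          then have "(j, 0) \<in> cells {..<s} K" "(c, q + (shift j - p)) \<in> cells pairs M"
            using in_cells by (cases c; simp)+
          then show ?thesis using True 2 \<open>a < m\<close> \<open>b < m\<close> inv_less in_cells
            by (intro wit[of "the_inv_into {..<k} eK (j, 0)" "the_inv_into {..<m} eM (c, q + (shift j - p))" 1])
              (simp_all add: G_def index_mat_def eq factor_proj_def mat_entry_def)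
        qed (use True \<open>a < m\<close> \<open>b < m\<close> in \<open>auto simp: G_def index_mat_def eq factor_proj_def\<close>)
      next
        case False
        show ?thesis
        proof (cases b')
          case b: False
          then have "(j, p) \<in> cells {..<s} K" using in_cells B_le_K[of j] by simp
          then show ?thesis using False b \<open>a < m\<close> \<open>b < m\<close> inv_less in_cells
            by (intro wit[of "the_inv_into {..<k} eK (j, p)" "the_inv_into {..<m} eM (c, q)" "-1"])
              (auto simp: G_def index_mat_def eq factor_proj_def mat_entry_def)
        qed (use False \<open>a < m\<close> \<open>b < m\<close> in \<open>auto simp: G_def index_mat_def eq factor_proj_def\<close>)
      qed
    qed
  qed (simp add: G_def)
  moreover have "jordan_mat eM m * F X = F X * jordan_mat eM m \<and> F X * ?\<phi> = X"
    if X: "X \<in> carrier_mat m l" "jordan_mat eM m * X = X * jordan_mat eL l" for X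
  proof -
    note X_eq = index_mat_mat_entry[OF eM eL X(1)]
    have hom: "\<And>c j. c \<in> pairs \<Longrightarrow> j < s \<Longrightarrow>
        block_hom (M c) (L j) (\<lambda>p q. mat_entry eM m eL l X (c, p) (j, q))"
      using X(2) index_mat_intertwines_iff[OF eM eL, of "mat_entry eM m eL l X"] unfolding X_eq by simp
    have "F X * ?\<phi> = X"
      unfolding F_def index_mat_mult[OF eM]
      by (subst (2) X_eq[symmetric]) (intro index_mat_cong[OF eM eL] factor_emb hom)
    moreover have "jordan_mat eM m * F X = F X * jordan_mat eM m"
      unfolding F_def by (subst index_mat_intertwines_iff[OF eM eM]) (auto intro: block_hom_factor_emb hom)
    ultimately show ?thesis by simp
  qed
  moreover have "jordan_mat eM m * G Y = G Y * jordan_mat eM m \<and> ?\<psi> * G Y = Y"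
    if Y: "Y \<in> carrier_mat k m" "jordan_mat eK k * Y = Y * jordan_mat eM m" for Y
  proof -
    note Y_eq = index_mat_mat_entry[OF eK eM Y(1)]
    have hom: "\<And>c j. c \<in> pairs \<Longrightarrow> j < s \<Longrightarrow>
        block_hom (K j) (M c) (\<lambda>p q. mat_entry eK k eM m Y (j, p) (c, q))"
      using Y(2) index_mat_intertwines_iff[OF eK eM, of "mat_entry eK k eM m Y"] unfolding Y_eq by simp
    have "?\<psi> * G Y = Y"
      unfolding G_def index_mat_mult[OF eM]
      by (subst (2) Y_eq[symmetric]) (intro index_mat_cong[OF eK eM] factor_proj hom)
    moreover have "jordan_mat eM m * G Y = G Y * jordan_mat eM m"
      unfolding G_def by (subst index_mat_intertwines_iff[OF eM eM]) (auto intro: block_hom_factor_proj hom)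
    ultimately show ?thesis by simp
  qed
  moreover have "jordan_mat eM m * ?\<phi> = ?\<phi> * jordan_mat eL l" "jordan_mat eK k * ?\<psi> = ?\<psi> * jordan_mat eM m"
    by (subst index_mat_intertwines_iff[OF eM eL] index_mat_intertwines_iff[OF eK eM];
        auto intro: block_hom_emb block_hom_proj)+
  moreover have "?\<psi> * ?\<phi> = 0\<^sub>m k l"
    unfolding index_mat_mult[OF eM] index_mat_zero[of eK eL, symmetric] by (intro index_mat_cong[OF eK eL] proj_emb)
  moreover have "?\<psi> * ?\<sigma> = 1\<^sub>m k"
    unfolding index_mat_mult[OF eM] index_mat_one[OF eK, symmetric] by (intro index_mat_cong[OF eK eK] proj_proj_section)
  moreover have "?\<phi> * ?r + ?\<sigma> * ?\<psi> = 1\<^sub>m m"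
    unfolding index_mat_mult[OF eL] index_mat_mult[OF eK] index_mat_add index_mat_one[OF eM, symmetric]
    by (intro index_mat_cong[OF eM eM] emb_proj_split)
  ultimately have "factoring_sequence l m k (jordan_mat eL l) (jordan_mat eM m) (jordan_mat eK k) ?\<phi> ?\<psi> ?r ?\<sigma> F G"
    unfolding factoring_sequence_def by simp
  then show ?thesis by blast
qed

theorem factoring_sequence_exists:
  fixes NL NM NK :: "'k::field mat"
  assumes "jordan_cells NL l {..<s} L" "jordan_cells NM m pairs M" "jordan_cells NK k {..<s} K"
    and c: "NL \<in> carrier_mat l l" "NM \<in> carrier_mat m m" "NK \<in> carrier_mat k k"
  shows "\<exists>\<phi> \<psi> r \<sigma> F G. factoring_sequence l m k NL NM NK \<phi> \<psi> r \<sigma> F G"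
proof -
  obtain eL eM eK where "bij_betw eL {..<l} (cells {..<s} L)" "bij_betw eM {..<m} (cells pairs M)"
      "bij_betw eK {..<k} (cells {..<s} K)"
    and sim: "similar_mat NL (jordan_mat eL l)" "similar_mat NM (jordan_mat eM m)" "similar_mat NK (jordan_mat eK k)"
    using assms(1-3) unfolding jordan_cells_def by blast
  from jordan_factoring_sequence[OF this(1-3), where 'k = 'k] obtain \<phi> \<psi> r \<sigma> F G where
    "factoring_sequence l m k (jordan_mat eL l :: 'k mat) (jordan_mat eM m) (jordan_mat eK k) \<phi> \<psi> r \<sigma> F G" by blast
  from factoring_sequence_similar[OF this c(1) sim(1) c(2) sim(2) c(3) sim(3)] show ?thesis .
qed

end

section \<open>Cokernels and stacked matrices\<close>

text \<open>If \<open>n < m\<close>, padding both matrices with zeros to size \<open>m\<close> keeps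
  the product equal to 1. For square matrices the other product is then 1 as well, although the
  padded \<open>A\<close> has a zero row.\<close>

lemma inverse_matrices_same_size:
  fixes A B :: "'k::field mat"
  assumes A: "A \<in> carrier_mat n m" and B: "B \<in> carrier_mat m n"
    and AB: "A * B = 1\<^sub>m n" and BA: "B * A = 1\<^sub>m m"
  shows "n = m"
proof -
  have False if A: "A \<in> carrier_mat n m" and B: "B \<in> carrier_mat m n" and BA: "B * A = 1\<^sub>m m" and "n < m"
    for n m and A B :: "'k mat"
  proof -
    define A' where "A' = mat m m (\<lambda>(i, j). if i < n then A $$ (i, j) else 0)"
    define B' where "B' = mat m m (\<lambda>(i, j). if j < n then B $$ (i, j) else 0)"
    have "B' * A' = B * A"
    proof (rule eq_matI)
      fix i j assume "i < dim_row (B * A)" "j < dim_col (B * A)"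
      then have ij: "i < m" "j < m" using A B by auto
      have "(B' * A') $$ (i, j) = (\<Sum>k<m. if k < n then B $$ (i, k) * A $$ (k, j) else 0)"
        using ij by (auto simp: A'_def B'_def scalar_prod_def atLeast0LessThan intro!: sum.cong)
      also have "\<dots> = (\<Sum>k<n. B $$ (i, k) * A $$ (k, j))"
        using \<open>n < m\<close> by (intro sum.mono_neutral_cong_right) auto
      finally show "(B' * A') $$ (i, j) = (B * A) $$ (i, j)"
        using ij A B by (simp add: scalar_prod_def atLeast0LessThan)
    qed (use A B in \<open>auto simp: A'_def B'_def\<close>)
    then have "A' * B' = 1\<^sub>m m"
      using mat_mult_left_right_inverse[of B' m A'] BA by (simp add: A'_def B'_def)
    moreover have "(A' * B') $$ (n, n) = 0"
      using \<open>n < m\<close> by (simp add: A'_def B'_def scalar_prod_def)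
    ultimately show False using \<open>n < m\<close> by simp
  qed
  from this[OF A B BA] this[OF B A AB] show ?thesis by (meson linorder_neqE_nat)
qed

lemma matrix_preimage:
  fixes A :: "'k::field mat"
  assumes A: "A \<in> carrier_mat n m" and B: "B \<in> carrier_mat n l"
    and ex: "\<And>j. j < l \<Longrightarrow> \<exists>x\<in>carrier_vec m. A *\<^sub>v x = col B j"
  shows "\<exists>X\<in>carrier_mat m l. A * X = B"
proof -
  obtain x where x: "\<And>j. j < l \<Longrightarrow> x j \<in> carrier_vec m \<and> A *\<^sub>v x j = col B j" using ex by metis
  define X where "X = mat_of_cols m (map x [0..<l])"
  have X: "X \<in> carrier_mat m l" using mat_of_cols_carrier(1)[of m "map x [0..<l]"] by (simp add: X_def)
  have "A * X = B"
  proof (rule mat_col_eqI)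
    fix j assume "j < dim_col B"
    then have j: "j < l" using B by simp
    then have "col X j = x j" using x[OF j] by (simp add: X_def)
    then show "col (A * X) j = col B j" using x[OF j] X j by (simp add: col_mult2[OF A X])
  qed (use A B X in auto)
  with X show ?thesis by blast
qed

text \<open>States by matrix equations that \<open>\<psi>\<close> is a cokernel of
  \<open>\<phi>\<close>. There is no equation for \<open>r * \<phi>\<close>: the map out of the
  source vertex need not be injective.\<close>

definition split_exact :: "nat \<Rightarrow> nat \<Rightarrow> nat \<Rightarrow> 'k::field mat \<Rightarrow> 'k mat \<Rightarrow> 'k mat \<Rightarrow> 'k mat \<Rightarrow> bool" where
  "split_exact l m k \<phi> \<psi> r \<sigma> \<longleftrightarrow> \<phi> \<in> carrier_mat m l \<and> \<psi> \<in> carrier_mat k m \<and>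
     r \<in> carrier_mat l m \<and> \<sigma> \<in> carrier_mat m k \<and>
     \<psi> * \<phi> = 0\<^sub>m k l \<and> \<psi> * \<sigma> = 1\<^sub>m k \<and> \<phi> * r + \<sigma> * \<psi> = 1\<^sub>m m"

lemma split_exactD:
  assumes "split_exact l m k \<phi> \<psi> r \<sigma>"
  shows "\<phi> \<in> carrier_mat m l" "\<psi> \<in> carrier_mat k m" "r \<in> carrier_mat l m" "\<sigma> \<in> carrier_mat m k"
    "\<psi> * \<phi> = 0\<^sub>m k l" "\<psi> * \<sigma> = 1\<^sub>m k" "\<phi> * r + \<sigma> * \<psi> = 1\<^sub>m m"
  using assms unfolding split_exact_def by blast+

text \<open>Preimages of the unit vectors form \<open>\<sigma>\<close>. The columns of
  \<open>1 - \<sigma> * \<psi>\<close> lie in the kernel of \<open>\<psi>\<close>, hence in the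
  image of \<open>\<phi>\<close>, and their preimages form \<open>r\<close>.\<close>

lemma split_exact_exists:
  fixes \<phi> \<psi> :: "'k::field mat"
  assumes \<phi>: "\<phi> \<in> carrier_mat m l" and \<psi>: "\<psi> \<in> carrier_mat k m"
    and surj: "\<And>w. w \<in> carrier_vec k \<Longrightarrow> \<exists>x\<in>carrier_vec m. \<psi> *\<^sub>v x = w"
    and ker: "\<And>x. x \<in> carrier_vec m \<Longrightarrow> \<psi> *\<^sub>v x = 0\<^sub>v k \<longleftrightarrow> (\<exists>v\<in>carrier_vec l. x = \<phi> *\<^sub>v v)"
  shows "\<exists>r \<sigma>. split_exact l m k \<phi> \<psi> r \<sigma>"
proof -
  obtain \<sigma> where \<sigma>: "\<sigma> \<in> carrier_mat m k" "\<psi> * \<sigma> = 1\<^sub>m k"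
    using matrix_preimage[OF \<psi> one_carrier_mat] surj[of "col (1\<^sub>m k) _"] by (metis col_carrier_vec one_carrier_mat)
  have zero: "\<psi> * \<phi> = 0\<^sub>m k l"
  proof (rule mat_col_eqI)
    fix j assume "j < dim_col (0\<^sub>m k l :: 'k mat)"
    then have j: "j < l" by simp
    have "col \<phi> j = \<phi> *\<^sub>v unit_vec l j" using col_mult2[OF \<phi> one_carrier_mat j] \<phi> j by simp
    then have "\<psi> *\<^sub>v col \<phi> j = 0\<^sub>v k" using ker[of "col \<phi> j"] \<phi> by auto
    then show "col (\<psi> * \<phi>) j = col (0\<^sub>m k l) j" using j by (simp add: col_mult2[OF \<psi> \<phi>])
  qed (use \<phi> \<psi> in auto)
  define R where "R = 1\<^sub>m m - \<sigma> * \<psi>"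
  have \<sigma>\<psi>: "\<sigma> * \<psi> \<in> carrier_mat m m" using \<sigma>(1) \<psi> by simp
  have R: "R \<in> carrier_mat m m" unfolding R_def using \<sigma>\<psi> by (rule minus_carrier_mat)
  have "\<psi> * R = \<psi> * 1\<^sub>m m - \<psi> * (\<sigma> * \<psi>)"
    unfolding R_def by (rule mult_minus_distrib_mat[OF \<psi> one_carrier_mat \<sigma>\<psi>])
  also have "\<psi> * (\<sigma> * \<psi>) = \<psi> * \<sigma> * \<psi>" using assoc_mult_mat[OF \<psi> \<sigma>(1) \<psi>] by simp
  finally have \<psi>R: "\<psi> * R = 0\<^sub>m k m" using \<psi> \<sigma>(2) by simp
  have "\<exists>r\<in>carrier_mat l m. \<phi> * r = R"
  proof (rule matrix_preimage[OF \<phi> R])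
    fix j assume j: "j < m"
    have "\<psi> *\<^sub>v col R j = 0\<^sub>v k" using col_mult2[OF \<psi> R j] \<psi>R j by simp
    then show "\<exists>v\<in>carrier_vec l. \<phi> *\<^sub>v v = col R j"
      using ker[of "col R j"] R j by (metis carrier_matD(1) col_dim)
  qed
  then obtain r where r: "r \<in> carrier_mat l m" "\<phi> * r = R" by blast
  have "\<phi> * r + \<sigma> * \<psi> = 1\<^sub>m m"
    unfolding r(2) R_def using \<sigma>(1) \<psi> by (intro eq_matI) auto
  with \<phi> \<psi> \<sigma> r(1) zero show ?thesis unfolding split_exact_def by blast
qed

lemma mult_eq_zero_cancel:
  assumes "A \<in> carrier_mat a b" "B \<in> carrier_mat b c" "C \<in> carrier_mat c d" "A * B = (0\<^sub>m a c :: 'k::field mat)"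
  shows "A * (B * C) = 0\<^sub>m a d"
  using assoc_mult_mat[OF assms(1-3)] assms by simp

text \<open>By the square, \<open>\<psi>' * T\<close> kills the image of \<open>\<phi>\<close>, so
  it equals \<open>\<psi>' * T * \<sigma> * \<psi>\<close>, which leads to
  \<open>\<chi> = \<psi>' * T * \<sigma>\<close>. The same formula with the roles exchanged gives
  the inverse.\<close>

lemma split_exact_cokernel_unique:
  fixes \<phi> :: "'k::field mat"
  assumes ex: "split_exact l m k \<phi> \<psi> r \<sigma>" and ex': "split_exact l m k' \<phi>' \<psi>' r' \<sigma>'"
    and T: "T \<in> carrier_mat m m" "T' \<in> carrier_mat m m" "T * T' = 1\<^sub>m m" "T' * T = 1\<^sub>m m"
    and A: "A \<in> carrier_mat l l" "A' \<in> carrier_mat l l" "A * A' = 1\<^sub>m l"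
    and sq: "T * \<phi> = \<phi>' * A"
  shows "\<exists>\<chi>\<in>carrier_mat k' k. invertible_mat \<chi> \<and> \<chi> * \<psi> = \<psi>' * T"
proof -
  note e = split_exactD[OF ex] and e' = split_exactD[OF ex']
  \<comment> \<open>Stated for fresh matrices because it is applied in both directions.\<close>
  have half: "\<psi>' * T * \<sigma> * \<psi> = \<psi>' * T"
    if e: "split_exact l m k \<phi> \<psi> r \<sigma>" and e': "split_exact l m k' \<phi>' \<psi>' r' \<sigma>'"
      and T: "T \<in> carrier_mat m m" and A: "A \<in> carrier_mat l l" and sq: "T * \<phi> = \<phi>' * A"
    for k k' \<phi> \<psi> r \<sigma> \<phi>' \<psi>' r' \<sigma>' and T A :: "'k mat"
  proof -
    note e = split_exactD[OF e] and e' = split_exactD[OF e']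
    have "T * \<phi> * r = \<phi>' * (A * r)" using assoc_mult_mat[OF e'(1) A e(3)] sq by simp
    then have "\<psi>' * (T * (\<phi> * r)) = 0\<^sub>m k' m"
      using assoc_mult_mat[OF T e(1,3)] mult_eq_zero_cancel[OF e'(2,1) _ e'(5), of "A * r" m] A e(3) by simp
    moreover have "\<psi>' * T * (\<phi> * r) = \<psi>' * (T * (\<phi> * r))"
      using assoc_mult_mat[OF e'(2) T, of "\<phi> * r" m] e by simp
    moreover have "\<psi>' * T * (\<phi> * r + \<sigma> * \<psi>) = \<psi>' * T * (\<phi> * r) + \<psi>' * T * (\<sigma> * \<psi>)"
      using e e' T by (intro mult_add_distrib_mat[of _ k' m _ m]) auto
    moreover have "\<psi>' * T * \<sigma> * \<psi> = \<psi>' * T * (\<sigma> * \<psi>)"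
      using e e' T by (intro assoc_mult_mat[of _ k' m _ k _ m]) auto
    moreover have "\<psi>' * T * (\<sigma> * \<psi>) \<in> carrier_mat k' m" "\<psi>' * T \<in> carrier_mat k' m"
      using e e' T by (meson mult_carrier_mat)+
    moreover from this(2) have "\<psi>' * T * 1\<^sub>m m = \<psi>' * T" by (rule right_mult_one_mat)
    ultimately show ?thesis using e(7) by simp
  qed
  have "T' * \<phi>' = \<phi> * A'"
  proof -
    have "T' * \<phi>' = T' * (\<phi>' * (A * A'))" using e'(1) A by simp
    also have "\<phi>' * (A * A') = T * \<phi> * A'" using assoc_mult_mat[OF e'(1) A(1,2)] sq by simp
    also have "\<dots> = T * (\<phi> * A')" using assoc_mult_mat[OF T(1) e(1) A(2)] .
    also have "T' * (T * (\<phi> * A')) = T' * T * (\<phi> * A')"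
      using e(1) A(2) by (intro assoc_mult_mat[symmetric, OF T(2,1), of _ l]) auto
    also have "\<dots> = \<phi> * A'" unfolding T(4) using e(1) A(2) by (intro left_mult_one_mat) auto
    finally show ?thesis .
  qed
  note h = half[OF ex ex' T(1) A(1) sq] and h' = half[OF ex' ex T(2) A(2) this]
  have mult_id: "\<psi>' * T * \<sigma> * (\<psi> * T' * \<sigma>') = 1\<^sub>m k'"
    if e: "split_exact l m k \<phi> \<psi> r \<sigma>" and e': "split_exact l m k' \<phi>' \<psi>' r' \<sigma>'"
      and T: "T \<in> carrier_mat m m" "T' \<in> carrier_mat m m" "T * T' = 1\<^sub>m m"
      and h: "\<psi>' * T * \<sigma> * \<psi> = \<psi>' * T"
    for k k' \<phi> \<psi> r \<sigma> \<phi>' \<psi>' r' \<sigma>' and T T' :: "'k mat"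
  proof -
    note e = split_exactD[OF e] and e' = split_exactD[OF e']
    have c: "\<psi>' * T * \<sigma> \<in> carrier_mat k' k" using e e' T by (meson mult_carrier_mat)
    have "\<psi>' * T * \<sigma> * (\<psi> * T' * \<sigma>') = \<psi>' * T * \<sigma> * (\<psi> * (T' * \<sigma>'))"
      using assoc_mult_mat[OF e(2) T(2) e'(4)] by simp
    also have "\<dots> = \<psi>' * T * \<sigma> * \<psi> * (T' * \<sigma>')"
      using e'(4) T by (intro assoc_mult_mat[symmetric, OF c e(2), of _ k']) auto
    also have "\<dots> = \<psi>' * T * (T' * \<sigma>')" by (simp only: h)
    also have "\<dots> = \<psi>' * T * T' * \<sigma>'"
      using e' T by (intro assoc_mult_mat[symmetric, of _ k' m _ m _ k']) auto
    also have "\<psi>' * T * T' = \<psi>'" using assoc_mult_mat[OF e'(2) T(1,2)] T(3) e'(2) by simp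
    finally show ?thesis using e'(6) by simp
  qed
  define \<chi> where "\<chi> = \<psi>' * T * \<sigma>"
  define \<chi>' where "\<chi>' = \<psi> * T' * \<sigma>'"
  have c: "\<chi> \<in> carrier_mat k' k" "\<chi>' \<in> carrier_mat k k'"
    unfolding \<chi>_def \<chi>'_def using e e' T by (meson mult_carrier_mat)+
  have inv: "\<chi> * \<chi>' = 1\<^sub>m k'" "\<chi>' * \<chi> = 1\<^sub>m k"
    unfolding \<chi>_def \<chi>'_def using mult_id[OF ex ex' T(1-3) h] mult_id[OF ex' ex T(2,1,4) h'] by auto
  \<comment> \<open>The sizes are not assumed equal; the two inverse identities force it, and
    \<open>invertible_mat\<close> asks for a square matrix.\<close>
  have "k' = k" by (rule inverse_matrices_same_size[OF c inv])
  then have "invertible_mat \<chi>"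
    using c inv unfolding invertible_mat_def inverts_mat_def square_mat.simps by (metis carrier_matD)
  with c(1) h show ?thesis unfolding \<chi>_def by blast
qed

text \<open>Coordinates on the direct sum of spaces of dimension \<open>n a\<close> for
  \<open>a\<close> in \<open>S\<close>. As \<open>S\<close> carries no order, the numbering
  \<open>e\<close> is a parameter. A family of maps into the summands becomes one column
  (\<open>stack\<close>), a family out of them one row (\<open>side\<close>), and a family of
  endomorphisms a block diagonal matrix.\<close>

locale stacked =
  fixes S :: "'i set" and n :: "'i \<Rightarrow> nat" and e :: "nat \<Rightarrow> 'i \<times> nat" and m :: nat
  assumes finite_S: "finite S" and e: "bij_betw e {..<m} (cells S n)"
begin

definition stack :: "nat \<Rightarrow> ('i \<Rightarrow> 'k::field mat) \<Rightarrow> 'k mat" where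
  "stack l f = index_mat e id m l (\<lambda>x j. f (fst x) $$ (snd x, j))"

definition side :: "nat \<Rightarrow> ('i \<Rightarrow> 'k::field mat) \<Rightarrow> 'k mat" where
  "side w h = index_mat id e w m (\<lambda>i x. h (fst x) $$ (i, snd x))"

definition diagonal :: "('i \<Rightarrow> 'k::field mat) \<Rightarrow> 'k mat" where
  "diagonal T = index_mat e e m m (\<lambda>x y. if fst x = fst y then T (fst x) $$ (snd x, snd y) else 0)"

definition unstack :: "nat \<Rightarrow> 'k::field mat \<Rightarrow> 'i \<Rightarrow> 'k mat" where
  "unstack l \<Phi> a = mat (n a) l (\<lambda>(i, j). \<Phi> $$ (the_inv_into {..<m} e (a, i), j))"

definition unside :: "nat \<Rightarrow> 'k::field mat \<Rightarrow> 'i \<Rightarrow> 'k mat" where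
  "unside w \<Psi> a = mat w (n a) (\<lambda>(i, j). \<Psi> $$ (i, the_inv_into {..<m} e (a, j)))"

lemma carriers[simp]:
  "stack l f \<in> carrier_mat m l" "side w h \<in> carrier_mat w m" "diagonal T \<in> carrier_mat m m"
  "unstack l \<Phi> a \<in> carrier_mat (n a) l" "unside w \<Psi> a \<in> carrier_mat w (n a)"
  by (simp_all add: stack_def side_def diagonal_def unstack_def unside_def)

lemma bij_id: "bij_betw id {..<l :: nat} {..<l}" by simp

lemma sum_cells: "(\<Sum>x\<in>cells S n. G x) = (\<Sum>a\<in>S. \<Sum>i<n a. G (a, i))"
  unfolding cells_def by (subst sum.Sigma[OF finite_S]) (auto simp: case_prod_unfold)

lemma sum_cells_delta:
  assumes "a \<in> S"
  shows "(\<Sum>x\<in>cells S n. if fst x = a then G x else 0) = (\<Sum>i<n a. G (a, i) :: 'k::field)"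
proof -
  have "(\<Sum>x\<in>cells S n. if fst x = a then G x else 0) = (\<Sum>b\<in>S. if b = a then \<Sum>i<n b. G (b, i) else 0)"
    unfolding sum_cells by (intro sum.cong) auto
  with assms finite_S show ?thesis by simp
qed

lemma mult_entry:
  assumes "A \<in> carrier_mat n1 n2" "B \<in> carrier_mat n2 n3" "i < n1" "j < n3"
  shows "(A * B) $$ (i, j) = (\<Sum>l<n2. A $$ (i, l) * B $$ (l, j) :: 'k::field)"
  using assms by (simp add: scalar_prod_def atLeast0LessThan)

lemma diagonal_stack:
  assumes "\<And>a. a \<in> S \<Longrightarrow> T a \<in> carrier_mat (n a) (n a)" "\<And>a. a \<in> S \<Longrightarrow> f a \<in> carrier_mat (n a) l"
  shows "diagonal T * stack l f = stack l (\<lambda>a. T a * f a)"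
  unfolding diagonal_def stack_def index_mat_mult[OF e]
proof (intro index_mat_cong[OF e bij_id])
  fix x j assume x: "x \<in> cells S n" and j: "j \<in> {..<l}"
  obtain a i where ai: "x = (a, i)" "a \<in> S" "i < n a" using x by (cases x) auto
  have "(\<Sum>y\<in>cells S n. (if fst x = fst y then T (fst x) $$ (snd x, snd y) else 0) * f (fst y) $$ (snd y, j))
    = (\<Sum>y\<in>cells S n. if fst y = a then T a $$ (i, snd y) * f a $$ (snd y, j) else 0)"
    by (rule sum.cong) (auto simp: ai)
  then show "(\<Sum>y\<in>cells S n. (if fst x = fst y then T (fst x) $$ (snd x, snd y) else 0) * f (fst y) $$ (snd y, j))
    = (T (fst x) * f (fst x)) $$ (snd x, j)"
    using mult_entry[OF assms(1,2)[OF ai(2)] ai(3), of j] j by (simp add: sum_cells_delta[OF ai(2)] ai(1))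
qed

lemma side_diagonal:
  assumes "\<And>a. a \<in> S \<Longrightarrow> T a \<in> carrier_mat (n a) (n a)" "\<And>a. a \<in> S \<Longrightarrow> h a \<in> carrier_mat w (n a)"
  shows "side w h * diagonal T = side w (\<lambda>a. h a * T a)"
  unfolding diagonal_def side_def index_mat_mult[OF e]
proof (intro index_mat_cong[OF bij_id e])
  fix x j assume x: "x \<in> cells S n" and j: "j \<in> {..<w}"
  obtain a i where ai: "x = (a, i)" "a \<in> S" "i < n a" using x by (cases x) auto
  have "(\<Sum>y\<in>cells S n. h (fst y) $$ (j, snd y) * (if fst y = fst x then T (fst y) $$ (snd y, snd x) else 0))
    = (\<Sum>y\<in>cells S n. if fst y = a then h a $$ (j, snd y) * T a $$ (snd y, i) else 0)"
    by (rule sum.cong) (auto simp: ai)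
  then show "(\<Sum>y\<in>cells S n. h (fst y) $$ (j, snd y) * (if fst y = fst x then T (fst y) $$ (snd y, snd x) else 0))
    = (h (fst x) * T (fst x)) $$ (j, snd x)"
    using mult_entry[OF assms(2,1)[OF ai(2)] _ ai(3), of j] j by (simp add: sum_cells_delta[OF ai(2)] ai(1))
qed

lemma diagonal_mult:
  assumes "\<And>a. a \<in> S \<Longrightarrow> T a \<in> carrier_mat (n a) (n a)" "\<And>a. a \<in> S \<Longrightarrow> T' a \<in> carrier_mat (n a) (n a)"
  shows "diagonal T * diagonal T' = diagonal (\<lambda>a. T a * T' a)"
  unfolding diagonal_def index_mat_mult[OF e]
proof (intro index_mat_cong[OF e e])
  fix x z assume "x \<in> cells S n" "z \<in> cells S n"
  then obtain a i b j where xz: "x = (a, i)" "z = (b, j)" and ai: "a \<in> S" "i < n a" and bj: "b \<in> S" "j < n b"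
    by (cases x; cases z) auto
  have "(\<Sum>y\<in>cells S n. (if fst x = fst y then T (fst x) $$ (snd x, snd y) else 0) *
      (if fst y = fst z then T' (fst y) $$ (snd y, snd z) else 0))
    = (\<Sum>y\<in>cells S n. if fst y = a then (if a = b then T a $$ (i, snd y) * T' a $$ (snd y, j) else 0) else 0)"
    by (rule sum.cong) (auto simp: xz)
  also have "\<dots> = (\<Sum>l<n a. if a = b then T a $$ (i, l) * T' a $$ (l, j) else 0)"
    by (subst sum_cells_delta[OF ai(1)]) (intro sum.cong refl, simp)
  also have "\<dots> = (if a = b then (T a * T' a) $$ (i, j) else 0)"
    using mult_entry[OF assms(1,2)[OF ai(1)] ai(2), of j] bj
    by (cases "a = b") simp_all
  finally show "(\<Sum>y\<in>cells S n. (if fst x = fst y then T (fst x) $$ (snd x, snd y) else 0) *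
      (if fst y = fst z then T' (fst y) $$ (snd y, snd z) else 0))
    = (if fst x = fst z then (T (fst x) * T' (fst x)) $$ (snd x, snd z) else 0)"
    by (simp add: xz)
qed

lemma diagonal_one: "diagonal (\<lambda>a. 1\<^sub>m (n a)) = 1\<^sub>m m"
  unfolding diagonal_def index_mat_one[OF e, symmetric]
  by (intro index_mat_cong[OF e e]) (auto simp: cells_def split: if_splits)

lemma stack_cong: "(\<And>a. a \<in> S \<Longrightarrow> f a = g a) \<Longrightarrow> stack l f = stack l g"
  unfolding stack_def by (intro index_mat_cong[OF e bij_id]) (auto simp: cells_def)

lemma side_cong: "(\<And>a. a \<in> S \<Longrightarrow> f a = g a) \<Longrightarrow> side w f = side w g"
  unfolding side_def by (intro index_mat_cong[OF bij_id e]) (auto simp: cells_def)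

lemma diagonal_cong: "(\<And>a. a \<in> S \<Longrightarrow> T a = T' a) \<Longrightarrow> diagonal T = diagonal T'"
  unfolding diagonal_def by (intro index_mat_cong[OF e e]) (auto simp: cells_def)

lemma stack_eqD:
  assumes "stack l f = stack l g" "a \<in> S" "f a \<in> carrier_mat (n a) l" "g a \<in> carrier_mat (n a) l"
  shows "f a = g a"
  using assms(2-) assms(1)[unfolded stack_def index_mat_eq_iff[OF e bij_id]]
  by (intro eq_matI) (auto simp: cells_def)

lemma side_eqD:
  assumes "side w f = side w g" "a \<in> S" "f a \<in> carrier_mat w (n a)" "g a \<in> carrier_mat w (n a)"
  shows "f a = g a"
  using assms(2-) assms(1)[unfolded side_def index_mat_eq_iff[OF bij_id e]]
  by (intro eq_matI) (auto simp: cells_def)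

lemma stack_mult:
  assumes X: "X \<in> carrier_mat l l'" and f: "\<And>a. a \<in> S \<Longrightarrow> f a \<in> carrier_mat (n a) l"
  shows "stack l f * X = stack l' (\<lambda>a. f a * X)"
proof -
  have X_eq: "X = index_mat id id l l' (\<lambda>i j. X $$ (i, j))"
    using X by (intro eq_matI) (auto simp: index_mat_def)
  have "stack l f * X = stack l f * index_mat id id l l' (\<lambda>i j. X $$ (i, j))"
    by (rule arg_cong[OF X_eq])
  also have "\<dots> = index_mat e id m l' (\<lambda>x j. \<Sum>i<l. f (fst x) $$ (snd x, i) * X $$ (i, j))"
    unfolding stack_def by (rule index_mat_mult[OF bij_id])
  also have "\<dots> = stack l' (\<lambda>a. f a * X)"
    unfolding stack_def by (intro index_mat_cong[OF e bij_id]) (auto simp: cells_def mult_entry[OF f X])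
  finally show ?thesis .
qed

lemma mult_side:
  assumes X: "X \<in> carrier_mat w' w" and h: "\<And>a. a \<in> S \<Longrightarrow> h a \<in> carrier_mat w (n a)"
  shows "X * side w h = side w' (\<lambda>a. X * h a)"
proof -
  have X_eq: "X = index_mat id id w' w (\<lambda>i j. X $$ (i, j))"
    using X by (intro eq_matI) (auto simp: index_mat_def)
  have "X * side w h = index_mat id id w' w (\<lambda>i j. X $$ (i, j)) * side w h"
    by (rule arg_cong[OF X_eq])
  also have "\<dots> = index_mat id e w' m (\<lambda>i x. \<Sum>j<w. X $$ (i, j) * h (fst x) $$ (j, snd x))"
    unfolding side_def by (rule index_mat_mult[OF bij_id])
  also have "\<dots> = side w' (\<lambda>a. X * h a)"
    unfolding side_def by (intro index_mat_cong[OF bij_id e]) (auto simp: cells_def mult_entry[OF X h])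
  finally show ?thesis .
qed

lemma e_bounds: "c < m \<Longrightarrow> fst (e c) \<in> S" "c < m \<Longrightarrow> snd (e c) < n (fst (e c))"
proof -
  assume "c < m"
  then have "e c \<in> cells S n" using bij_betwE[OF e] by blast
  then show "fst (e c) \<in> S" "snd (e c) < n (fst (e c))" by (auto simp: cells_def)
qed

lemma the_inv_e: "c < m \<Longrightarrow> the_inv_into {..<m} e (fst (e c), snd (e c)) = c"
  using the_inv_into_f_f[OF bij_betw_imp_inj_on[OF e], of c] by simp

lemma stack_unstack: "\<Phi> \<in> carrier_mat m l \<Longrightarrow> stack l (unstack l \<Phi>) = \<Phi>"
  by (intro eq_matI) (auto simp: stack_def unstack_def index_mat_def e_bounds the_inv_e simp del: prod.collapse)

lemma side_unside: "\<Psi> \<in> carrier_mat w m \<Longrightarrow> side w (unside w \<Psi>) = \<Psi>"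
  by (intro eq_matI) (auto simp: side_def unside_def index_mat_def e_bounds the_inv_e simp del: prod.collapse)

lemma unstack_stack:
  assumes "a \<in> S" "f a \<in> carrier_mat (n a) l"
  shows "unstack l (stack l f) a = f a"
  using stack_unstack[of "stack l f" l] assms by (intro stack_eqD[of l _ f]) simp_all

lemma jordan_cells_diagonal:
  assumes N: "\<And>a. a \<in> S \<Longrightarrow> jordan_cells (N a) (n a) (I a) (\<mu> a)"
    and c: "\<And>a. a \<in> S \<Longrightarrow> N a \<in> carrier_mat (n a) (n a)"
  shows "jordan_cells (diagonal N) m (Sigma S I) (\<lambda>(a, i). \<mu> a i)"
proof -
  obtain h where h: "\<And>a. a \<in> S \<Longrightarrow> bij_betw (h a) {..<n a} (cells (I a) (\<mu> a))"
    and sim: "\<And>a. a \<in> S \<Longrightarrow> similar_mat (N a) (jordan_mat (h a) (n a))"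
    using N unfolding jordan_cells_def by metis
  define J where "J a = (jordan_mat (h a) (n a) :: 'a mat)" for a
  have "\<forall>a\<in>S. \<exists>P Q. similar_mat_wit (N a) (J a) P Q" using sim unfolding similar_mat_def J_def by blast
  then obtain P Q where wit: "\<And>a. a \<in> S \<Longrightarrow> similar_mat_wit (N a) (J a) (P a) (Q a)" by metis
  have w: "P a * Q a = 1\<^sub>m (n a)" "Q a * P a = 1\<^sub>m (n a)" "N a = P a * J a * Q a"
      "P a \<in> carrier_mat (n a) (n a)" "J a \<in> carrier_mat (n a) (n a)" "Q a \<in> carrier_mat (n a) (n a)"
    if "a \<in> S" for a
    using similar_mat_witD2[OF c[OF that] wit[OF that]] by blast+
  have similar: "similar_mat (diagonal N) (diagonal J)"
  proof (rule similar_matI[of _ _ "diagonal P" "diagonal Q" m])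
    show "diagonal P * diagonal Q = 1\<^sub>m m" "diagonal Q * diagonal P = 1\<^sub>m m"
      using diagonal_mult[of P Q, OF w(4,6)] diagonal_mult[of Q P, OF w(6,4)]
        diagonal_cong[OF w(1)] diagonal_cong[OF w(2)] by (simp_all only: diagonal_one)
    have "diagonal P * diagonal J * diagonal Q = diagonal (\<lambda>a. P a * J a) * diagonal Q"
      using diagonal_mult[of P J, OF w(4,5)] by (simp only:)
    also have "\<dots> = diagonal (\<lambda>a. P a * J a * Q a)"
      using diagonal_mult[of "\<lambda>a. P a * J a" Q, OF mult_carrier_mat[OF w(4,5)] w(6)] .
    also have "\<dots> = diagonal N" using w(3) by (intro diagonal_cong) simp
    finally show "diagonal N = diagonal P * diagonal J * diagonal Q" ..
  qed simp
  \<comment> \<open>Coordinate \<open>i\<close> of the summand \<open>a\<close> is a cell of some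
    Jordan block of \<open>N a\<close>; the label of that block is paired with
    \<open>a\<close>.\<close>
  define g where "g x = ((fst x, fst (h (fst x) (snd x))), snd (h (fst x) (snd x)))" for x
  have "bij_betw g (cells S n) (cells (Sigma S I) (\<lambda>(a, i). \<mu> a i))"
    unfolding bij_betw_def
  proof (intro conjI inj_onI equalityI subsetI)
    fix x y assume xy: "x \<in> cells S n" "y \<in> cells S n" and eq: "g x = g y"
    obtain a i b j where xy_eq: "x = (a, i)" "y = (b, j)" by fastforce
    from eq have "a = b" by (simp add: g_def xy_eq)
    moreover from eq this have "h a i = h a j" by (intro prod_eqI) (simp_all add: g_def xy_eq)
    ultimately show "x = y"
      using inj_onD[OF bij_betw_imp_inj_on[OF h[of a]], of i j] xy by (simp add: xy_eq)
  next
    fix y assume "y \<in> g ` cells S n"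
    then obtain a i where y: "y = g (a, i)" "a \<in> S" "i < n a" by (auto simp: cells_def)
    then have "h a i \<in> cells (I a) (\<mu> a)" using bij_betwE[OF h[of a]] by blast
    then show "y \<in> cells (Sigma S I) (\<lambda>(a, i). \<mu> a i)" using y by (auto simp: g_def cells_def)
  next
    fix y assume "y \<in> cells (Sigma S I) (\<lambda>(a, i). \<mu> a i)"
    then obtain a i p where y: "y = ((a, i), p)" "a \<in> S" "i \<in> I a" "p < \<mu> a i" by (auto simp: cells_def)
    then have "(i, p) \<in> h a ` {..<n a}" using h[of a] by (simp add: bij_betw_def)
    then obtain q where "q < n a" "h a q = (i, p)" by (metis imageE lessThan_iff)
    then have "(a, q) \<in> cells S n" "g (a, q) = y" using y by (simp_all add: g_def)
    then show "y \<in> g ` cells S n" by blast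
  qed
  then have bij: "bij_betw (g \<circ> e) {..<m} (cells (Sigma S I) (\<lambda>(a, i). \<mu> a i))"
    by (rule bij_betw_trans[OF e])
  have "diagonal J = jordan_mat (g \<circ> e) m"
  proof -
    have "diagonal J = index_mat e e m m (\<lambda>x y. jordan_entry (g x) (g y))"
      unfolding diagonal_def
    proof (intro index_mat_cong[OF e e])
      fix x y assume xy: "x \<in> cells S n" "y \<in> cells S n"
      obtain a i b j where "x = (a, i)" "y = (b, j)" by fastforce
      with xy show "(if fst x = fst y then J (fst x) $$ (snd x, snd y) else 0) = jordan_entry (g x) (g y)"
        by (cases "a = b") (simp_all add: J_def index_mat_def jordan_entry_def g_def)
    qed
    then show ?thesis by (simp add: index_mat_def)
  qed
  with similar bij show ?thesis unfolding jordan_cells_def by metis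
qed

end

section \<open>Irreducibility of the space of compatible representations\<close>

lemma commuting_inverse:
  fixes A M :: "'k::field mat"
  assumes A: "A \<in> carrier_mat m m" and M: "M \<in> carrier_mat m m" and det: "det A \<noteq> 0" and comm: "M * A = A * M"
  obtains A' where "A' \<in> carrier_mat m m" "A * A' = 1\<^sub>m m" "A' * A = 1\<^sub>m m" "M * A' = A' * M"
    "adj_mat A = det A \<cdot>\<^sub>m A'"
proof
  define A' where "A' = inverse (det A) \<cdot>\<^sub>m adj_mat A"
  note adj = adj_mat[OF A]
  show A': "A' \<in> carrier_mat m m" unfolding A'_def using adj(1) by simp
  show AA': "A * A' = 1\<^sub>m m" and A'A: "A' * A = 1\<^sub>m m"
    unfolding A'_def using adj det mult_smult_distrib[OF A adj(1)]
    by (auto simp: mult_smult_assoc_mat[OF adj(1) A] intro!: eq_matI)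
  have "A' * M = A' * (M * (A * A'))" using M by (simp add: AA')
  also have "M * (A * A') = A * M * A'" using assoc_mult_mat[OF M A A'] comm by simp
  also have "\<dots> = A * (M * A')" by (rule assoc_mult_mat[OF A M A'])
  also have "A' * (A * (M * A')) = A' * A * (M * A')"
    by (rule assoc_mult_mat[symmetric, OF A' A]) (use M A' in \<open>rule mult_carrier_mat\<close>)
  also have "\<dots> = M * A'" unfolding A'A using M A' by (intro left_mult_one_mat) (rule mult_carrier_mat)
  finally show "M * A' = A' * M" ..
  \<comment> \<open>Relates the inverse to the adjugate, the matrix that varies polynomially with
    \<open>A\<close>.\<close>
  show "adj_mat A = det A \<cdot>\<^sub>m A'" unfolding A'_def using det by (intro eq_matI) auto
qed

text \<open>An automorphism of the middle space commuting with \<open>M\<close> carries the sequence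
  to another one. This allows the base point to be changed: any \<open>A * \<phi>\<close> can take
  the place of \<open>\<phi>\<close>, and any \<open>\<psi> * A'\<close> that of
  \<open>\<psi>\<close>.\<close>

lemma factoring_sequence_twist:
  fixes M :: "'k::field mat"
  assumes seq: "factoring_sequence l m k L M K \<phi> \<psi> r \<sigma> F G"
    and LMK: "L \<in> carrier_mat l l" "M \<in> carrier_mat m m" "K \<in> carrier_mat k k"
    and A: "A \<in> carrier_mat m m" and A': "A' \<in> carrier_mat m m"
    and inv: "A * A' = 1\<^sub>m m" "A' * A = 1\<^sub>m m" and comm: "M * A = A * M" "M * A' = A' * M"
  shows "factoring_sequence l m k L M K (A * \<phi>) (\<psi> * A') (r * A') (A * \<sigma>) (\<lambda>X. F X * A') (\<lambda>Y. A * G Y)"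
proof -
  note s = factoring_sequenceD[OF seq]
  have cancel: "X * A' * (A * Y) = X * Y" if "X \<in> carrier_mat a m" "Y \<in> carrier_mat m b" for X Y a b
  proof -
    have "X * A' * (A * Y) = X * (A' * (A * Y))"
      using that A A' by (intro assoc_mult_mat) auto
    also have "A' * (A * Y) = A' * A * Y" by (rule assoc_mult_mat[symmetric, OF A' A that(2)])
    finally show ?thesis using that inv by simp
  qed
  have "M * (A * \<phi>) = A * \<phi> * L"
    using assoc_mult_mat[OF LMK(2) A s(1)] assoc_mult_mat[OF A LMK(2) s(1)] assoc_mult_mat[OF A s(1) LMK(1)]
      comm(1) s(5) by simp
  moreover have "K * (\<psi> * A') = \<psi> * A' * M"
    using assoc_mult_mat[OF LMK(3) s(2) A'] assoc_mult_mat[OF s(2) LMK(2) A'] assoc_mult_mat[OF s(2) A' LMK(2)]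
      comm(2) s(6) by simp
  moreover have "A * \<phi> * (r * A') + A * \<sigma> * (\<psi> * A') = 1\<^sub>m m"
  proof -
    have c: "\<phi> * r \<in> carrier_mat m m" "\<sigma> * \<psi> \<in> carrier_mat m m" using s(1-4) by simp_all
    have "A * \<phi> * (r * A') = A * (\<phi> * r) * A'"
      using assoc_mult_mat[OF _ s(3) A', of "A * \<phi>" m] assoc_mult_mat[OF A s(1,3)] A s(1) by simp
    moreover have "A * \<sigma> * (\<psi> * A') = A * (\<sigma> * \<psi>) * A'"
      using assoc_mult_mat[OF _ s(2) A', of "A * \<sigma>" m] assoc_mult_mat[OF A s(4,2)] A s(4) by simp
    ultimately have "A * \<phi> * (r * A') + A * \<sigma> * (\<psi> * A') = (A * (\<phi> * r) + A * (\<sigma> * \<psi>)) * A'"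
      using add_mult_distrib_mat[of "A * (\<phi> * r)" m m "A * (\<sigma> * \<psi>)" A' m] A A' c by simp
    also have "A * (\<phi> * r) + A * (\<sigma> * \<psi>) = A * (\<phi> * r + \<sigma> * \<psi>)"
      by (rule mult_add_distrib_mat[symmetric, OF A c])
    finally show ?thesis using s(9) A inv by simp
  qed
  moreover have "regular_map m l m m (\<lambda>X. F X * A')" "regular_map k m m m (\<lambda>Y. A * G Y)"
    unfolding regular_map_def
    by (intro allI impI matrix_over_mult[OF _ regular_mapD[OF s(10)]] matrix_over_mult[OF _ _ regular_mapD[OF s(11)]]
        matrix_over_const A A'; assumption)+
  moreover have "M * (F X * A') = F X * A' * M" "F X * A' * (A * \<phi>) = X"
    if X: "X \<in> carrier_mat m l" "M * X = X * L" for X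
  proof -
    note Fc = regular_map_carrier[OF s(10) X(1)] and FX = factoring_sequence_factor(1,2)[OF seq X]
    show "M * (F X * A') = F X * A' * M"
      using assoc_mult_mat[OF LMK(2) Fc A'] assoc_mult_mat[OF Fc LMK(2) A'] assoc_mult_mat[OF Fc A' LMK(2)]
        FX(1) comm(2) by simp
    show "F X * A' * (A * \<phi>) = X" using cancel[OF Fc s(1)] FX(2) by simp
  qed
  moreover have "M * (A * G Y) = A * G Y * M" "\<psi> * A' * (A * G Y) = Y"
    if Y: "Y \<in> carrier_mat k m" "K * Y = Y * M" for Y
  proof -
    note Gc = regular_map_carrier[OF s(11) Y(1)] and GY = factoring_sequence_factor(3,4)[OF seq Y]
    show "M * (A * G Y) = A * G Y * M"
      using assoc_mult_mat[OF LMK(2) A Gc] assoc_mult_mat[OF A LMK(2) Gc] assoc_mult_mat[OF A Gc LMK(2)]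
        GY(1) comm(1) by simp
    show "\<psi> * A' * (A * G Y) = Y" using cancel[OF s(2) Gc] GY(2) by simp
  qed
  moreover have "\<psi> * A' * (A * \<phi>) = 0\<^sub>m k l" "\<psi> * A' * (A * \<sigma>) = 1\<^sub>m k"
    using cancel[OF s(2,1)] cancel[OF s(2,4)] s(7,8) by simp_all
  ultimately show ?thesis unfolding factoring_sequence_def using s(1-4) A A' by auto
qed

text \<open>\<open>F \<phi>\<close> is only known to fix \<open>\<phi>\<close> and may be singular:
  in the explicit sequence it vanishes on every long block with \<open>L j = B j\<close>. The
  constant \<open>1 - F \<phi>\<close> commutes with \<open>M\<close> and kills
  \<open>\<phi>\<close>, so adding it keeps the factorization and yields the identity at
  \<open>\<phi>\<close>. Hence the determinant is not identically zero. \<open>G\<close> is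
  corrected in the same way.\<close>

lemma normalized_factor:
  fixes M :: "'k::field mat"
  assumes seq: "factoring_sequence l m k L M K \<phi> \<psi> r \<sigma> F G" and M: "M \<in> carrier_mat m m"
  shows "\<exists>F' G'. regular_map m l m m F' \<and> regular_map k m m m G' \<and> F' \<phi> = 1\<^sub>m m \<and> G' \<psi> = 1\<^sub>m m \<and>
    (\<forall>X\<in>carrier_mat m l. M * X = X * L \<longrightarrow> M * F' X = F' X * M \<and> F' X * \<phi> = X) \<and>
    (\<forall>Y\<in>carrier_mat k m. K * Y = Y * M \<longrightarrow> M * G' Y = G' Y * M \<and> \<psi> * G' Y = Y)"
proof -
  note s = factoring_sequenceD[OF seq] and fac = factoring_sequence_factor[OF seq]
  define E where "E = 1\<^sub>m m - F \<phi>"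
  define H where "H = 1\<^sub>m m - G \<psi>"
  note c = regular_map_carrier[OF s(10) s(1)] regular_map_carrier[OF s(11) s(2)]
  have EH: "E \<in> carrier_mat m m" "H \<in> carrier_mat m m"
    unfolding E_def H_def using c by (auto intro: minus_carrier_mat)
  have E: "M * E = E * M" "E * \<phi> = 0\<^sub>m m l"
    using fac(1,2)[OF s(1,5)] mult_minus_distrib_mat[OF M one_carrier_mat c(1)]
      minus_mult_distrib_mat[OF one_carrier_mat c(1) M] minus_mult_distrib_mat[OF one_carrier_mat c(1) s(1)] M s(1)
    by (simp_all add: E_def)
  have H: "M * H = H * M" "\<psi> * H = 0\<^sub>m k m"
    using fac(3,4)[OF s(2,6)] mult_minus_distrib_mat[OF M one_carrier_mat c(2)]
      minus_mult_distrib_mat[OF one_carrier_mat c(2) M] mult_minus_distrib_mat[OF s(2) one_carrier_mat c(2)] M s(2)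
    by (simp_all add: H_def)
  have "M * (E + F X) = (E + F X) * M" "(E + F X) * \<phi> = X"
    if X: "X \<in> carrier_mat m l" "M * X = X * L" for X
    using fac(1,2)[OF X] E X s(1) mult_add_distrib_mat[OF M EH(1) regular_map_carrier[OF s(10) X(1)]]
      add_mult_distrib_mat[OF EH(1) regular_map_carrier[OF s(10) X(1)]] M by auto
  moreover have "M * (H + G Y) = (H + G Y) * M" "\<psi> * (H + G Y) = Y"
    if Y: "Y \<in> carrier_mat k m" "K * Y = Y * M" for Y
    using fac(3,4)[OF Y] H Y s(2) mult_add_distrib_mat[OF _ EH(2) regular_map_carrier[OF s(11) Y(1)]]
      add_mult_distrib_mat[OF EH(2) regular_map_carrier[OF s(11) Y(1)]] M by auto
  moreover have "regular_map m l m m (\<lambda>X. E + F X)" "regular_map k m m m (\<lambda>Y. H + G Y)"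
    unfolding regular_map_def
    by (intro allI impI matrix_over_add[OF _ _ regular_mapD[OF s(10)]] matrix_over_add[OF _ _ regular_mapD[OF s(11)]]
        matrix_over_const EH; assumption)+
  moreover have "E + F \<phi> = 1\<^sub>m m" "H + G \<psi> = 1\<^sub>m m"
    unfolding E_def H_def using c by (auto intro!: eq_matI)
  ultimately show ?thesis
    by (intro exI[of _ "\<lambda>X. E + F X"] exI[of _ "\<lambda>Y. H + G Y"]) simp
qed

section \<open>Polynomial functions along lines\<close>

lemma infinite_if_alg_closed:
  assumes "\<forall>p :: 'k::field poly. degree p > 0 \<longrightarrow> (\<exists>x. poly p x = 0)"
  shows "infinite (UNIV :: 'k set)"
proof
  assume fin: "finite (UNIV :: 'k set)"
  define p :: "'k poly" where "p = (\<Prod>a\<in>UNIV. [:- a, 1:]) + 1"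
  have "degree (\<Prod>a\<in>UNIV. [:- a, 1:] :: 'k poly) = card (UNIV :: 'k set)"
    by (subst degree_prod_eq_sum_degree) auto
  moreover have "card (UNIV :: 'k set) > 0" using fin by (simp add: card_gt_0_iff)
  ultimately have "degree p > 0" unfolding p_def by (subst degree_add_eq_left) auto
  moreover have "poly p x = 1" for x
    using fin by (simp add: p_def poly_prod prod_zero_iff)
  ultimately show False using assms by (metis zero_neq_one)
qed

lemma poly_funs_along_line:
  fixes x y :: "nat \<Rightarrow> 'k::field mat"
  assumes p: "p \<in> poly_funs Q d" and x: "is_rep Q d x" and y: "is_rep Q d y"
  shows "\<exists>P. \<forall>t. p (\<lambda>a. (1 - t) \<cdot>\<^sub>m x a + t \<cdot>\<^sub>m y a) = poly P t"
  using p
proof induction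
  case (pf_const c)
  then show ?case by (intro exI[of _ "[:c:]"]) simp
next
  case (pf_coord a i j)
  then have "x a \<in> carrier_mat (d (tgt Q a)) (d (src Q a))" "y a \<in> carrier_mat (d (tgt Q a)) (d (src Q a))"
    using x y by (auto simp: is_rep_def)
  then show ?case using pf_coord
    by (intro exI[of _ "[:x a $$ (i, j), y a $$ (i, j) - x a $$ (i, j):]"]) (simp add: algebra_simps)
next
  case (pf_add p q)
  then obtain P P' where "\<forall>t. p (\<lambda>a. (1 - t) \<cdot>\<^sub>m x a + t \<cdot>\<^sub>m y a) = poly P t"
    "\<forall>t. q (\<lambda>a. (1 - t) \<cdot>\<^sub>m x a + t \<cdot>\<^sub>m y a) = poly P' t" by blast
  then show ?case by (intro exI[of _ "P + P'"]) simp
next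
  case (pf_mult p q)
  then obtain P P' where "\<forall>t. p (\<lambda>a. (1 - t) \<cdot>\<^sub>m x a + t \<cdot>\<^sub>m y a) = poly P t"
    "\<forall>t. q (\<lambda>a. (1 - t) \<cdot>\<^sub>m x a + t \<cdot>\<^sub>m y a) = poly P' t" by blast
  then show ?case by (intro exI[of _ "P * P'"]) simp
qed

lemma poly_funs_cong:
  assumes "p \<in> poly_funs Q d" "\<And>a. a < narrs Q \<Longrightarrow> f a = g a"
  shows "p f = p g"
  using assms(1) by induction (auto simp: assms(2))

text \<open>The line through \<open>x\<close> and \<open>y\<close> consists of compatible
  representations. Along it \<open>p\<close> and \<open>q\<close> become one-variable polynomials,
  neither of them zero, and an infinite field has a point where their product is nonzero.\<close>

lemma compat_reps_irreducible:
  fixes x y :: "nat \<Rightarrow> 'k::field mat"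
  assumes inf: "infinite (UNIV :: 'k set)" and wf: "quiver_wf Q"
    and N: "\<And>i. i < nverts Q \<Longrightarrow> N i \<in> carrier_mat (d i) (d i)"
    and p: "p \<in> poly_funs Q d" "x \<in> compat_reps Q d N" "p x \<noteq> 0"
    and q: "q \<in> poly_funs Q d" "y \<in> compat_reps Q d N" "q y \<noteq> 0"
  shows "\<exists>z\<in>compat_reps Q d N. p z \<noteq> 0 \<and> q z \<noteq> 0"
proof -
  have x: "is_rep Q d x" and y: "is_rep Q d y" using p(2) q(2) by (auto simp: compat_reps_def)
  let ?z = "\<lambda>t a. (1 - t) \<cdot>\<^sub>m x a + t \<cdot>\<^sub>m y a"
  obtain P P' where P: "\<And>t. p (?z t) = poly P t" and P': "\<And>t. q (?z t) = poly P' t"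
    using poly_funs_along_line[OF p(1) x y] poly_funs_along_line[OF q(1) x y] by blast
  \<comment> \<open>The end points are compared with \<open>x\<close> and \<open>y\<close> only at
    the arrows of \<open>Q\<close>, the only places that polynomial functions see.\<close>
  have "?z 0 a = x a" "?z 1 a = y a" if "a < narrs Q" for a
  proof -
    have "x a \<in> carrier_mat (d (tgt Q a)) (d (src Q a))" "y a \<in> carrier_mat (d (tgt Q a)) (d (src Q a))"
      using x y that by (auto simp: is_rep_def)
    then show "?z 0 a = x a" "?z 1 a = y a" by (auto intro!: eq_matI)
  qed
  then have "p (?z 0) = p x" "q (?z 1) = q y"
    by (intro poly_funs_cong[OF p(1)] poly_funs_cong[OF q(1)]; simp)+
  then have "poly P 0 \<noteq> 0" "poly P' 1 \<noteq> 0" using p(3) q(3) P[of 0] P'[of 1] by auto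
  then have "P * P' \<noteq> 0" by auto
  then have "finite {t. poly (P * P') t = 0}" by (rule poly_roots_finite)
  then have "{t. poly (P * P') t = 0} \<noteq> UNIV" using inf by metis
  then obtain t where "poly (P * P') t \<noteq> 0" by blast
  then have "p (?z t) \<noteq> 0" "q (?z t) \<noteq> 0" using P P' by auto
  moreover have "?z t \<in> compat_reps Q d N"
    unfolding compat_reps_def is_rep_def
  proof (intro CollectI conjI allI impI)
    fix a assume a: "a < narrs Q"
    have xa: "x a \<in> carrier_mat (d (tgt Q a)) (d (src Q a))" "y a \<in> carrier_mat (d (tgt Q a)) (d (src Q a))"
      using x y a by (auto simp: is_rep_def)
    then show "?z t a \<in> carrier_mat (d (tgt Q a)) (d (src Q a))" by simp
    have N': "N (tgt Q a) \<in> carrier_mat (d (tgt Q a)) (d (tgt Q a))" "N (src Q a) \<in> carrier_mat (d (src Q a)) (d (src Q a))"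
      using N wf a by (auto simp: quiver_wf_def)
    have s: "(1 - t) \<cdot>\<^sub>m x a \<in> carrier_mat (d (tgt Q a)) (d (src Q a))" "t \<cdot>\<^sub>m y a \<in> carrier_mat (d (tgt Q a)) (d (src Q a))"
      using xa by simp_all
    have "N (tgt Q a) * x a = x a * N (src Q a)" "N (tgt Q a) * y a = y a * N (src Q a)"
      using p(2) q(2) a by (auto simp: compat_reps_def)
    then show "N (tgt Q a) * ?z t a = ?z t a * N (src Q a)"
      using mult_add_distrib_mat[OF N'(1) s] add_mult_distrib_mat[OF s N'(2)]
        mult_smult_distrib[OF N'(1) xa(1)] mult_smult_distrib[OF N'(1) xa(2)]
        mult_smult_assoc_mat[OF xa(1) N'(2)] mult_smult_assoc_mat[OF xa(2) N'(2)] by simp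
  qed
  ultimately show ?thesis by blast
qed

section \<open>Vectors in the direct sum\<close>

lemma vsum_index:
  assumes "\<And>v. v \<in> set vs \<Longrightarrow> v \<in> carrier_vec n"
  shows "vsum n vs \<in> carrier_vec n" "i < n \<Longrightarrow> vsum n vs $ i = (\<Sum>v\<leftarrow>vs. v $ i)"
  using assms by (induction vs) (auto simp: vsum_def)

context stacked begin

definition flat :: "('i \<Rightarrow> 'k::field vec) \<Rightarrow> 'k vec" where
  "flat x = vec m (\<lambda>c. x (fst (e c)) $ snd (e c))"

lemma flat_carrier[simp]: "flat x \<in> carrier_vec m" by (simp add: flat_def)

lemma flat_surj:
  assumes "v \<in> carrier_vec m"
  obtains x where "\<And>a. x a \<in> carrier_vec (n a)" "flat x = v"
proof
  let ?x = "\<lambda>a. vec (n a) (\<lambda>i. v $ the_inv_into {..<m} e (a, i))"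
  show "?x a \<in> carrier_vec (n a)" for a by simp
  show "flat ?x = v"
    using assms by (intro eq_vecI) (auto simp: flat_def e_bounds the_inv_e simp del: prod.collapse)
qed

lemma flat_eq_iff:
  assumes "\<And>a. a \<in> S \<Longrightarrow> x a \<in> carrier_vec (n a)" "\<And>a. a \<in> S \<Longrightarrow> y a \<in> carrier_vec (n a)"
  shows "flat x = flat y \<longleftrightarrow> (\<forall>a\<in>S. x a = y a)"
proof
  assume eq: "flat x = flat y"
  show "\<forall>a\<in>S. x a = y a"
  proof
    fix a assume a: "a \<in> S"
    show "x a = y a"
    proof (rule eq_vecI)
      fix i assume "i < dim_vec (y a)"
      then have "(a, i) \<in> e ` {..<m}" using assms(2)[OF a] a e by (auto simp: bij_betw_def)
      then obtain c where "c < m" "e c = (a, i)" by (metis imageE lessThan_iff)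
      then show "x a $ i = y a $ i" using arg_cong[OF eq, of "\<lambda>v. v $ c"] by (simp add: flat_def)
    qed (use assms[OF a] in auto)
  qed
qed (auto simp: flat_def e_bounds intro!: eq_vecI)

lemma stack_mult_vec:
  assumes "\<And>a. a \<in> S \<Longrightarrow> f a \<in> carrier_mat (n a) l" "v \<in> carrier_vec l"
  shows "stack l f *\<^sub>v v = flat (\<lambda>a. f a *\<^sub>v v)"
proof (rule eq_vecI)
  fix c assume "c < dim_vec (flat (\<lambda>a. f a *\<^sub>v v))"
  then have c: "c < m" by (simp add: flat_def)
  then show "(stack l f *\<^sub>v v) $ c = flat (\<lambda>a. f a *\<^sub>v v) $ c"
    using assms(1)[OF e_bounds(1)[OF c]] assms(2) e_bounds[OF c]
    by (simp add: flat_def stack_def index_mat_def scalar_prod_def)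
qed (simp_all add: flat_def stack_def index_mat_def)

lemma side_mult_flat:
  assumes h: "\<And>a. a \<in> S \<Longrightarrow> h a \<in> carrier_mat w (n a)" and x: "\<And>a. a \<in> S \<Longrightarrow> x a \<in> carrier_vec (n a)"
    and as: "set as = S" "distinct as"
  shows "side w h *\<^sub>v flat x = vsum w (map (\<lambda>a. h a *\<^sub>v x a) as)"
proof (rule eq_vecI)
  note c = vsum_index[of "map (\<lambda>a. h a *\<^sub>v x a) as" w]
  have hx: "v \<in> carrier_vec w" if "v \<in> set (map (\<lambda>a. h a *\<^sub>v x a) as)" for v using that as(1) mult_mat_vec_carrier[OF h x] by auto
  show "dim_vec (side w h *\<^sub>v flat x) = dim_vec (vsum w (map (\<lambda>a. h a *\<^sub>v x a) as))"
    using c(1)[OF hx] by (simp add: side_def index_mat_def)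
  fix i assume "i < dim_vec (vsum w (map (\<lambda>a. h a *\<^sub>v x a) as))"
  then have i: "i < w" using c(1)[OF hx] by simp
  have "(side w h *\<^sub>v flat x) $ i = (\<Sum>c<m. h (fst (e c)) $$ (i, snd (e c)) * x (fst (e c)) $ snd (e c))"
    using i by (simp add: side_def flat_def index_mat_def scalar_prod_def atLeast0LessThan)
  also have "\<dots> = (\<Sum>y\<in>cells S n. h (fst y) $$ (i, snd y) * x (fst y) $ snd y)"
    by (rule sum.reindex_bij_betw[OF e])
  also have "\<dots> = (\<Sum>a\<in>S. (h a *\<^sub>v x a) $ i)"
    unfolding sum_cells
  proof (rule sum.cong)
    fix a assume "a \<in> S"
    then show "(\<Sum>j<n a. h (fst (a, j)) $$ (i, snd (a, j)) * x (fst (a, j)) $ snd (a, j)) = (h a *\<^sub>v x a) $ i"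
      using h[of a] x[of a] i by (simp add: scalar_prod_def atLeast0LessThan)
  qed simp
  also have "\<dots> = vsum w (map (\<lambda>a. h a *\<^sub>v x a) as) $ i"
    using c(2)[OF hx i] as by (simp add: o_def sum_list_distinct_conv_sum_set)
  finally show "(side w h *\<^sub>v flat x) $ i = vsum w (map (\<lambda>a. h a *\<^sub>v x a) as) $ i" .
qed

end

section \<open>Reflection at a source\<close>

lemma invertible_mat_inverse:
  fixes A :: "'k::field mat"
  assumes A: "A \<in> carrier_mat n n'" and inv: "invertible_mat A"
  obtains A' where "A' \<in> carrier_mat n' n" "A * A' = 1\<^sub>m n" "A' * A = 1\<^sub>m n'"
proof -
  obtain B where B: "inverts_mat A B" "inverts_mat B A"
    using inv unfolding invertible_mat_def by blast
  have 1: "A * B = 1\<^sub>m n" using B(1) A by (simp add: inverts_mat_def)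
  have 2: "B * A = 1\<^sub>m (dim_row B)" using B(2) by (simp add: inverts_mat_def)
  have "dim_col B = n" using arg_cong[OF 1, of dim_col] by simp
  moreover have "dim_row B = n'" using arg_cong[OF 2, of dim_col] A by simp
  ultimately show thesis using 1 2 that[of B] by auto
qed

lemma rep_iso_sym:
  assumes "rep_iso Q d f d' f'" and wf: "quiver_wf Q" and f: "is_rep Q d f" and f': "is_rep Q d' f'"
  shows "rep_iso Q d' f' d f"
proof -
  obtain \<phi> where \<phi>: "\<And>i. i < nverts Q \<Longrightarrow> \<phi> i \<in> carrier_mat (d' i) (d i) \<and> invertible_mat (\<phi> i)"
    and hom: "\<And>a. a < narrs Q \<Longrightarrow> \<phi> (tgt Q a) * f a = f' a * \<phi> (src Q a)"
    using assms(1) unfolding rep_iso_def by blast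
  have d: "d' i = d i" if "i < nverts Q" for i
    using \<phi>[OF that] unfolding invertible_mat_def square_mat.simps by (metis carrier_matD)
  have "\<exists>\<psi>. \<psi> \<in> carrier_mat (d i) (d' i) \<and> \<phi> i * \<psi> = 1\<^sub>m (d' i) \<and> \<psi> * \<phi> i = 1\<^sub>m (d i)" if i: "i < nverts Q" for i
    using invertible_mat_inverse[of "\<phi> i"] \<phi>[OF i] by metis
  then obtain \<psi> where \<psi>: "\<And>i. i < nverts Q \<Longrightarrow> \<psi> i \<in> carrier_mat (d i) (d' i) \<and>
      \<phi> i * \<psi> i = 1\<^sub>m (d' i) \<and> \<psi> i * \<phi> i = 1\<^sub>m (d i)" by metis
  show ?thesis
    unfolding rep_iso_def
  proof (intro exI[of _ \<psi>] conjI allI impI)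
    fix i assume i: "i < nverts Q"
    show "\<psi> i \<in> carrier_mat (d i) (d' i)" using \<psi>[OF i] by blast
    show "invertible_mat (\<psi> i)"
      unfolding invertible_mat_def inverts_mat_def square_mat.simps
      using \<psi>[OF i] \<phi>[OF i] d[OF i] by (metis carrier_matD)
  next
    fix a assume a: "a < narrs Q"
    then have st: "src Q a < nverts Q" "tgt Q a < nverts Q" using wf by (auto simp: quiver_wf_def)
    have fc: "f a \<in> carrier_mat (d (tgt Q a)) (d (src Q a))" "f' a \<in> carrier_mat (d' (tgt Q a)) (d' (src Q a))"
      using f f' a by (auto simp: is_rep_def)
    note t = \<psi>[OF st(2)] \<phi>[OF st(2)] and s = \<psi>[OF st(1)] \<phi>[OF st(1)]
    have "\<psi> (tgt Q a) * f' a = \<psi> (tgt Q a) * (f' a * (\<phi> (src Q a) * \<psi> (src Q a)))"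
      using s fc by simp
    also have "f' a * (\<phi> (src Q a) * \<psi> (src Q a)) = f' a * \<phi> (src Q a) * \<psi> (src Q a)"
      using s fc by (intro assoc_mult_mat[symmetric]) auto
    also have "\<dots> = \<phi> (tgt Q a) * f a * \<psi> (src Q a)" using hom[OF a] by simp
    also have "\<dots> = \<phi> (tgt Q a) * (f a * \<psi> (src Q a))"
      using s t fc by (intro assoc_mult_mat) auto
    also have "\<psi> (tgt Q a) * (\<phi> (tgt Q a) * (f a * \<psi> (src Q a)))
        = \<psi> (tgt Q a) * \<phi> (tgt Q a) * (f a * \<psi> (src Q a))"
      using s t fc by (intro assoc_mult_mat[symmetric, of _ "d (tgt Q a)" "d' (tgt Q a)" _ "d (tgt Q a)" _ "d' (src Q a)"]) auto
    also have "\<dots> = f a * \<psi> (src Q a)"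
    proof -
      have "f a * \<psi> (src Q a) \<in> carrier_mat (d (tgt Q a)) (d' (src Q a))"
        using fc(1) s by (meson mult_carrier_mat)
      then show ?thesis using t by (metis left_mult_one_mat)
    qed
    finally show "\<psi> (tgt Q a) * f' a = f a * \<psi> (src Q a)" .
  qed
qed

lemma invertible_mat_mult:
  fixes A :: "'k::field mat"
  assumes A: "A \<in> carrier_mat n n" and B: "B \<in> carrier_mat n n" and "invertible_mat A" "invertible_mat B"
  shows "invertible_mat (A * B)"
proof -
  obtain A' where A': "A' \<in> carrier_mat n n" "A * A' = 1\<^sub>m n" "A' * A = 1\<^sub>m n"
    using invertible_mat_inverse[OF A assms(3)] .
  obtain B' where B': "B' \<in> carrier_mat n n" "B * B' = 1\<^sub>m n" "B' * B = 1\<^sub>m n"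
    using invertible_mat_inverse[OF B assms(4)] .
  have "A * B * (B' * A') = A * (B * B') * A'" "B' * A' * (A * B) = B' * (A' * A) * B"
    using conjugate_mult[OF A one_carrier_mat B B'(1) one_carrier_mat A'(1) B'(2)]
      conjugate_mult[OF B'(1) one_carrier_mat A'(1) A one_carrier_mat B A'(3)] A B A' B' by simp_all
  then have "A * B * (B' * A') = 1\<^sub>m n" "B' * A' * (A * B) = 1\<^sub>m n"
    using A B A' B' by simp_all
  then show ?thesis
    using mult_carrier_mat[OF A B] mult_carrier_mat[OF B'(1) A'(1)]
    unfolding invertible_mat_def inverts_mat_def square_mat.simps by (metis carrier_matD)
qed

lemma rep_iso_trans:
  assumes "rep_iso Q d f d' f'" "rep_iso Q d' f' d'' f''" and wf: "quiver_wf Q"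
    and f: "is_rep Q d f" and f': "is_rep Q d' f'" and f'': "is_rep Q d'' f''"
  shows "rep_iso Q d f d'' f''"
proof -
  obtain \<phi> where \<phi>: "\<And>i. i < nverts Q \<Longrightarrow> \<phi> i \<in> carrier_mat (d' i) (d i) \<and> invertible_mat (\<phi> i)"
    and hom: "\<And>a. a < narrs Q \<Longrightarrow> \<phi> (tgt Q a) * f a = f' a * \<phi> (src Q a)"
    using assms(1) unfolding rep_iso_def by blast
  obtain \<psi> where \<psi>: "\<And>i. i < nverts Q \<Longrightarrow> \<psi> i \<in> carrier_mat (d'' i) (d' i) \<and> invertible_mat (\<psi> i)"
    and hom': "\<And>a. a < narrs Q \<Longrightarrow> \<psi> (tgt Q a) * f' a = f'' a * \<psi> (src Q a)"
    using assms(2) unfolding rep_iso_def by blast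
  show ?thesis
    unfolding rep_iso_def
  proof (intro exI[of _ "\<lambda>i. \<psi> i * \<phi> i"] conjI allI impI)
    fix i assume i: "i < nverts Q"
    then show "\<psi> i * \<phi> i \<in> carrier_mat (d'' i) (d i)" using \<phi>[OF i] \<psi>[OF i] by (meson mult_carrier_mat)
    have "d' i = d i" "d'' i = d' i"
      using \<phi>[OF i] \<psi>[OF i] unfolding invertible_mat_def square_mat.simps by (metis carrier_matD)+
    then show "invertible_mat (\<psi> i * \<phi> i)"
      using \<phi>[OF i] \<psi>[OF i] invertible_mat_mult by metis
  next
    fix a assume a: "a < narrs Q"
    then have st: "src Q a < nverts Q" "tgt Q a < nverts Q" using wf by (auto simp: quiver_wf_def)
    have fc: "f a \<in> carrier_mat (d (tgt Q a)) (d (src Q a))" "f' a \<in> carrier_mat (d' (tgt Q a)) (d' (src Q a))"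
      "f'' a \<in> carrier_mat (d'' (tgt Q a)) (d'' (src Q a))"
      using f f' f'' a by (auto simp: is_rep_def)
    have c: "\<phi> (tgt Q a) \<in> carrier_mat (d' (tgt Q a)) (d (tgt Q a))" "\<phi> (src Q a) \<in> carrier_mat (d' (src Q a)) (d (src Q a))"
      "\<psi> (tgt Q a) \<in> carrier_mat (d'' (tgt Q a)) (d' (tgt Q a))" "\<psi> (src Q a) \<in> carrier_mat (d'' (src Q a)) (d' (src Q a))"
      using \<phi> \<psi> st by blast+
    show "\<psi> (tgt Q a) * \<phi> (tgt Q a) * f a = f'' a * (\<psi> (src Q a) * \<phi> (src Q a))"
      using assoc_mult_mat[OF c(3,1) fc(1)] assoc_mult_mat[OF c(3) fc(2) c(2)] assoc_mult_mat[OF fc(3) c(4,2)]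
        hom[OF a] hom'[OF a] by simp
  qed
qed

text \<open>The summands are indexed by the arrows starting at \<open>k\<close>. The dimension at
  \<open>k\<close> after reflection is not tied to \<open>D\<close>; it enters as
  \<open>D(k := w)\<close> with \<open>w\<close> arbitrary.\<close>

locale source_reflection = stacked "set (out_arrows Q k)" "\<lambda>a. D (tgt Q a)" e m
  for Q :: quiver and k :: nat and D :: "nat \<Rightarrow> nat" and e :: "nat \<Rightarrow> nat \<times> nat" and m :: nat +
  assumes wf: "quiver_wf Q" and source: "is_source Q k"
begin

abbreviation "out \<equiv> set (out_arrows Q k)"

lemma out_iff[simp]: "a \<in> out \<longleftrightarrow> a < narrs Q \<and> src Q a = k"
  by (auto simp: out_arrows_def)

lemma tgt_neq: "a < narrs Q \<Longrightarrow> tgt Q a \<noteq> k"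
  using source by (auto simp: is_source_def)

lemma verts: "a < narrs Q \<Longrightarrow> src Q a < nverts Q" "a < narrs Q \<Longrightarrow> tgt Q a < nverts Q" "k < nverts Q"
  using wf source by (auto simp: quiver_wf_def is_source_def)

abbreviation "Q' \<equiv> refl_quiver Q k"

lemma refl_simps[simp]:
  "narrs Q' = narrs Q" "nverts Q' = nverts Q"
  "src Q a = k \<Longrightarrow> src Q' a = tgt Q a" "src Q a = k \<Longrightarrow> tgt Q' a = k"
  "src Q a \<noteq> k \<Longrightarrow> src Q' a = src Q a" "src Q a \<noteq> k \<Longrightarrow> tgt Q' a = tgt Q a"
  by (simp_all add: refl_quiver_def)

lemma wf': "quiver_wf Q'"
  using verts unfolding quiver_wf_def by (metis refl_simps)

text \<open>The conditions shared by both quivers: as \<open>k\<close> is a source, arrows not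
  starting at \<open>k\<close> do not touch it and are not reversed.\<close>

definition compat_away :: "(nat \<Rightarrow> 'k::field mat) \<Rightarrow> (nat \<Rightarrow> 'k mat) \<Rightarrow> bool" where
  "compat_away N f \<longleftrightarrow> (\<forall>a<narrs Q. src Q a \<noteq> k \<longrightarrow>
     f a \<in> carrier_mat (D (tgt Q a)) (D (src Q a)) \<and> N (tgt Q a) * f a = f a * N (src Q a))"

abbreviation target_op :: "(nat \<Rightarrow> 'k::field mat) \<Rightarrow> 'k mat" where
  "target_op N \<equiv> diagonal (\<lambda>a. N (tgt Q a))"

text \<open>Collects the equations at the arrows starting at \<open>k\<close> into one intertwining
  relation, the form in which a factoring sequence applies. \<open>compat_refl_iff\<close> is its
  counterpart for the reversed arrows.\<close>

lemma compat_reps_iff: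
  assumes N: "\<And>i. i < nverts Q \<Longrightarrow> N i \<in> carrier_mat (D i) (D i)"
  shows "f \<in> compat_reps Q D N \<longleftrightarrow> compat_away N f \<and> (\<forall>a\<in>out. f a \<in> carrier_mat (D (tgt Q a)) (D k)) \<and>
    target_op N * stack (D k) f = stack (D k) f * N k"
proof -
  have "target_op N * stack (D k) f = stack (D k) f * N k \<longleftrightarrow> (\<forall>a\<in>out. N (tgt Q a) * f a = f a * N k)"
    if f: "\<And>a. a \<in> out \<Longrightarrow> f a \<in> carrier_mat (D (tgt Q a)) (D k)"
  proof -
    have Nt: "\<And>a. a \<in> out \<Longrightarrow> N (tgt Q a) \<in> carrier_mat (D (tgt Q a)) (D (tgt Q a))" using N verts by auto
    have 1: "target_op N * stack (D k) f = stack (D k) (\<lambda>a. N (tgt Q a) * f a)"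
      by (rule diagonal_stack[OF Nt f])
    have 2: "stack (D k) f * N k = stack (D k) (\<lambda>a. f a * N k)"
      by (rule stack_mult[OF N[OF verts(3)] f])
    show ?thesis unfolding 1 2
    proof
      assume eq: "stack (D k) (\<lambda>a. N (tgt Q a) * f a) = stack (D k) (\<lambda>a. f a * N k)"
      show "\<forall>a\<in>out. N (tgt Q a) * f a = f a * N k"
        using stack_eqD[OF eq] mult_carrier_mat[OF Nt f] mult_carrier_mat[OF f N[OF verts(3)]] by blast
    qed (auto intro: stack_cong)
  qed
  then show ?thesis
    unfolding compat_reps_def is_rep_def compat_away_def mem_Collect_eq by (metis out_iff)
qed

lemma compat_refl_iff:
  assumes N: "\<And>i. i < nverts Q \<Longrightarrow> N i \<in> carrier_mat (D i) (D i)" and NK: "NK \<in> carrier_mat w w"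
  shows "h \<in> compat_reps Q' (D(k := w)) (N(k := NK)) \<longleftrightarrow> compat_away N h \<and>
    (\<forall>a\<in>out. h a \<in> carrier_mat w (D (tgt Q a))) \<and> NK * side w h = side w h * target_op N"
proof -
  have "NK * side w h = side w h * target_op N \<longleftrightarrow> (\<forall>a\<in>out. NK * h a = h a * N (tgt Q a))"
    if h: "\<And>a. a \<in> out \<Longrightarrow> h a \<in> carrier_mat w (D (tgt Q a))"
  proof -
    have Nt: "\<And>a. a \<in> out \<Longrightarrow> N (tgt Q a) \<in> carrier_mat (D (tgt Q a)) (D (tgt Q a))" using N verts by auto
    have 1: "side w h * target_op N = side w (\<lambda>a. h a * N (tgt Q a))"
      by (rule side_diagonal[OF Nt h])
    have 2: "NK * side w h = side w (\<lambda>a. NK * h a)"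
      by (rule mult_side[OF NK h])
    show ?thesis unfolding 1 2
    proof
      assume eq: "side w (\<lambda>a. NK * h a) = side w (\<lambda>a. h a * N (tgt Q a))"
      show "\<forall>a\<in>out. NK * h a = h a * N (tgt Q a)"
        using side_eqD[OF eq] mult_carrier_mat[OF NK h] mult_carrier_mat[OF h Nt] by blast
    qed (auto intro: side_cong)
  qed
  moreover have "h \<in> compat_reps Q' (D(k := w)) (N(k := NK)) \<longleftrightarrow>
    (\<forall>a<narrs Q. (src Q a \<noteq> k \<longrightarrow> h a \<in> carrier_mat (D (tgt Q a)) (D (src Q a)) \<and> N (tgt Q a) * h a = h a * N (src Q a)) \<and>
      (src Q a = k \<longrightarrow> h a \<in> carrier_mat w (D (tgt Q a)) \<and> NK * h a = h a * N (tgt Q a)))"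
  proof -
    have "(h a \<in> carrier_mat ((D(k := w)) (tgt Q' a)) ((D(k := w)) (src Q' a)) \<and>
        (N(k := NK)) (tgt Q' a) * h a = h a * (N(k := NK)) (src Q' a)) \<longleftrightarrow>
      (src Q a \<noteq> k \<longrightarrow> h a \<in> carrier_mat (D (tgt Q a)) (D (src Q a)) \<and> N (tgt Q a) * h a = h a * N (src Q a)) \<and>
      (src Q a = k \<longrightarrow> h a \<in> carrier_mat w (D (tgt Q a)) \<and> NK * h a = h a * N (tgt Q a))" if "a < narrs Q" for a
      using tgt_neq[OF that] by (cases "src Q a = k") simp_all
    then show ?thesis unfolding compat_reps_def is_rep_def mem_Collect_eq refl_simps(1) by blast
  qed
  ultimately show ?thesis unfolding compat_away_def by (metis out_iff)
qed

lemma matrix_over_stack: "matrix_over (poly_funs Q D) m (D k) (stack (D k))"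
proof (rule matrix_overI)
  fix c j assume c: "c < m" and j: "j < D k"
  have "(\<lambda>f. f (fst (e c)) $$ (snd (e c), j)) \<in> poly_funs Q D"
    using e_bounds[OF c] j by (intro pf_coord) auto
  then show "(\<lambda>f. stack (D k) f $$ (c, j)) \<in> poly_funs Q D"
    using c j by (simp add: stack_def index_mat_def)
qed simp

lemma matrix_over_side: "matrix_over (poly_funs Q' (D(k := w))) w m (side w)"
proof (rule matrix_overI)
  fix i c assume c: "c < m" and i: "i < w"
  define a where "a = fst (e c)"
  have a: "a < narrs Q" "src Q a = k" "snd (e c) < D (tgt Q a)" using e_bounds[OF c] by (simp_all add: a_def)
  have "(\<lambda>h. h a $$ (i, snd (e c))) \<in> poly_funs Q' (D(k := w))"
    by (rule pf_coord) (use a i tgt_neq in simp_all)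
  then show "(\<lambda>h. side w h $$ (i, c)) \<in> poly_funs Q' (D(k := w))"
    using c i by (simp add: side_def index_mat_def a_def)
qed simp

end

lemma factoring_sequence_split_exact:
  assumes "factoring_sequence l m k L M K \<phi> \<psi> r \<sigma> F G"
  shows "split_exact l m k \<phi> \<psi> r \<sigma>"
  using factoring_sequenceD(1-4,7-9)[OF assms] unfolding split_exact_def by blast

text \<open>Absorbs the factor by which an adjugate differs from the inverse: a nonzero multiple of
  \<open>\<phi>\<close> has the same image.\<close>

lemma split_exact_scale:
  fixes c :: "'k::field"
  assumes ex: "split_exact l m k \<phi> \<psi> r \<sigma>" and c: "c \<noteq> 0"
  shows "split_exact l m k (c \<cdot>\<^sub>m \<phi>) \<psi> (inverse c \<cdot>\<^sub>m r) \<sigma>"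
proof -
  note e = split_exactD[OF ex]
  have "\<psi> * (c \<cdot>\<^sub>m \<phi>) = 0\<^sub>m k l" using mult_smult_distrib[OF e(2,1), of c] e(5) by auto
  moreover have "c \<cdot>\<^sub>m \<phi> * (inverse c \<cdot>\<^sub>m r) = \<phi> * r"
  proof -
    have ir: "inverse c \<cdot>\<^sub>m r \<in> carrier_mat l m" using e(3) by simp
    have "c \<cdot>\<^sub>m \<phi> * (inverse c \<cdot>\<^sub>m r) = c \<cdot>\<^sub>m (inverse c \<cdot>\<^sub>m (\<phi> * r))"
      using mult_smult_assoc_mat[OF e(1) ir, of c] mult_smult_distrib[OF e(1,3), of "inverse c"] by simp
    also have "\<dots> = \<phi> * r" using c by (intro eq_matI) simp_all
    finally show ?thesis .
  qed
  ultimately show ?thesis using e unfolding split_exact_def by simp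
qed

lemma adj_mat_one: "adj_mat (1\<^sub>m n :: 'k::field mat) = 1\<^sub>m n"
  using adj_mat[of "1\<^sub>m n :: 'k mat" n] by auto

section \<open>Carrying the generic locus through the reflection\<close>

context source_reflection begin

definition put :: "'k::field mat \<Rightarrow> (nat \<Rightarrow> 'k mat) \<Rightarrow> nat \<Rightarrow> 'k mat" where
  "put \<Phi> f a = (if a \<in> out then unstack (D k) \<Phi> a else f a)"

lemma stack_put: "\<Phi> \<in> carrier_mat m (D k) \<Longrightarrow> stack (D k) (put \<Phi> f) = \<Phi>"
  using stack_cong[of "put \<Phi> f" "unstack (D k) \<Phi>" "D k"] stack_unstack[of \<Phi> "D k"]
  by (simp add: put_def)

lemma put_compat:
  assumes N: "\<And>i. i < nverts Q \<Longrightarrow> N i \<in> carrier_mat (D i) (D i)"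
    and "compat_away N f" "\<Phi> \<in> carrier_mat m (D k)" "target_op N * \<Phi> = \<Phi> * N k"
  shows "put \<Phi> f \<in> compat_reps Q D N"
  using assms(2-) by (simp add: compat_reps_iff[OF N] stack_put) (simp add: compat_away_def put_def)

lemma generic_transfer:
  fixes N :: "nat \<Rightarrow> 'k::field mat"
  assumes inf: "infinite (UNIV :: 'k set)"
    and N: "\<And>i. i < nverts Q \<Longrightarrow> N i \<in> carrier_mat (D i) (D i)" and NK: "NK \<in> carrier_mat w w"
    and seq: "factoring_sequence (D k) m w (N k) (target_op N) NK \<phi> \<psi> r \<sigma> F G"
    and q: "q \<in> poly_funs Q D" "g \<in> compat_reps Q D N" "q g \<noteq> 0"
  obtains p h where "p \<in> poly_funs Q' (D(k := w))" "h \<in> compat_reps Q' (D(k := w)) (N(k := NK))" "p h \<noteq> 0"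
    "\<And>h. h \<in> compat_reps Q' (D(k := w)) (N(k := NK)) \<Longrightarrow> p h \<noteq> 0 \<Longrightarrow>
      \<exists>g r \<sigma>. g \<in> compat_reps Q D N \<and> q g \<noteq> 0 \<and> (\<forall>a<narrs Q. src Q a \<noteq> k \<longrightarrow> g a = h a) \<and>
        split_exact (D k) m w (stack (D k) g) (side w h) r \<sigma>"
proof -
  let ?M = "target_op N" and ?l = "D k" and ?R = "poly_funs Q D" and ?R' = "poly_funs Q' (D(k := w))"
  let ?X = "compat_reps Q D N" and ?X' = "compat_reps Q' (D(k := w)) (N(k := NK))"
  have M: "?M \<in> carrier_mat m m" by simp
  note alg = function_algebra_poly_funs[of Q D] and alg' = function_algebra_poly_funs[of Q' "D(k := w)"]
  note iff = compat_reps_iff[OF N] and iff' = compat_refl_iff[OF N NK]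
  note s = factoring_sequenceD[OF seq]
  have g_away: "compat_away N g" using q(2) iff by blast
  obtain F' where F': "regular_map m ?l m m F'" "F' \<phi> = 1\<^sub>m m"
    and F'_fac: "\<And>X. X \<in> carrier_mat m ?l \<Longrightarrow> ?M * X = X * N k \<Longrightarrow> ?M * F' X = F' X * ?M \<and> F' X * \<phi> = X"
    using normalized_factor[OF seq M] by blast
  \<comment> \<open>Nonzero exactly when the endomorphism that carries \<open>\<phi>\<close> to
    \<open>stack ?l f\<close> is invertible.\<close>
  define p1 where "p1 f = det (F' (stack ?l f))" for f
  have p1: "p1 \<in> ?R"
    unfolding p1_def[abs_def]
    by (rule det_in_function_algebra[OF alg regular_mapD[OF F'(1) alg matrix_over_stack]])
  have x: "put \<phi> g \<in> ?X" by (rule put_compat[OF N g_away s(1,5)])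
  have "p1 (put \<phi> g) \<noteq> 0" using F'(2) by (simp add: p1_def stack_put[OF s(1)])
  \<comment> \<open>\<open>q\<close> is nonzero at \<open>g\<close> and \<open>p1\<close> at
    \<open>put \<phi> g\<close>, possibly not at a common point of these two; irreducibility
    provides the common point.\<close>
  then obtain g1 where g1: "g1 \<in> ?X" "q g1 \<noteq> 0" "p1 g1 \<noteq> 0"
    using compat_reps_irreducible[OF inf wf N q p1 x] by blast
  define A where "A = F' (stack ?l g1)"
  have g1': "compat_away N g1" "\<And>a. a \<in> out \<Longrightarrow> g1 a \<in> carrier_mat (D (tgt Q a)) ?l"
    "?M * stack ?l g1 = stack ?l g1 * N k" using g1(1) iff by blast+
  have A: "A \<in> carrier_mat m m" unfolding A_def by (rule regular_map_carrier[OF F'(1)]) simp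
  have A_fac: "?M * A = A * ?M" "A * \<phi> = stack ?l g1"
    unfolding A_def using F'_fac[OF _ g1'(3)] by simp_all
  have "det A \<noteq> 0" using g1(3) by (simp add: p1_def A_def)
  from commuting_inverse[OF A M this A_fac(1)] obtain A' where A': "A' \<in> carrier_mat m m"
    "A * A' = 1\<^sub>m m" "A' * A = 1\<^sub>m m" "?M * A' = A' * ?M" by blast
  \<comment> \<open>The translated sequence has \<open>stack ?l g1\<close> as its embedding and
    \<open>\<psi>1\<close> as its projection.\<close>
  define \<psi>1 where "\<psi>1 = \<psi> * A'"
  note seq1 = factoring_sequence_twist[OF seq N[OF verts(3)] M NK A A'(1-3) A_fac(1) A'(4),
      unfolded A_fac(2), folded \<psi>1_def]
  note s1 = factoring_sequenceD[OF seq1]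
  obtain G' where G': "regular_map w m m m G'" "G' \<psi>1 = 1\<^sub>m m"
    and G'_fac: "\<And>Y. Y \<in> carrier_mat w m \<Longrightarrow> NK * Y = Y * ?M \<Longrightarrow> ?M * G' Y = G' Y * ?M \<and> \<psi>1 * G' Y = Y"
    using normalized_factor[OF seq1 M] by blast
  \<comment> \<open>With \<open>B = G' (side w h)\<close> one has
    \<open>side w h = \<psi>1 * B\<close>, and this is the projection belonging to the embedding
    \<open>stack ?l g1\<close> multiplied by the inverse of \<open>B\<close>. The adjugate yields
    that embedding up to the factor \<open>det B\<close>.\<close>
  define \<Phi> where "\<Phi> h = adj_mat (G' (side w h)) * stack ?l g1" for h
  \<comment> \<open>The first factor makes \<open>B\<close> invertible; the second puts the
    representation built from \<open>\<Phi> h\<close> into the locus of \<open>q\<close>.\<close>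
  define p where "p h = det (G' (side w h)) * q (put (\<Phi> h) h)" for h
  note G'_over = regular_mapD[OF G'(1) alg' matrix_over_side]
  have \<Phi>_over: "matrix_over ?R' m ?l \<Phi>"
    unfolding \<Phi>_def[abs_def]
    by (rule matrix_over_mult[OF alg' matrix_over_adj_mat[OF alg' G'_over] matrix_over_const[OF alg']]) simp
  have "(\<lambda>h. q (put (\<Phi> h) h)) \<in> ?R'"
  proof (rule poly_funs_comp[OF q(1) alg'])
    fix a i j assume a: "a < narrs Q" and i: "i < D (tgt Q a)" and j: "j < D (src Q a)"
    show "(\<lambda>h. put (\<Phi> h) h a $$ (i, j)) \<in> ?R'"
    proof (cases "src Q a = k")
      case True
      with a i have "(a, i) \<in> cells out (\<lambda>a. D (tgt Q a))" by simp
      then have "the_inv_into {..<m} e (a, i) < m" by (rule the_inv_into_less[OF e])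
      with matrix_overD(2)[OF \<Phi>_over this, of j] True a i j show ?thesis
        by (simp add: put_def unstack_def)
    next
      case False
      with pf_coord[of a Q' i "D(k := w)" j] a i j tgt_neq[OF a] show ?thesis by (simp add: put_def)
    qed
  qed
  then have p: "p \<in> ?R'"
    unfolding p_def[abs_def] by (rule function_algebraD(3)[OF alg' det_in_function_algebra[OF alg' G'_over]])
  \<comment> \<open>Witness that \<open>p\<close> is not identically zero: its row matrix is
    \<open>\<psi>1\<close>, where \<open>G'\<close> is the identity, so the construction returns
    \<open>g1\<close>.\<close>
  define h1 where "h1 a = (if a \<in> out then unside w \<psi>1 a else g1 a)" for a
  have side_h1: "side w h1 = \<psi>1"
    using side_cong[of h1 "unside w \<psi>1" w] side_unside[OF s1(2)] by (simp add: h1_def)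
  have h1: "h1 \<in> ?X'"
    using g1'(1) s1(6) by (simp add: iff' side_h1) (simp add: compat_away_def h1_def)
  have "\<Phi> h1 = stack ?l g1"
    using left_mult_one_mat[OF carriers(1), of ?l g1] by (simp add: \<Phi>_def side_h1 G'(2) adj_mat_one)
  then have "q (put (\<Phi> h1) h1) = q g1"
    using unstack_stack[of _ g1 ?l] g1'(2) by (intro poly_funs_cong[OF q(1)]) (simp add: put_def h1_def)
  then have "p h1 \<noteq> 0" using g1(2) by (simp add: p_def side_h1 G'(2))
  moreover have "\<exists>g r \<sigma>. g \<in> ?X \<and> q g \<noteq> 0 \<and> (\<forall>a<narrs Q. src Q a \<noteq> k \<longrightarrow> g a = h a) \<and>
      split_exact ?l m w (stack ?l g) (side w h) r \<sigma>" if h: "h \<in> ?X'" "p h \<noteq> 0" for h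
  proof -
    have h': "compat_away N h" "NK * side w h = side w h * ?M" using h(1) iff' by blast+
    define B where "B = G' (side w h)"
    have B: "B \<in> carrier_mat m m" unfolding B_def by (rule regular_map_carrier[OF G'(1)]) simp
    have B_fac: "?M * B = B * ?M" "\<psi>1 * B = side w h"
      unfolding B_def using G'_fac[OF _ h'(2)] by simp_all
    have det: "det B \<noteq> 0" using h(2) by (simp add: p_def B_def)
    from commuting_inverse[OF B M this B_fac(1)] obtain B' where B': "B' \<in> carrier_mat m m"
      "B * B' = 1\<^sub>m m" "B' * B = 1\<^sub>m m" "?M * B' = B' * ?M" "adj_mat B = det B \<cdot>\<^sub>m B'" by blast
    \<comment> \<open>Here the inverse of \<open>B\<close> is the automorphism, which makes
      \<open>\<psi>1 * B = side w h\<close> the new projection.\<close>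
    note seq2 = factoring_sequence_twist[OF seq1 N[OF verts(3)] M NK B'(1) B B'(3,2,4) B_fac(1), unfolded B_fac(2)]
    note s2 = factoring_sequenceD[OF seq2]
    have \<Phi>h: "\<Phi> h = det B \<cdot>\<^sub>m (B' * stack ?l g1)"
      unfolding \<Phi>_def B_def[symmetric] B'(5) by (rule mult_smult_assoc_mat[OF B'(1) carriers(1)])
    have \<Phi>c: "\<Phi> h \<in> carrier_mat m ?l" unfolding \<Phi>h using s2(1) by simp
    have "?M * \<Phi> h = \<Phi> h * N k"
      unfolding \<Phi>h using mult_smult_distrib[OF M s2(1)] mult_smult_assoc_mat[OF s2(1) N[OF verts(3)]] s2(5) by simp
    then have in_X: "put (\<Phi> h) h \<in> ?X" using put_compat[OF N h'(1) \<Phi>c] by blast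
    have put_h: "stack ?l (put (\<Phi> h) h) = det B \<cdot>\<^sub>m (B' * stack ?l g1)"
      using stack_put[OF \<Phi>c, of h] \<Phi>h by (rule trans)
    have "split_exact ?l m w (stack ?l (put (\<Phi> h) h)) (side w h) (inverse (det B) \<cdot>\<^sub>m (r * A' * B)) (B' * (A * \<sigma>))"
      unfolding put_h
      by (rule split_exact_scale[OF factoring_sequence_split_exact[OF seq2] det])
    with in_X show ?thesis
      using h(2) by (intro exI[of _ "put (\<Phi> h) h"] exI conjI) (auto simp: p_def put_def)
  qed
  ultimately show thesis using that[OF p h1] by blast
qed

text \<open>The components of the isomorphism at the targets form a block diagonal automorphism of
  the direct sum, and the component at \<open>k\<close> completes the commuting square. The induced
  isomorphism of cokernels becomes the new component at \<open>k\<close>; the other components are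
  kept.\<close>

lemma rep_iso_reflection:
  assumes g: "is_rep Q D g" and f: "is_rep Q D f" and iso: "rep_iso Q D g D f"
    and h: "is_rep Q' (D(k := w)) h" and f': "is_rep Q' (D(k := w')) f'"
    and same: "\<And>a. a < narrs Q \<Longrightarrow> src Q a \<noteq> k \<Longrightarrow> g a = h a" "\<And>a. a < narrs Q \<Longrightarrow> src Q a \<noteq> k \<Longrightarrow> f' a = f a"
    and ex: "split_exact (D k) m w (stack (D k) g) (side w h) r \<sigma>"
    and ex': "split_exact (D k) m w' (stack (D k) f) (side w' f') r' \<sigma>'"
  shows "rep_iso Q' (D(k := w)) h (D(k := w')) f'"
proof -
  obtain \<theta> where \<theta>: "\<And>i. i < nverts Q \<Longrightarrow> \<theta> i \<in> carrier_mat (D i) (D i)"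
      "\<And>i. i < nverts Q \<Longrightarrow> invertible_mat (\<theta> i)"
    and hom: "\<And>a. a < narrs Q \<Longrightarrow> \<theta> (tgt Q a) * g a = f a * \<theta> (src Q a)"
    using iso unfolding rep_iso_def by blast
  have "\<forall>i. \<exists>B. i < nverts Q \<longrightarrow> B \<in> carrier_mat (D i) (D i) \<and> \<theta> i * B = 1\<^sub>m (D i) \<and> B * \<theta> i = 1\<^sub>m (D i)"
    using invertible_mat_inverse[OF \<theta>] by metis
  then obtain \<theta>' where \<theta>': "\<And>i. i < nverts Q \<Longrightarrow> \<theta>' i \<in> carrier_mat (D i) (D i)"
      "\<And>i. i < nverts Q \<Longrightarrow> \<theta> i * \<theta>' i = 1\<^sub>m (D i)" "\<And>i. i < nverts Q \<Longrightarrow> \<theta>' i * \<theta> i = 1\<^sub>m (D i)" by metis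
  have out: "a < narrs Q" "tgt Q a < nverts Q" "g a \<in> carrier_mat (D (tgt Q a)) (D k)" "f a \<in> carrier_mat (D (tgt Q a)) (D k)"
    "h a \<in> carrier_mat w (D (tgt Q a))" "f' a \<in> carrier_mat w' (D (tgt Q a))"
    "\<theta> (tgt Q a) \<in> carrier_mat (D (tgt Q a)) (D (tgt Q a))" "\<theta>' (tgt Q a) \<in> carrier_mat (D (tgt Q a)) (D (tgt Q a))"
    if "a \<in> out" for a
  proof -
    have a: "a < narrs Q" "src Q a = k" using that by simp_all
    show "a < narrs Q" "tgt Q a < nverts Q" using a verts by simp_all
    show "g a \<in> carrier_mat (D (tgt Q a)) (D k)" "f a \<in> carrier_mat (D (tgt Q a)) (D k)"
      using g f a unfolding is_rep_def by blast+
    have "h a \<in> carrier_mat ((D(k := w)) (tgt Q' a)) ((D(k := w)) (src Q' a))"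
      "f' a \<in> carrier_mat ((D(k := w')) (tgt Q' a)) ((D(k := w')) (src Q' a))"
      using h f' a(1) unfolding is_rep_def by simp_all
    then show "h a \<in> carrier_mat w (D (tgt Q a))" "f' a \<in> carrier_mat w' (D (tgt Q a))"
      using a tgt_neq[OF a(1)] by simp_all
    show "\<theta> (tgt Q a) \<in> carrier_mat (D (tgt Q a)) (D (tgt Q a))" "\<theta>' (tgt Q a) \<in> carrier_mat (D (tgt Q a)) (D (tgt Q a))"
      using \<theta>(1) \<theta>'(1) verts(2)[OF a(1)] by blast+
  qed
  have k: "k < nverts Q" by (rule verts(3))
  let ?T = "diagonal (\<lambda>a. \<theta> (tgt Q a))" and ?T' = "diagonal (\<lambda>a. \<theta>' (tgt Q a))"
  have "?T * ?T' = diagonal (\<lambda>a. \<theta> (tgt Q a) * \<theta>' (tgt Q a))"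
    by (rule diagonal_mult) (erule out(7,8))+
  also have "\<dots> = diagonal (\<lambda>a. 1\<^sub>m (D (tgt Q a)))"
    by (rule diagonal_cong) (rule \<theta>'(2)[OF out(2)])
  finally have TT': "?T * ?T' = 1\<^sub>m m" by (simp only: diagonal_one)
  have "?T' * ?T = diagonal (\<lambda>a. \<theta>' (tgt Q a) * \<theta> (tgt Q a))"
    by (rule diagonal_mult) (erule out(7,8))+
  also have "\<dots> = diagonal (\<lambda>a. 1\<^sub>m (D (tgt Q a)))"
    by (rule diagonal_cong) (rule \<theta>'(3)[OF out(2)])
  finally have T'T: "?T' * ?T = 1\<^sub>m m" by (simp only: diagonal_one)
  have "?T * stack (D k) g = stack (D k) (\<lambda>a. \<theta> (tgt Q a) * g a)"
    by (rule diagonal_stack[of "\<lambda>a. \<theta> (tgt Q a)", OF out(7,3)])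
  also have "\<dots> = stack (D k) (\<lambda>a. f a * \<theta> k)"
    using hom by (intro stack_cong) auto
  also have "\<dots> = stack (D k) f * \<theta> k"
    by (rule stack_mult[symmetric, OF \<theta>(1)[OF k] out(4)])
  finally obtain \<chi> where \<chi>: "\<chi> \<in> carrier_mat w' w" "invertible_mat \<chi>" "\<chi> * side w h = side w' f' * ?T"
    using split_exact_cokernel_unique[OF ex ex' _ _ TT' T'T \<theta>(1)[OF k] \<theta>'(1)[OF k] \<theta>'(2)[OF k]] by auto
  \<comment> \<open>Read block by block, this is compatibility of \<open>\<chi>\<close> with every
    reversed arrow.\<close>
  have eq: "side w' (\<lambda>a. \<chi> * h a) = side w' (\<lambda>a. f' a * \<theta> (tgt Q a))"
    using \<chi>(3) mult_side[of \<chi> w' w h, OF \<chi>(1) out(5)]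
      side_diagonal[of "\<lambda>a. \<theta> (tgt Q a)" f' w', OF out(7,6)] by simp
  have \<chi>_hom: "\<chi> * h a = f' a * \<theta> (tgt Q a)" if "a \<in> out" for a
    using side_eqD[OF eq that] mult_carrier_mat[OF \<chi>(1) out(5)[OF that]]
      mult_carrier_mat[OF out(6)[OF that] out(7)[OF that]] by blast
  show ?thesis
    unfolding rep_iso_def
  proof (intro exI[of _ "\<theta>(k := \<chi>)"] conjI allI impI)
    fix i assume "i < nverts Q'"
    then show "(\<theta>(k := \<chi>)) i \<in> carrier_mat ((D(k := w')) i) ((D(k := w)) i)" "invertible_mat ((\<theta>(k := \<chi>)) i)"
      using \<theta> \<chi> by simp_all
  next
    fix a assume a: "a < narrs Q'"
    show "(\<theta>(k := \<chi>)) (tgt Q' a) * h a = f' a * (\<theta>(k := \<chi>)) (src Q' a)"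
      using \<chi>_hom[of a] hom[of a] same[of a] tgt_neq[of a] a by (cases "src Q a = k") simp_all
  qed
qed

text \<open>Under \<open>flat\<close>, a family of vectors indexed by the arrows is one vector of
  the direct sum, so the elementwise cokernel conditions become surjectivity and the kernel
  condition for \<open>side\<close>.\<close>

lemma refl_minus_split_exact:
  assumes refl: "is_refl_minus Q k d f d' f'" and d: "\<And>i. i < nverts Q \<Longrightarrow> d i = D i"
  shows "\<exists>r \<sigma>. split_exact (D k) m (d' k) (stack (D k) f) (side (d' k) f') r \<sigma>"
proof -
  note refl' = refl[unfolded is_refl_minus_def]
  have dk: "d k = D k" and dt: "\<And>a. a \<in> out \<Longrightarrow> d (tgt Q a) = D (tgt Q a)" using d verts by auto
  have f: "f a \<in> carrier_mat (D (tgt Q a)) (D k)" if "a \<in> out" for a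
    using refl' that dk dt[OF that] unfolding is_rep_def by auto
  have f': "f' a \<in> carrier_mat (d' k) (D (tgt Q a))" if "a \<in> out" for a
  proof -
    have a: "a < narrs Q" "src Q a = k" using that by simp_all
    have "is_rep Q' d' f'" and d': "\<forall>i<nverts Q. i \<noteq> k \<longrightarrow> d' i = d i" using refl' by blast+
    then have "f' a \<in> carrier_mat (d' (tgt Q' a)) (d' (src Q' a))"
      using a(1) unfolding is_rep_def by simp
    moreover have "d' (tgt Q a) = d (tgt Q a)" using d' verts(2)[OF a(1)] tgt_neq[OF a(1)] by blast
    ultimately show ?thesis using a dt[OF that] by simp
  qed
  have side: "side (d' k) f' *\<^sub>v flat x = vsum (d' k) (map (\<lambda>a. f' a *\<^sub>v x a) (out_arrows Q k))"
    if "\<And>a. a \<in> out \<Longrightarrow> x a \<in> carrier_vec (D (tgt Q a))" for x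
    by (rule side_mult_flat[OF f' that]) (auto simp: out_arrows_def)
  have surj: "\<forall>v \<in> carrier_vec (d' k). \<exists>x. (\<forall>a\<in>out. x a \<in> carrier_vec (d (tgt Q a))) \<and>
      vsum (d' k) (map (\<lambda>a. f' a *\<^sub>v x a) (out_arrows Q k)) = v"
    and ker: "\<forall>x. (\<forall>a\<in>out. x a \<in> carrier_vec (d (tgt Q a))) \<longrightarrow>
      (vsum (d' k) (map (\<lambda>a. f' a *\<^sub>v x a) (out_arrows Q k)) = 0\<^sub>v (d' k) \<longleftrightarrow>
        (\<exists>v \<in> carrier_vec (d k). \<forall>a\<in>out. x a = f a *\<^sub>v v))"
    using refl' by blast+
  show ?thesis
  proof (rule split_exact_exists)
    fix v :: "'a vec" assume "v \<in> carrier_vec (d' k)"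
    then obtain x where x: "\<forall>a\<in>out. x a \<in> carrier_vec (d (tgt Q a))"
      "vsum (d' k) (map (\<lambda>a. f' a *\<^sub>v x a) (out_arrows Q k)) = v" using surj by blast
    then have "side (d' k) f' *\<^sub>v flat x = v" using side[of x] dt by (metis x(1))
    then show "\<exists>y\<in>carrier_vec m. side (d' k) f' *\<^sub>v y = v" using flat_carrier by blast
  next
    fix y :: "'a vec" assume "y \<in> carrier_vec m"
    then obtain x where x: "\<And>a. x a \<in> carrier_vec (D (tgt Q a))" "flat x = y"
      by (rule flat_surj) (rule that)
    have "y = stack (D k) f *\<^sub>v v \<longleftrightarrow> (\<forall>a\<in>out. x a = f a *\<^sub>v v)" if v: "v \<in> carrier_vec (D k)" for v
    proof -
      have "stack (D k) f *\<^sub>v v = flat (\<lambda>a. f a *\<^sub>v v)" by (rule stack_mult_vec[OF f v])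
      moreover have "flat x = flat (\<lambda>a. f a *\<^sub>v v) \<longleftrightarrow> (\<forall>a\<in>out. x a = f a *\<^sub>v v)"
        by (rule flat_eq_iff[OF x(1)]) (rule mult_mat_vec_carrier[OF f v])
      ultimately show ?thesis by (simp only: x(2))
    qed
    moreover have "side (d' k) f' *\<^sub>v y = 0\<^sub>v (d' k) \<longleftrightarrow> (\<exists>v \<in> carrier_vec (D k). \<forall>a\<in>out. x a = f a *\<^sub>v v)"
    proof -
      have "\<forall>a\<in>out. x a \<in> carrier_vec (d (tgt Q a))" using x(1) dt by simp
      with ker have "vsum (d' k) (map (\<lambda>a. f' a *\<^sub>v x a) (out_arrows Q k)) = 0\<^sub>v (d' k) \<longleftrightarrow>
        (\<exists>v \<in> carrier_vec (d k). \<forall>a\<in>out. x a = f a *\<^sub>v v)" by blast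
      then show ?thesis using side[OF x(1)] unfolding x(2) dk by (simp only:)
    qed
    ultimately show "side (d' k) f' *\<^sub>v y = 0\<^sub>v (d' k) \<longleftrightarrow> (\<exists>v\<in>carrier_vec (D k). y = stack (D k) f *\<^sub>v v)"
      by blast
  qed simp_all
qed

end

section \<open>From interlaced partitions to interlaced blocks\<close>

lemma jordan_cells_nth_reindex:
  assumes "jordan_cells N n {..<length xs} ((!) xs)"
    and "\<And>j. j \<in> S \<Longrightarrow> 0 < \<mu> j \<Longrightarrow> c j < length xs \<and> \<mu> j = xs ! c j \<and> g (c j) = j"
    and "\<And>i. i < length xs \<Longrightarrow> 0 < xs ! i \<Longrightarrow> g i \<in> S \<and> \<mu> (g i) = xs ! i \<and> c (g i) = i"
  shows "jordan_cells N n S \<mu>"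
proof (rule jordan_cells_reindex[OF assms(1)])
  show "bij_betw g {i \<in> {..<length xs}. 0 < xs ! i} {i \<in> S. 0 < \<mu> i}"
    by (rule bij_betw_byWitness[of _ c]) (use assms(2,3) in auto)
qed (use assms(3) in auto)

lemma pad_antimono:
  assumes "\<And>i. pad mu (Suc i) \<le> pad mu i" "i \<le> j"
  shows "pad mu j \<le> pad mu i"
  using lift_Suc_antimono_le[of "pad mu"] assms by blast

lemma card_nth_eq: "card {i \<in> {..<length xs}. xs ! i = v} = count (mset xs) v"
proof -
  have "count (mset xs) v = length (filter (\<lambda>x. v = x) xs)" by (induction xs) auto
  also have "\<dots> = card {i. i < length xs \<and> v = xs ! i}" by (rule length_filter_conv_card)
  finally show ?thesis by (simp add: eq_commute[of v])
qed

context
  fixes t :: nat and lam mu :: "nat list"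
  assumes inter: "interlaced t lam mu"
begin

text \<open>Each of the first \<open>t\<close> parts of \<open>mu\<close> is paired with an empty
  block and receives nothing from the source, so it passes unchanged to the cokernel. From there on
  two consecutive parts form a pair, with one part of \<open>lam\<close> between them.\<close>

definition long_part :: "nat \<Rightarrow> nat" where
  "long_part j = (if j < t then pad mu j else pad mu (t + 2 * (j - t)))"
definition short_part :: "nat \<Rightarrow> nat" where
  "short_part j = (if j < t then 0 else pad mu (t + 2 * (j - t) + 1))"
definition middle_part :: "nat \<Rightarrow> nat" where
  "middle_part j = (if j < t then 0 else pad lam (j - t))"

lemma mu_antimono: "i \<le> j \<Longrightarrow> pad mu j \<le> pad mu i"
  using inter pad_antimono[of mu] unfolding interlaced_def by blast

lemma lam_between: "pad lam j \<le> pad mu (t + 2 * j)" "pad mu (Suc (t + 2 * j)) \<le> pad lam j"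
  using inter unfolding interlaced_def by auto

text \<open>All pairs beyond \<open>t + length mu\<close> would be empty, and the bound agrees with
  the range in \<open>diff_part\<close>.\<close>

interpretation interlaced_blocks "t + length mu" long_part short_part middle_part
proof
  fix j c b
  show "short_part j \<le> middle_part j" "middle_part j \<le> long_part j"
    using lam_between[of "j - t"] by (auto simp: short_part_def middle_part_def long_part_def)
  show "middle_part j = short_part j \<or> long_part j \<le> (if b then long_part c else short_part c)
    \<or> (if b then long_part c else short_part c) \<le> short_part j"
  proof (cases "j < t")
    case False
    let ?x = "if b then long_part c else short_part c"
    \<comment> \<open>A block length is zero or a part of \<open>mu\<close>, and by monotonicity no
      part lies strictly between two consecutive ones.\<close>
    have "?x = 0 \<or> (\<exists>i. ?x = pad mu i)" by (auto simp: short_part_def long_part_def)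
    moreover have "pad mu (t + 2 * (j - t)) \<le> pad mu i \<or> pad mu i \<le> pad mu (t + 2 * (j - t) + 1)" for i
      using mu_antimono by (cases "i \<le> t + 2 * (j - t)") auto
    ultimately show ?thesis using False by (auto simp: short_part_def long_part_def)
  qed (simp add: middle_part_def short_part_def)
qed

lemma interlaced_factoring_sequence:
  fixes NL :: "'k::field mat"
  assumes NL: "NL \<in> carrier_mat l l" "jordan_cells NL l {..<length lam} ((!) lam)"
    and NM: "NM \<in> carrier_mat m m" "jordan_cells NM m {..<length mu} ((!) mu)"
    and NK: "NK \<in> carrier_mat k k" "jordan_cells NK k {..<t + length mu} (diff_seq t mu lam)"
  shows "\<exists>\<phi> \<psi> r \<sigma> F G. factoring_sequence l m k NL NM NK \<phi> \<psi> r \<sigma> F G"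
proof (rule factoring_sequence_exists[OF _ _ _ NL(1) NM(1) NK(1)])
  have less: "i < length mu" if "0 < pad mu i" for i using that by (auto simp: pad_def split: if_splits)
  show "jordan_cells NL l {..<t + length mu} middle_part"
  proof (rule jordan_cells_nth_reindex[OF NL(2), of _ _ "\<lambda>j. j - t" "\<lambda>i. t + i"])
    fix i assume i: "i < length lam" "0 < lam ! i"
    \<comment> \<open>A positive part of \<open>lam\<close> lies below a part of \<open>mu\<close>,
      which bounds its position by \<open>length mu\<close>.\<close>
    then have "0 < pad mu (t + 2 * i)" using lam_between(1)[of i] by (simp add: pad_def)
    from less[OF this] i show "t + i \<in> {..<t + length mu} \<and> middle_part (t + i) = lam ! i \<and> t + i - t = i"
      by (simp add: middle_part_def pad_def)
  qed (auto simp: middle_part_def pad_def split: if_splits)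
  \<comment> \<open>\<open>c\<close> gives the position in \<open>mu\<close> of a labelled block and
    \<open>g\<close> the label of a position. The short labels below \<open>t\<close> have size 0,
    so the value of \<open>c\<close> there is immaterial.\<close>
  define c where "c = (\<lambda>(j, b). if j < t then j else if b then t + 2 * (j - t) else t + 2 * (j - t) + 1)"
  define g where "g i = (if i < t then (i, True) else (t + (i - t) div 2, even (i - t)))" for i
  show "jordan_cells NM m pairs M"
  proof (rule jordan_cells_nth_reindex[OF NM(2), of _ _ c g])
    fix x assume "x \<in> pairs" and pos: "0 < M x"
    obtain j b where x: "x = (j, b)" by fastforce
    have M_x: "M x = pad mu (c x) \<and> (j < t \<longrightarrow> b)"
      using pos by (cases b) (auto simp: x c_def long_part_def short_part_def split: if_splits)
    then have less_x: "c x < length mu" using less pos by simp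
    have "g (c x) = x"
    proof (cases "j < t")
      case False
      then show ?thesis by (cases b) (simp_all add: x c_def g_def)
    qed (use M_x in \<open>simp add: x c_def g_def\<close>)
    with M_x less_x show "c x < length mu \<and> M x = mu ! c x \<and> g (c x) = x" by (simp add: pad_def)
  next
    fix i assume i: "i < length mu" "0 < mu ! i"
    show "g i \<in> pairs \<and> M (g i) = mu ! i \<and> c (g i) = i"
    proof (cases "i < t")
      case True
      with i show ?thesis by (simp add: g_def c_def long_part_def pad_def)
    next
      case False
      define n where "n = i - t"
      have n: "i = t + n" using False by (simp add: n_def)
      show ?thesis
      proof (cases "even n")
        case True
        then obtain n' where "n = 2 * n'" by (elim evenE)
        with n i show ?thesis by (simp add: g_def c_def long_part_def pad_def)
      next
        case odd: False
        then obtain n' where "n = 2 * n' + 1" by (elim oddE)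
        with n i show ?thesis by (simp add: g_def c_def short_part_def pad_def)
      qed
    qed
  qed
  have "K = diff_seq t mu lam"
    by (rule ext) (simp add: K_def diff_seq_def long_part_def short_part_def middle_part_def)
  with NK(2) show "jordan_cells NK k {..<t + length mu} K" by simp
qed

end

lemma jordan_type_diff_part:
  fixes N :: "'k::field mat"
  assumes "jordan_type N (diff_part t mu lam)"
  shows "jordan_cells N (sum_list (diff_part t mu lam)) {..<t + length mu} (diff_seq t mu lam)"
proof -
  let ?xs = "map (diff_seq t mu lam) [0..<t + length mu]"
  have "jordan_type N ?xs"
    using assms unfolding jordan_type_def diff_part_def jordan_matrix_filter_pos .
  from jordan_type_cells[OF this]
  have "jordan_cells N (sum_list ?xs) {..<length ?xs} ((!) ?xs)" .
  moreover have "sum_list (filter (\<lambda>x. 0 < x) ys) = sum_list ys" for ys :: "nat list" by (induction ys) auto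
  then have "sum_list (diff_part t mu lam) = sum_list ?xs" unfolding diff_part_def .
  ultimately have "jordan_cells N (sum_list (diff_part t mu lam)) {..<length ?xs} ((!) ?xs)" by simp
  then show ?thesis
    by (rule jordan_cells_nth_reindex[of _ _ _ _ _ id id]) auto
qed

context source_reflection begin

text \<open>The union of parts is sorted in \<open>adj_part\<close>, which loses the arrow each part
  came from; the comparison therefore counts how often each size occurs.\<close>

lemma jordan_cells_target_op:
  fixes N :: "nat \<Rightarrow> 'k::field mat"
  assumes D: "D = (\<lambda>i. sum_list (\<nu> i))"
    and N: "\<And>i. i < nverts Q \<Longrightarrow> N i \<in> carrier_mat (D i) (D i)"
    and type: "\<And>i. i < nverts Q \<Longrightarrow> jordan_type (N i) (\<nu> i)"
  shows "jordan_cells (target_op N) m {..<length (adj_part Q k \<nu>)} ((!) (adj_part Q k \<nu>))"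
proof -
  let ?S = "SIGMA a:out. {..<length (\<nu> (tgt Q a))}"
  have "jordan_cells (target_op N) m ?S (\<lambda>(a, i). \<nu> (tgt Q a) ! i)"
  proof (rule jordan_cells_diagonal)
    fix a assume "a \<in> out"
    then have "tgt Q a < nverts Q" using verts by simp
    then show "N (tgt Q a) \<in> carrier_mat (D (tgt Q a)) (D (tgt Q a))"
      "jordan_cells (N (tgt Q a)) (D (tgt Q a)) {..<length (\<nu> (tgt Q a))} ((!) (\<nu> (tgt Q a)))"
      using N jordan_type_cells[OF type] by (simp_all add: D)
  qed
  then show ?thesis
  proof (rule jordan_cells_cong_card)
    fix v :: nat
    have "{x \<in> ?S. (case x of (a, i) \<Rightarrow> \<nu> (tgt Q a) ! i) = v}
        = (SIGMA a:out. {i \<in> {..<length (\<nu> (tgt Q a))}. \<nu> (tgt Q a) ! i = v})" by auto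
    then have "card {x \<in> ?S. (case x of (a, i) \<Rightarrow> \<nu> (tgt Q a) ! i) = v}
        = (\<Sum>a\<in>out. card {i \<in> {..<length (\<nu> (tgt Q a))}. \<nu> (tgt Q a) ! i = v})"
      by (simp only:) (rule card_SigmaI; simp)
    also have "\<dots> = (\<Sum>a\<in>out. count (mset (\<nu> (tgt Q a))) v)" by (simp only: card_nth_eq)
    also have "\<dots> = (\<Sum>a\<leftarrow>out_arrows Q k. count (mset (\<nu> (tgt Q a))) v)"
      by (rule sum_list_distinct_conv_sum_set[symmetric]) (simp add: out_arrows_def)
    also have "\<dots> = count (mset (concat (map (\<lambda>a. \<nu> (tgt Q a)) (out_arrows Q k)))) v"
    proof -
      have "(\<Sum>a\<leftarrow>as. count (mset (\<nu> (tgt Q a))) v) = count (mset (concat (map (\<lambda>a. \<nu> (tgt Q a)) as))) v" for as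
        by (induction as) simp_all
      then show ?thesis .
    qed
    finally show "card {x \<in> ?S. (case x of (a, i) \<Rightarrow> \<nu> (tgt Q a) ! i) = v}
      = card {i \<in> {..<length (adj_part Q k \<nu>)}. adj_part Q k \<nu> ! i = v}"
      unfolding card_nth_eq by (simp add: adj_part_def)
  qed simp_all
qed

end

section \<open>The generic class of the reflected quiver\<close>

lemma rep_iso_cong:
  assumes "quiver_wf Q" "\<And>i. i < nverts Q \<Longrightarrow> d i = e i" "\<And>i. i < nverts Q \<Longrightarrow> d' i = e' i"
  shows "rep_iso Q d f d' f' = rep_iso Q e f e' f'"
  using assms unfolding rep_iso_def by simp

lemma is_rep_cong:
  assumes "quiver_wf Q" "\<And>i. i < nverts Q \<Longrightarrow> d i = e i"
  shows "is_rep Q d f = is_rep Q e f"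
  using assms unfolding is_rep_def quiver_wf_def by simp

theorem theorem3p5:
  fixes Q :: quiver and k t :: nat and \<nu> :: "nat \<Rightarrow> nat list" and d d' :: "nat \<Rightarrow> nat"
    and f f' :: "nat \<Rightarrow> 'k::field mat"
  assumes alg_closed: "\<forall>p :: 'k poly. degree p > 0 \<longrightarrow> (\<exists>x. poly p x = 0)"
    and dynkin: "dynkin_quiver Q"
    and source: "is_source Q k"
    and parts: "\<forall>i<nverts Q. is_partition (\<nu> i) \<and> sum_list (\<nu> i) = d i"
    and inter: "interlaced t (\<nu> k) (adj_part Q k \<nu>)"
    and gen: "is_GenRep Q \<nu> d f"
    and refl: "is_refl_minus Q k d f d' f'"
  shows "is_GenRep (refl_quiver Q k) (sigma_part Q k t \<nu>) d' f'"
proof -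
  \<comment> \<open>\<open>is_GenRep\<close> measures dimensions by these sums, whereas
    \<open>d\<close> agrees with them only at vertices of \<open>Q\<close>.\<close>
  define D where "D = (\<lambda>i. sum_list (\<nu> i))"
  define \<kappa> where "\<kappa> = diff_part t (adj_part Q k \<nu>) (\<nu> k)"
  define w where "w = sum_list \<kappa>"
  let ?Q' = "refl_quiver Q k"
  have wf: "quiver_wf Q" using dynkin by (simp add: dynkin_quiver_def)
  have inf: "infinite (UNIV :: 'k set)" by (rule infinite_if_alg_closed[OF alg_closed])
  have d: "d i = D i" if "i < nverts Q" for i using parts that by (simp add: D_def)
  obtain N U where N: "\<And>i. i < nverts Q \<Longrightarrow> N i \<in> carrier_mat (D i) (D i)"
      "\<And>i. i < nverts Q \<Longrightarrow> jordan_type (N i) (\<nu> i)"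
    and U: "zariski_open_in Q D (compat_reps Q D N) U"
    and iso: "\<And>g h. g \<in> U \<Longrightarrow> h \<in> U \<Longrightarrow> rep_iso Q D g D h"
    and g0: "\<exists>g\<in>U. rep_iso Q D g d f" and f: "is_rep Q d f"
    using gen unfolding is_GenRep_def Let_def D_def[symmetric] by blast
  obtain g0 where g0: "g0 \<in> U" "rep_iso Q D g0 d f" using g0 by blast
  obtain P where P: "P \<subseteq> poly_funs Q D" "U = {f \<in> compat_reps Q D N. \<exists>p\<in>P. p f \<noteq> 0}"
    using U unfolding zariski_open_in_def by blast
  \<comment> \<open>One member of the family suffices: where \<open>q\<close> is nonzero, a
    compatible representation already lies in \<open>U\<close>.\<close>
  obtain q where q: "q \<in> P" "q g0 \<noteq> 0" "g0 \<in> compat_reps Q D N" using g0(1) P(2) by blast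
  have qP: "q \<in> poly_funs Q D" using q(1) P(1) by blast
  have "finite (cells (set (out_arrows Q k)) (\<lambda>a. D (tgt Q a)))" by simp
  from ex_bij_betw_nat_finite[OF this] obtain e :: "nat \<Rightarrow> nat \<times> nat" and m where
    e: "bij_betw e {..<m} (cells (set (out_arrows Q k)) (\<lambda>a. D (tgt Q a)))"
    unfolding atLeast0LessThan by metis
  interpret source_reflection Q k D e m
    by unfold_locales (use e wf source in simp_all)
  \<comment> \<open>The operators in \<open>is_GenRep\<close> may be chosen: the Jordan matrix
    itself is taken at \<open>k\<close>, and the given ones are kept elsewhere.\<close>
  define NK :: "'k mat" where "NK = jordan_matrix (map (\<lambda>s. (s, 0)) \<kappa>)"
  have NK: "NK \<in> carrier_mat w w"
    using jordan_matrix_carrier[of "map (\<lambda>s. (s, 0 :: 'k)) \<kappa>"] by (simp add: NK_def w_def o_def)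
  have NK_type: "jordan_type NK \<kappa>"
    unfolding jordan_type_def NK_def[symmetric] by (rule similar_mat_refl[OF NK])
  have k: "k < nverts Q" by (rule verts(3))
  obtain \<phi> \<psi> r \<sigma> F G where seq: "factoring_sequence (D k) m w (N k) (target_op N) NK \<phi> \<psi> r \<sigma> F G"
    using interlaced_factoring_sequence[OF inter N(1)[OF k] _ carriers(3) jordan_cells_target_op[OF D_def N] NK]
      jordan_type_cells[OF N(2)[OF k]] jordan_type_diff_part[OF NK_type[unfolded \<kappa>_def]]
    unfolding D_def \<kappa>_def[symmetric] w_def[symmetric] by blast
  let ?D' = "D(k := w)" and ?N' = "N(k := NK)"
  let ?X' = "compat_reps ?Q' ?D' ?N'"
  obtain p h1 where p: "p \<in> poly_funs ?Q' ?D'" "h1 \<in> ?X'" "p h1 \<noteq> 0"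
    and transfer: "\<And>h. h \<in> ?X' \<Longrightarrow> p h \<noteq> 0 \<Longrightarrow>
      \<exists>g r \<sigma>. g \<in> compat_reps Q D N \<and> q g \<noteq> 0 \<and> (\<forall>a<narrs Q. src Q a \<noteq> k \<longrightarrow> g a = h a) \<and>
        split_exact (D k) m w (stack (D k) g) (side w h) r \<sigma>"
    using generic_transfer[OF inf N(1) NK seq qP q(3,2)] by metis
  obtain r' \<sigma>' where ex': "split_exact (D k) m (d' k) (stack (D k) f) (side (d' k) f') r' \<sigma>'"
    using refl_minus_split_exact[OF refl d] by blast
  have f': "is_rep ?Q' d' f'" and d': "\<And>i. i < nverts Q \<Longrightarrow> i \<noteq> k \<Longrightarrow> d' i = d i"
    and same: "\<And>a. a < narrs Q \<Longrightarrow> src Q a \<noteq> k \<Longrightarrow> f' a = f a"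
    using refl unfolding is_refl_minus_def by blast+
  have d'_eq: "d' i = (D(k := d' k)) i" if "i < nverts ?Q'" for i using that d d' by simp
  have f_D: "is_rep Q D f" using f is_rep_cong[of Q d D f, OF wf d] by simp
  have f'_D: "is_rep ?Q' (D(k := d' k)) f'" using f' is_rep_cong[of ?Q' d' "D(k := d' k)" f', OF wf' d'_eq] by simp
  \<comment> \<open>Such an \<open>h\<close> is a reflection of some \<open>g\<close> in
    \<open>U\<close>, and \<open>g\<close> is isomorphic to \<open>f\<close> through
    \<open>g0\<close>. Taking cokernels carries this over to \<open>h\<close> and
    \<open>f'\<close>.\<close>
  have iso': "rep_iso ?Q' ?D' h d' f'" if h: "h \<in> ?X'" "p h \<noteq> 0" for h
  proof -
    obtain g r \<sigma> where g: "g \<in> compat_reps Q D N" "q g \<noteq> 0" "\<And>a. a < narrs Q \<Longrightarrow> src Q a \<noteq> k \<Longrightarrow> g a = h a"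
      and ex: "split_exact (D k) m w (stack (D k) g) (side w h) r \<sigma>" using transfer[OF h] by blast
    have rep: "is_rep Q D g" "is_rep Q D g0" "is_rep ?Q' ?D' h"
      using g(1) q(3) h(1) by (simp_all add: compat_reps_def)
    have "g \<in> U" using g q(1) P(2) by blast
    then have "rep_iso Q D g D g0" using iso g0(1) by blast
    moreover have "rep_iso Q D g0 D f" using g0(2) rep_iso_cong[of Q D D d D g0 f, OF wf HOL.refl d] by simp
    ultimately have "rep_iso Q D g D f" using rep_iso_trans wf rep(1,2) f_D by blast
    then have "rep_iso ?Q' ?D' h (D(k := d' k)) f'"
      by (rule rep_iso_reflection[OF rep(1) f_D _ rep(3) f'_D g(3) same ex ex'])
    then show ?thesis using rep_iso_cong[of ?Q' ?D' ?D' d' "D(k := d' k)" h f', OF wf' HOL.refl d'_eq] by simp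
  qed
  define U' where "U' = {h \<in> ?X'. \<exists>p'\<in>{p}. p' h \<noteq> 0}"
  have sigma: "(\<lambda>i. sum_list (sigma_part Q k t \<nu> i)) = ?D'"
    by (auto simp: sigma_part_def D_def w_def \<kappa>_def)
  have N': "?N' i \<in> carrier_mat (?D' i) (?D' i)" if "i < nverts ?Q'" for i using that N NK by simp
  have "U' \<noteq> {}" using p U'_def by blast
  moreover have "zariski_open_in ?Q' ?D' ?X' U'"
    unfolding zariski_open_in_def U'_def using p(1) by blast
  moreover have "zariski_dense_in ?Q' ?D' ?X' U'"
    unfolding zariski_dense_in_def
  proof (intro conjI allI impI)
    show "U' \<subseteq> ?X'" by (auto simp: U'_def)
    fix W assume W: "zariski_open_in ?Q' ?D' ?X' W \<and> W \<noteq> {}"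
    then obtain P' where P': "P' \<subseteq> poly_funs ?Q' ?D'" "W = {f \<in> ?X'. \<exists>p\<in>P'. p f \<noteq> 0}"
      unfolding zariski_open_in_def by blast
    with W obtain p' y where y: "p' \<in> P'" "y \<in> ?X'" "p' y \<noteq> 0" by blast
    \<comment> \<open>Applied to \<open>p\<close> and to a polynomial that is nonzero somewhere on
      \<open>W\<close>, irreducibility is exactly density of \<open>U'\<close>.\<close>
    obtain z where "z \<in> ?X'" "p z \<noteq> 0" "p' z \<noteq> 0"
      using compat_reps_irreducible[OF inf wf' N' p, of p' y] P'(1) y by blast
    then show "U' \<inter> W \<noteq> {}" using P'(2) y(1) U'_def by blast
  qed
  moreover have "rep_iso ?Q' ?D' g ?D' h" if "g \<in> U'" "h \<in> U'" for g h
  proof -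
    have gh: "g \<in> ?X'" "p g \<noteq> 0" "h \<in> ?X'" "p h \<noteq> 0" using that by (simp_all add: U'_def)
    then have rep: "is_rep ?Q' ?D' g" "is_rep ?Q' ?D' h" by (simp_all add: compat_reps_def)
    show ?thesis
      by (rule rep_iso_trans[OF iso'[OF gh(1,2)] rep_iso_sym[OF iso'[OF gh(3,4)] wf' rep(2) f'] wf' rep(1) f' rep(2)])
  qed
  moreover have "\<exists>g\<in>U'. rep_iso ?Q' ?D' g d' f'" using iso' p U'_def by blast
  moreover have "jordan_type (?N' i) (sigma_part Q k t \<nu> i)" if "i < nverts ?Q'" for i
    using that N(2) NK_type by (simp add: sigma_part_def \<kappa>_def)
  ultimately show ?thesis
    unfolding is_GenRep_def Let_def sigma
    using f' N' by (intro conjI exI[of _ ?N'] exI[of _ U']) blast+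
qed

end
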